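(* Let $\mathbb{F}$ be an ordered field, let $n\ge3$, and let $\mathcal{L}=\{L_1,\ldots,L_n\}$ be a line arrangement in $\mathbb{F}^2$ which has a (bounded) $n$-gonality. Let $U$ be the union of all bounded regions of the arrangement and consider the cyclic traversal $T$ of the boundary segments of $U$. Let $r$ be the number of extreme points of the arrangement and let $k$ be the number of non-outer points occurring as vertices on the traversal $T$. Then the arrangement has exactly $r$ unbounded $2$-gonalities, exactly $k$ unbounded $4$-gonalities, exactly $2n-r-k$ unbounded $3$-gonalities, and no unbounded $m$-gonalities with $m>4$.
   Context: An ordered field is a totally ordered field with $x\le y\Rightarrow x+z\le y+z$ and $x,y\ge0\Rightarrow xy\ge0$. A line arrangement is a finite set of lines with no two parallel and no three concurrent. If $L_i$ has equation $a_ix+b_iy=c_i$, a region is a set $\{(x,y):\varepsilon_i(a_ix+b_iy-c_i)\ge0\ \forall i\}$ containing a point with all inequalities strict; it is bounded if it contains no ray $\{v+tw:t\ge0\}$, $w\ne0$, and unbounded otherwise. An $n$-gonality is a bounded region met by every line in a segment between adjacent intersection points. An unbounded $m$-gonality is an unbounded region $R$ met by exactly $m$ lines such that for all but two of them the intersection with $R$ is a segment between two adjacent intersection points, while each of the two remaining lines meets $R$ in a set containing exactly one intersection point, as an end vertex. Inner coordinates: each line contains $n-1$ intersection points, linearly ordered along it; a point $P=L_i\cap L_j$ has as inner coordinates its positions in $\{1,\ldots,n-1\}$ on $L_i$ and on $L_j$ (defined up to sign mod $n$, i.e. up to reversing the order). $P$ is an outer point if it is the first or last intersection point on at least one of its two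 lines, a non-outer point otherwise, and an extreme point if it is the first or last intersection point on both of its lines. *)

theory Defs
  imports Main
begin

text \<open>
  The plane over an ordered field is the type of pairs over a \<^class>\<open>linordered_field\<close>; a line
  arrangement is a set of lines, each line being a set of points.
\<close>

definition line_eq :: "'a::linordered_field \<Rightarrow> 'a \<Rightarrow> 'a \<Rightarrow> ('a \<times> 'a) set \<Rightarrow> bool" where
  "line_eq a b c L \<longleftrightarrow> (a, b) \<noteq> (0, 0) \<and> L = {(x, y). a * x + b * y = c}"

definition is_line :: "('a::linordered_field \<times> 'a) set \<Rightarrow> bool" where
  "is_line L \<longleftrightarrow> (\<exists>a b c. line_eq a b c L)"

definition line_arrangement :: "('a::linordered_field \<times> 'a) set set \<Rightarrow> bool" where
  "line_arrangement \<L> \<longleftrightarrow>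
     finite \<L> \<and> (\<forall>L\<in>\<L>. is_line L) \<and>
     (\<forall>L\<in>\<L>. \<forall>M\<in>\<L>. L \<noteq> M \<longrightarrow> L \<inter> M \<noteq> {}) \<and>
     (\<forall>L\<in>\<L>. \<forall>M\<in>\<L>. \<forall>N\<in>\<L>. L \<noteq> M \<and> L \<noteq> N \<and> M \<noteq> N \<longrightarrow> L \<inter> M \<inter> N = {})"

definition ray :: "'a::linordered_field \<times> 'a \<Rightarrow> 'a \<times> 'a \<Rightarrow> ('a \<times> 'a) set" where
  "ray v w = {(fst v + t * fst w, snd v + t * snd w) | t. t \<ge> 0}"

definition seg :: "'a::linordered_field \<times> 'a \<Rightarrow> 'a \<times> 'a \<Rightarrow> ('a \<times> 'a) set" where
  "seg P Q = {(fst P + t * (fst Q - fst P), snd P + t * (snd Q - snd P)) | t. 0 \<le> t \<and> t \<le> 1}"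

text \<open>
  The regions do not depend on which equations \<open>a L x + b L y = c L\<close> are chosen for the lines,
  because all sign vectors \<open>\<epsilon>\<close> are allowed.
\<close>

definition region :: "('a::linordered_field \<times> 'a) set set \<Rightarrow> ('a \<times> 'a) set \<Rightarrow> bool" where
  "region \<L> R \<longleftrightarrow>
     (\<exists>a b c \<epsilon>. (\<forall>L\<in>\<L>. line_eq (a L) (b L) (c L) L \<and> \<epsilon> L \<in> {-1, 1}) \<and>
        R = {(x, y). \<forall>L\<in>\<L>. \<epsilon> L * (a L * x + b L * y - c L) \<ge> 0} \<and>
        (\<exists>x y. \<forall>L\<in>\<L>. \<epsilon> L * (a L * x + b L * y - c L) > 0))"

definition contains_ray :: "('a::linordered_field \<times> 'a) set \<Rightarrow> bool" where
  "contains_ray R \<longleftrightarrow> (\<exists>v w. w \<noteq> (0, 0) \<and> ray v w \<subseteq> R)"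

definition bounded_region :: "('a::linordered_field \<times> 'a) set set \<Rightarrow> ('a \<times> 'a) set \<Rightarrow> bool" where
  "bounded_region \<L> R \<longleftrightarrow> region \<L> R \<and> \<not> contains_ray R"

definition unbounded_region :: "('a::linordered_field \<times> 'a) set set \<Rightarrow> ('a \<times> 'a) set \<Rightarrow> bool" where
  "unbounded_region \<L> R \<longleftrightarrow> region \<L> R \<and> contains_ray R"

definition intersection_points :: "('a::linordered_field \<times> 'a) set set \<Rightarrow> ('a \<times> 'a) set" where
  "intersection_points \<L> = {P. \<exists>L\<in>\<L>. \<exists>M\<in>\<L>. L \<noteq> M \<and> P \<in> L \<and> P \<in> M}"

definition adjacent_points ::
  "('a::linordered_field \<times> 'a) set set \<Rightarrow> ('a \<times> 'a) set \<Rightarrow> 'a \<times> 'a \<Rightarrow> 'a \<times> 'a \<Rightarrow> bool" where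
  "adjacent_points \<L> L P Q \<longleftrightarrow>
     P \<noteq> Q \<and> P \<in> L \<inter> intersection_points \<L> \<and> Q \<in> L \<inter> intersection_points \<L> \<and>
     seg P Q \<inter> intersection_points \<L> = {P, Q}"

text \<open>
  Used for subsets \<open>S\<close> of a line.  The two linear orders of a line are the ones by the
  parameter \<open>t\<close> in \<open>P + t w\<close> for the two opposite directions \<open>w\<close>, so \<open>P\<close> is the first or last
  point of \<open>S\<close> iff \<open>S\<close> lies on one ray starting at \<open>P\<close>.
\<close>

definition end_of :: "'a::linordered_field \<times> 'a \<Rightarrow> ('a \<times> 'a) set \<Rightarrow> bool" where
  "end_of P S \<longleftrightarrow> P \<in> S \<and> (\<exists>w. S \<subseteq> ray P w)"

text \<open>
  For an arrangement of \<open>n\<close> lines this is an \<open>n\<close>-gonality, as all lines take part.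
\<close>

definition full_gonality :: "('a::linordered_field \<times> 'a) set set \<Rightarrow> ('a \<times> 'a) set \<Rightarrow> bool" where
  "full_gonality \<L> R \<longleftrightarrow> bounded_region \<L> R \<and>
     (\<forall>L\<in>\<L>. \<exists>P Q. adjacent_points \<L> L P Q \<and> L \<inter> R = seg P Q)"

definition unbounded_gonality ::
  "('a::linordered_field \<times> 'a) set set \<Rightarrow> nat \<Rightarrow> ('a \<times> 'a) set \<Rightarrow> bool" where
  "unbounded_gonality \<L> m R \<longleftrightarrow> unbounded_region \<L> R \<and>
     card {L\<in>\<L>. L \<inter> R \<noteq> {}} = m \<and>
     (\<exists>A\<in>\<L>. \<exists>B\<in>\<L>. A \<noteq> B \<and>
        (\<forall>L\<in>{A, B}. \<exists>P. L \<inter> R \<inter> intersection_points \<L> = {P} \<and> end_of P (L \<inter> R)) \<and>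
        (\<forall>L\<in>\<L> - {A, B}. L \<inter> R \<noteq> {} \<longrightarrow>
           (\<exists>P Q. adjacent_points \<L> L P Q \<and> L \<inter> R = seg P Q)))"

definition outer_point :: "('a::linordered_field \<times> 'a) set set \<Rightarrow> 'a \<times> 'a \<Rightarrow> bool" where
  "outer_point \<L> P \<longleftrightarrow> P \<in> intersection_points \<L> \<and>
     (\<exists>L\<in>\<L>. P \<in> L \<and> end_of P (L \<inter> intersection_points \<L>))"

definition non_outer_point :: "('a::linordered_field \<times> 'a) set set \<Rightarrow> 'a \<times> 'a \<Rightarrow> bool" where
  "non_outer_point \<L> P \<longleftrightarrow> P \<in> intersection_points \<L> \<and> \<not> outer_point \<L> P"

definition extreme_point :: "('a::linordered_field \<times> 'a) set set \<Rightarrow> 'a \<times> 'a \<Rightarrow> bool" where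
  "extreme_point \<L> P \<longleftrightarrow> P \<in> intersection_points \<L> \<and>
     (\<forall>L\<in>\<L>. P \<in> L \<longrightarrow> end_of P (L \<inter> intersection_points \<L>))"

definition bounded_union :: "('a::linordered_field \<times> 'a) set set \<Rightarrow> ('a \<times> 'a) set" where
  "bounded_union \<L> = \<Union> {R. bounded_region \<L> R}"

text \<open>
  The topological boundary with respect to the product of the order topologies, written out
  with open squares, since \<^class>\<open>linordered_field\<close> does not carry a topology.
\<close>

definition square :: "'a::linordered_field \<times> 'a \<Rightarrow> 'a \<Rightarrow> ('a \<times> 'a) set" where
  "square P e = {Q. \<bar>fst Q - fst P\<bar> < e \<and> \<bar>snd Q - snd P\<bar> < e}"

definition boundary :: "('a::linordered_field \<times> 'a) set \<Rightarrow> ('a \<times> 'a) set" where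
  "boundary S = {P. \<forall>e>0. square P e \<inter> S \<noteq> {} \<and> square P e - S \<noteq> {}}"

definition boundary_segments :: "('a::linordered_field \<times> 'a) set set \<Rightarrow> ('a \<times> 'a) set set" where
  "boundary_segments \<L> =
     {seg P Q | P Q. \<exists>L\<in>\<L>. adjacent_points \<L> L P Q \<and> seg P Q \<subseteq> boundary (bounded_union \<L>)}"

text \<open>
  A cyclic traversal is given by its cyclic list of vertices: each step runs from one vertex to
  the next along a boundary segment, and every boundary segment is used exactly once.
\<close>

definition cyclic_traversal ::
  "('a::linordered_field \<times> 'a) set set \<Rightarrow> ('a \<times> 'a) list \<Rightarrow> bool" where
  "cyclic_traversal \<L> T \<longleftrightarrow>
     bij_betw (\<lambda>i. seg (T ! i) (T ! (Suc i mod length T))) {..<length T} (boundary_segments \<L>)"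

end

theory Submission
  imports Defs
begin

text \<open>
  Direct the lines and sort them by angle, giving a family indexed by the integers in which the
  line \<open>k + n\<close> is the line \<open>k\<close> with its direction reversed.  Let \<open>J k\<close> say that the \<open>n\<close>-gonality
  \<open>G\<close> lies to the left of the directed line \<open>k\<close>.  Since every line carries a side of \<open>G\<close>, the
  orientation of each triangle formed by three of the lines can be read off from \<open>J\<close>, so all
  questions become combinatorial.  The \<open>2n\<close> unbounded regions \<open>R i\<close> are the ones whose directions
  lie between those of the lines \<open>i\<close> and \<open>i + 1\<close>.  If \<open>a\<close> and \<open>b\<close> are the first and last indices in
  \<open>{i+1..i+n}\<close> satisfying \<open>J\<close>, then exactly the lines \<open>i+1, a, b, i+n\<close> (which may coincide) meet
  \<open>R i\<close>, in this order along its boundary, the first and last in rays.  Hence there are between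
  two and four of them, and in the extreme cases the intersection point of the lines \<open>a\<close> and \<open>b\<close>
  determines \<open>R i\<close>: it is an extreme point if there are two lines, and a non-outer point on the
  traversal if there are four.  Walking around the \<open>R i\<close> in cyclic order gives the traversal.
\<close>

text \<open>The triangles can be read off from \<open>J\<close> because, for three directed lines
  within a half-turn, the middle form \<open>f k\<close> is a combination of the outer two with
  positive coefficients plus the constant \<open>tri\<close>; at a suitable side point
  \<open>h\<close> the signs of the remaining terms are given by \<open>J\<close>. The same constant
  decides whether the middle constraint of \<open>R i\<close> is implied by its neighbours
  (negative) or cuts off their common corner (positive), and this singles out \<open>a i\<close> and
  \<open>b i\<close>. A general ordered field offers no angles, compactness or Jordan curves. Signs
  of the cross product \<open>D\<close> replace angles, and unboundedness is treated by a ray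
  direction, which obeys the same linear identity. The topological boundary is tested at midpoints
  of segments, which lie on one line only and so in just two closed cells. The traversal is not
  unique, but a boundary segment determines its ends, so the set of its vertices is, and k does not
  depend on \<open>T\<close>. The number of regions met by three lines is obtained by subtraction
  from 2n.\<close>

lemma rayI: "t \<ge> 0 \<Longrightarrow> x = (fst v + t * d, snd v + t * e) \<Longrightarrow> x \<in> ray v (d, e)"
  unfolding ray_def fst_conv snd_conv by blast

lemma finite_common_bound:
  fixes P :: "'b \<Rightarrow> 'a::linordered_field \<Rightarrow> bool"
  assumes "finite A" "\<And>k. k \<in> A \<Longrightarrow> \<exists>e>0. P k e"
    and mono: "\<And>k e e'. P k e \<Longrightarrow> e' > 0 \<Longrightarrow> e' \<le> e \<Longrightarrow> P k e'"
  shows "\<exists>e>0. \<forall>k\<in>A. P k e"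
  using assms(1,2)
proof (induction A)
  case empty
  show ?case by (rule exI[of _ 1]) simp
next
  case (insert x A)
  then obtain e where e: "e > 0" "\<forall>k\<in>A. P k e" by auto
  obtain e' where e': "e' > 0" "P x e'" using insert.prems by auto
  show ?case using e e' mono by (intro exI[of _ "min e e'"]) auto
qed

lemma small_move:
  fixes e :: "'a::linordered_field"
  assumes "e > 0" obtains t where "t > 0" "(fst m + t * d, snd m + t * g) \<in> square m e"
proof
  \<comment> \<open>The denominator exceeds the absolute values of both \<open>d\<close> and
    \<open>g\<close>, and it is positive even if both vanish.\<close>
  let ?t = "e / (\<bar>d\<bar> + \<bar>g\<bar> + 1)"
  have pos: "\<bar>d\<bar> + \<bar>g\<bar> + 1 > 0" by (simp add: add_nonneg_pos)
  show t: "?t > 0" using assms pos by simp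
  have *: "\<bar>?t * s\<bar> < e" if "\<bar>s\<bar> < \<bar>d\<bar> + \<bar>g\<bar> + 1" for s
  proof -
    have "\<bar>?t * s\<bar> = ?t * \<bar>s\<bar>" using t by (simp only: abs_mult abs_of_pos)
    also have "\<dots> < ?t * (\<bar>d\<bar> + \<bar>g\<bar> + 1)" using that t by (rule mult_strict_left_mono)
    also have "\<dots> = e" using pos by simp
    finally show ?thesis .
  qed
  have "\<bar>d\<bar> < \<bar>d\<bar> + \<bar>g\<bar> + 1" "\<bar>g\<bar> < \<bar>d\<bar> + \<bar>g\<bar> + 1"
    by (simp_all add: add_nonneg_pos add_pos_nonneg add.commute add.left_commute)
  from *[OF this(1)] *[OF this(2)]
  show "(fst m + ?t * d, snd m + ?t * g) \<in> square m e" by (simp add: square_def)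
qed

lemma seg_commute: "seg P Q = seg Q P"
proof -
  have "seg P Q \<subseteq> seg Q P" for P Q :: "'a::linordered_field \<times> 'a"
  proof
    fix x assume "x \<in> seg P Q"
    then obtain t where t: "0 \<le> t" "t \<le> 1"
      "x = (fst P + t * (fst Q - fst P), snd P + t * (snd Q - snd P))" unfolding seg_def by blast
    have "x = (fst Q + (1 - t) * (fst P - fst Q), snd Q + (1 - t) * (snd P - snd Q))"
      unfolding t(3) by (simp add: algebra_simps)
    moreover have "0 \<le> 1 - t" "1 - t \<le> 1" using t by auto
    ultimately show "x \<in> seg Q P" unfolding seg_def by blast
  qed
  then show ?thesis by blast
qed

lemma ends_in_seg: "P \<in> seg P Q" "Q \<in> seg P Q"
proof -
  have *: "P \<in> seg P Q" for P Q :: "'a::linordered_field \<times> 'a"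
    unfolding seg_def by (cases P) (auto intro!: exI[of _ 0])
  show "P \<in> seg P Q" "Q \<in> seg P Q" using * seg_commute by metis+
qed

section \<open>Walks as lists of vertices\<close>

fun walk_edges :: "('a::linordered_field \<times> 'a) list \<Rightarrow> ('a \<times> 'a) set list" where
  "walk_edges (x # y # xs) = seg x y # walk_edges (y # xs)"
| "walk_edges _ = []"

lemma length_walk_edges: "length (walk_edges xs) = length xs - 1"
  by (induction xs rule: walk_edges.induct) auto

lemma nth_walk_edges: "Suc i < length xs \<Longrightarrow> walk_edges xs ! i = seg (xs ! i) (xs ! Suc i)"
  by (induction xs arbitrary: i rule: walk_edges.induct) (auto simp: nth_Cons split: nat.splits)

text \<open>Two walks are glued at a shared vertex, which must be listed only once; no edge is lost
  by this.\<close>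

lemma walk_edges_append:
  "xs \<noteq> [] \<Longrightarrow> ys \<noteq> [] \<Longrightarrow> last xs = hd ys \<Longrightarrow> walk_edges (xs @ tl ys) = walk_edges xs @ walk_edges ys"
proof (induction xs rule: walk_edges.induct)
  case ("2_2" x)
  then show ?case by (cases ys) auto
qed auto

lemma distinct_concat_map:
  assumes "\<And>i. i < N \<Longrightarrow> distinct (g i)" "\<And>i j. i < j \<Longrightarrow> j < N \<Longrightarrow> set (g i) \<inter> set (g j) = {}"
  shows "distinct (concat (map g [0..<N]))"
  using assms
proof (induction N)
  case (Suc N)
  have "set (concat (map g [0..<N])) \<inter> set (g N) = {}" using Suc.prems(2) by fastforce
  then show ?case using Suc by simp
qed simp

text \<open>The repeated closing vertex is dropped, because \<open>cyclic_traversal\<close> returns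
  to the start by taking the index modulo the length.\<close>

lemma closed_walk_bij:
  assumes "W \<noteq> []" "hd W = last W" "distinct (walk_edges W)"
  shows "\<exists>T. bij_betw (\<lambda>i. seg (T ! i) (T ! (Suc i mod length T))) {..<length T} (set (walk_edges W))"
proof
  let ?T = "butlast W"
  have len: "length (walk_edges W) = length ?T" by (simp add: length_walk_edges)
  have W: "W = ?T @ [last W]" using assms(1) by simp
  have eq: "walk_edges W ! i = seg (?T ! i) (?T ! (Suc i mod length ?T))" if i: "i < length ?T" for i
  proof -
    have "walk_edges W ! i = seg (W ! i) (W ! Suc i)" using i by (intro nth_walk_edges) simp
    moreover have "W ! i = ?T ! i" using i by (simp add: nth_butlast)
    moreover have "W ! Suc i = ?T ! (Suc i mod length ?T)"
    proof (cases "Suc i = length ?T")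
      case True
      then have "W ! Suc i = last W" using W by (metis nth_append_length)
      moreover have "?T ! 0 = hd W" using i assms(1) by (cases W) (auto simp: nth_butlast hd_conv_nth)
      ultimately show ?thesis using True assms(2) by simp
    next
      case False
      then show ?thesis using i by (simp add: nth_butlast)
    qed
    ultimately show ?thesis by simp
  qed
  have "bij_betw ((!) (walk_edges W)) {..<length ?T} (set (walk_edges W))"
    using bij_betw_nth[OF assms(3)] len by simp
  then show "bij_betw (\<lambda>i. seg (?T ! i) (?T ! (Suc i mod length ?T))) {..<length ?T} (set (walk_edges W))"
    using eq by (subst bij_betw_cong[where g = "(!) (walk_edges W)"]) auto
qed

text \<open>The vector \<open>(p k, q k)\<close> is the direction of line \<open>k\<close>,
  \<open>f k\<close> is positive to its left, and \<open>D j k\<close> is the cross product of two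
  directions. The point \<open>h k\<close> belongs to the side of the polygon on line
  \<open>k\<close> and to no other line, whence the strict signs in \<open>h_pos\<close> and
  \<open>h_neg\<close>. The boundedness of the polygon enters as \<open>J_ex\<close>: without
  \<open>J\<close> on the window, the polygon would contain a ray in the direction of line
  \<open>i\<close>.\<close>

locale polygon_lines =
  fixes n :: int
    and p q c :: "int \<Rightarrow> 'a::linordered_field"
    and J :: "int \<Rightarrow> bool"
    and h :: "int \<Rightarrow> 'a \<times> 'a"
    and f :: "int \<Rightarrow> 'a \<times> 'a \<Rightarrow> 'a"
    and D :: "int \<Rightarrow> int \<Rightarrow> 'a"
  defines "f \<equiv> \<lambda>k x. p k * snd x - q k * fst x - c k"
    and "D \<equiv> \<lambda>j k. p j * q k - q j * p k"
  assumes n3: "n \<ge> 3"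
    and p_anti: "p (k + n) = - p k"
    and q_anti: "q (k + n) = - q k"
    and c_anti: "c (k + n) = - c k"
    and D_pos: "j < k \<Longrightarrow> k < j + n \<Longrightarrow> D j k > 0"
    and h_zero: "f k (h k) = 0"
    and h_pos: "\<not> n dvd j - k \<Longrightarrow> J j \<Longrightarrow> f j (h k) > 0"
    and h_neg: "\<not> n dvd j - k \<Longrightarrow> \<not> J j \<Longrightarrow> f j (h k) < 0"
    and J_ex: "\<exists>j\<in>{i+1..i+n}. J j"
begin

definition line :: "int \<Rightarrow> ('a \<times> 'a) set" where
  "line k = {x. f k x = 0}"

text \<open>The sign of \<open>tri j k b\<close> is the orientation of the triangle formed by the three lines.\<close>

definition tri :: "int \<Rightarrow> int \<Rightarrow> int \<Rightarrow> 'a" where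
  "tri j k b = D k b * c j + D j k * c b - D j b * c k"

text \<open>Cramer's rule for the common zero of \<open>f j\<close> and \<open>f k\<close>; it is
  meaningful only if \<open>D j k\<close> is nonzero.\<close>

definition V :: "int \<Rightarrow> int \<Rightarrow> 'a \<times> 'a" where
  "V j k = ((c j * p k - p j * c k) / D j k, (q k * c j - q j * c k) / D j k)"

text \<open>The closed cell around a point \<open>z\<close> that is on no line. Upper bounds are
  covered too, since \<open>k\<close> ranges over all integers and \<open>f (k + n)\<close> is the
  negative of \<open>f k\<close>.\<close>

definition cell :: "'a \<times> 'a \<Rightarrow> ('a \<times> 'a) set" where
  "cell z = {x. \<forall>k. f k z > 0 \<longrightarrow> f k x \<ge> 0}"

text \<open>A direction strictly between those of lines \<open>i\<close> and \<open>i+1\<close>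
  points to the right of each of the lines \<open>i+1\<close> to \<open>i+n\<close>, which explains
  the window and the sign.\<close>

definition R :: "int \<Rightarrow> ('a \<times> 'a) set" where
  "R i = {x. \<forall>k\<in>{i+1..i+n}. f k x \<le> 0}"

section \<open>Index shifts by n and by 2n\<close>

lemma f_anti: "f (k + n) x = - f k x"
  by (simp add: f_def p_anti q_anti c_anti)

lemma f_periodic: "f (k + 2 * n) x = f k x"
  using f_anti[of k x] f_anti[of "k + n" x] by (simp add: algebra_simps)

lemma f_mult: "f (k + int m * n) x = (-1) ^ m * f k x"
proof (induction m)
  case (Suc m)
  have "f (k + int (Suc m) * n) x = f ((k + int m * n) + n) x" by (simp add: algebra_simps)
  with Suc f_anti show ?case by simp
qed simp

lemma f_dvd: assumes "n dvd j - k" shows "(\<forall>x. f j x = f k x) \<or> (\<forall>x. f j x = - f k x)"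
proof -
  obtain r where r: "j = k + n * r" using assms by (metis add.commute diff_add_cancel dvdE)
  show ?thesis
  proof (cases "r \<ge> 0")
    case True
    then have "j = k + int (nat r) * n" using r by simp
    then have "f j x = (-1) ^ nat r * f k x" for x by (simp only: f_mult)
    then show ?thesis by (cases "even (nat r)") auto
  next
    case False
    then have "k = j + int (nat (-r)) * n" using r by simp
    then have "f k x = (-1) ^ nat (-r) * f j x" for x by (simp only: f_mult)
    then show ?thesis by (cases "even (nat (-r))") auto
  qed
qed

lemma f_zero_dvd: "n dvd j - k \<Longrightarrow> f j x = 0 \<longleftrightarrow> f k x = 0"
  using f_dvd[of j k] by (metis neg_equal_0_iff_equal)

lemma line_eq_of_dvd: "n dvd j - k \<Longrightarrow> line j = line k"
  by (simp add: line_def f_zero_dvd)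

lemma rep_ex: obtains k' where "k' \<in> {i+1..i+n}" "n dvd k - k'"
proof
  let ?k = "i + 1 + (k - i - 1) mod n"
  have "0 \<le> (k - i - 1) mod n" "(k - i - 1) mod n < n" using n3 by simp_all
  then show "?k \<in> {i+1..i+n}" by simp
  show "n dvd k - ?k" using dvd_minus_mod[of n "k - i - 1"] by (simp add: algebra_simps)
qed

lemma dvd_small: "n dvd j - k \<Longrightarrow> \<bar>j - k\<bar> < n \<Longrightarrow> j = k"
  using dvd_imp_le_int[of "j-k" n] n3 by force

lemma not_dvd: "j < k \<Longrightarrow> k < j + n \<Longrightarrow> \<not> n dvd k - j \<and> \<not> n dvd j - k"
  using dvd_small[of j k] dvd_small[of k j] by auto

lemma J_anti: "J (k + n) \<longleftrightarrow> \<not> J k"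
proof -
  \<comment> \<open>\<open>h (k+1)\<close> lies off the common line of \<open>k\<close> and
    \<open>k + n\<close>, so the opposite signs of the two forms can be compared there.\<close>
  have nd: "\<not> n dvd k - (k + 1)" "\<not> n dvd (k + n) - (k + 1)"
    using n3 not_dvd[of k "k+1"] not_dvd[of "k+1" "k + n"] by auto
  show ?thesis
    using f_anti[of k "h (k+1)"] h_pos[OF nd(1)] h_neg[OF nd(1)] h_pos[OF nd(2)] h_neg[OF nd(2)]
    by (smt (verit) neg_less_0_iff_less less_asym)
qed

lemma J_periodic: "J (k + 2 * n) \<longleftrightarrow> J k"
  using J_anti[of k] J_anti[of "k + n"] by (simp add: algebra_simps)

section \<open>Linear identities and orientations of triangles\<close>

lemma D_swap: "D k j = - D j k"
  by (simp add: D_def)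

lemma f_move: "f k (fst x + t * p j, snd x + t * q j) = f k x + t * D k j"
  by (simp add: f_def D_def algebra_simps)

lemma f_affine:
  "f k (fst x + t * (fst y - fst x), snd x + t * (snd y - snd x)) = (1 - t) * f k x + t * f k y"
  by (simp add: f_def algebra_simps)

text \<open>Any three vectors of the plane are linearly related with their cross products as
  coefficients; for the linear parts of the three forms this leaves the constant \<open>tri\<close>.
  If \<open>j < k < b < j + n\<close>, the coefficients are positive, so at the intersection of the
  outer lines \<open>f k\<close> has the sign of \<open>tri j k b\<close>.\<close>

lemma tri_eq: "D j b * f k x = D k b * f j x + D j k * f b x + tri j k b"
  by (simp add: f_def D_def tri_def algebra_simps)

lemma V_on: assumes "D j k \<noteq> 0" shows "f j (V j k) = 0" "f k (V j k) = 0"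
  using assms by (simp_all add: V_def f_def field_simps) (simp_all add: D_def algebra_simps)

lemma V_unique: assumes "D j k \<noteq> 0" "f j x = f j y" "f k x = f k y" shows "x = y"
proof -
  have 1: "p j * (snd x - snd y) = q j * (fst x - fst y)" "p k * (snd x - snd y) = q k * (fst x - fst y)"
    using assms(2,3) by (simp_all add: f_def algebra_simps)
  have "D j k * (snd x - snd y) = q k * (p j * (snd x - snd y)) - q j * (p k * (snd x - snd y))"
    by (simp add: D_def algebra_simps)
  also have "\<dots> = 0" unfolding 1 by (simp add: algebra_simps)
  finally have a: "snd x = snd y" using assms(1) by simp
  have "D j k * (fst x - fst y) = p j * (q k * (fst x - fst y)) - p k * (q j * (fst x - fst y))"
    by (simp add: D_def algebra_simps)
  also have "\<dots> = 0" unfolding 1[symmetric] by (simp add: algebra_simps)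
  finally have "fst x = fst y" using assms(1) by simp
  with a show ?thesis by (simp add: prod_eq_iff)
qed

text \<open>Evaluating \<open>tri_eq\<close> at \<open>h j\<close>, \<open>h k\<close> or \<open>h b\<close> determines the sign in each of the eight cases.\<close>

lemma tri_sign:
  assumes "j < k" "k < b" "b < j + n"
  shows "if (if J j = J b then J j else \<not> J k) then tri j k b < 0 else tri j k b > 0"
proof -
  have D: "D j b > 0" "D k b > 0" "D j k > 0" using assms D_pos by auto
  have nd: "\<not> n dvd j - k" "\<not> n dvd k - j" "\<not> n dvd j - b" "\<not> n dvd b - j"
    "\<not> n dvd k - b" "\<not> n dvd b - k"
    using assms not_dvd[of j k] not_dvd[of k b] not_dvd[of j b] by auto
  have ek: "0 = D k b * f j (h k) + D j k * f b (h k) + tri j k b"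
    using tri_eq[of j b k "h k"] h_zero[of k] by simp
  have ej: "D j b * f k (h j) = D j k * f b (h j) + tri j k b"
    using tri_eq[of j b k "h j"] h_zero[of j] by simp
  have eb: "D j b * f k (h b) = D k b * f j (h b) + tri j k b"
    using tri_eq[of j b k "h b"] h_zero[of b] by simp
  note S = mult_pos_pos mult_pos_neg
  consider "J j" "J b" | "\<not> J j" "\<not> J b" | "J j" "J k" "\<not> J b" | "J j" "\<not> J k" "\<not> J b"
    | "\<not> J j" "J k" "J b" | "\<not> J j" "\<not> J k" "J b" by blast
  then show ?thesis
  proof cases
    case 1 then show ?thesis
      using ek S(1)[OF D(2) h_pos[OF nd(1)]] S(1)[OF D(3) h_pos[OF nd(6)]] by simp
  next
    case 2 then show ?thesis
      using ek S(2)[OF D(2) h_neg[OF nd(1)]] S(2)[OF D(3) h_neg[OF nd(6)]] by simp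
  next
    case 3 then show ?thesis
      using ej S(1)[OF D(1) h_pos[OF nd(2)]] S(2)[OF D(3) h_neg[OF nd(4)]] by simp
  next
    case 4 then show ?thesis
      using eb S(2)[OF D(1) h_neg[OF nd(5)]] S(1)[OF D(2) h_pos[OF nd(3)]] by simp
  next
    case 5 then show ?thesis
      using eb S(1)[OF D(1) h_pos[OF nd(5)]] S(2)[OF D(2) h_neg[OF nd(3)]] by simp
  next
    case 6 then show ?thesis
      using ej S(2)[OF D(1) h_neg[OF nd(2)]] S(1)[OF D(3) h_pos[OF nd(4)]] by simp
  qed
qed

lemma tri_nonzero: "j < k \<Longrightarrow> k < b \<Longrightarrow> b < j + n \<Longrightarrow> tri j k b \<noteq> 0"
  using tri_sign[of j k b] by (auto split: if_splits)

text \<open>General position is not an assumption of the locale: it follows from the fact that every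
  line carries a side of the polygon.\<close>

lemma no_concurrent_ordered:
  assumes "j < k" "k < b" "b < j + n" "f j x = 0" "f k x = 0" "f b x = 0" shows False
  using tri_nonzero[OF assms(1-3)] tri_eq[of j b k x] assms by simp

section \<open>Lines and intersection points in terms of indices\<close>

lemma line_eq_iff: "line j = line k \<longleftrightarrow> n dvd j - k"
proof
  assume eq: "line j = line k"
  have "h k \<in> line k" using h_zero by (simp add: line_def)
  then have "f j (h k) = 0" using eq by (auto simp: line_def)
  then show "n dvd j - k" using h_pos[of j k] h_neg[of j k] by force
qed (rule line_eq_of_dvd)

lemma inj_line: "inj_on line {i+1..i+n}"
  by (rule inj_onI) (use dvd_small in \<open>force simp: line_eq_iff\<close>)

lemma mem_line [simp]: "x \<in> line k \<longleftrightarrow> f k x = 0"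
  by (simp add: line_def)

lemma range_line: "range line = line ` {i+1..i+n}"
proof -
  have "line k \<in> line ` {i+1..i+n}" for k
    using rep_ex[of i k] line_eq_of_dvd by (metis imageI)
  then show ?thesis by blast
qed

lemma intersection_points_iff:
  "x \<in> intersection_points (range line) \<longleftrightarrow> (\<exists>j k. \<not> n dvd j - k \<and> f j x = 0 \<and> f k x = 0)"
  unfolding intersection_points_def by (auto simp: line_eq_iff)

lemma intersection_point_second_line:
  assumes "x \<in> intersection_points (range line)" "f k x = 0" "k \<in> {i+1..i+n}"
  obtains l where "l \<in> {i+1..i+n}" "l \<noteq> k" "f l x = 0"
proof -
  obtain j m where jm: "\<not> n dvd j - m" "f j x = 0" "f m x = 0"
    using assms intersection_points_iff by auto
  obtain j' where j': "j' \<in> {i+1..i+n}" "n dvd j - j'" by (rule rep_ex)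
  obtain m' where m': "m' \<in> {i+1..i+n}" "n dvd m - m'" by (rule rep_ex)
  have "j' \<noteq> m'" using jm(1) dvd_diff[OF j'(2) m'(2)] by auto
  then show ?thesis
    using that[of j'] that[of m'] j' m' jm f_zero_dvd[OF j'(2), of x] f_zero_dvd[OF m'(2), of x] by auto
qed

subsection \<open>The lines meeting an unbounded region\<close>

definition a :: "int \<Rightarrow> int" where "a i = Min {j\<in>{i+1..i+n}. J j}"
definition b :: "int \<Rightarrow> int" where "b i = Max {j\<in>{i+1..i+n}. J j}"
definition C :: "int \<Rightarrow> int set" where "C i = {i+1, a i, b i, i+n}"

lemma a_in: "a i \<in> {i+1..i+n}" "J (a i)" and b_in: "b i \<in> {i+1..i+n}" "J (b i)" and a_le_b: "a i \<le> b i"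
  and a_min: "k \<in> {i+1..i+n} \<Longrightarrow> J k \<Longrightarrow> a i \<le> k"
  and b_max: "k \<in> {i+1..i+n} \<Longrightarrow> J k \<Longrightarrow> k \<le> b i"
proof -
  let ?S = "{j\<in>{i+1..i+n}. J j}"
  have "finite ?S" by (rule finite_subset[of _ "{i+1..i+n}"]) auto
  moreover have "?S \<noteq> {}" using J_ex[of i] by auto
  ultimately have "finite ?S" "?S \<noteq> {}" by auto
  from Min_in[OF this] Max_in[OF this]
  show "a i \<in> {i+1..i+n}" "J (a i)" "b i \<in> {i+1..i+n}" "J (b i)"
    by (auto simp: a_def b_def)
  show "k \<in> {i+1..i+n} \<Longrightarrow> J k \<Longrightarrow> a i \<le> k" "k \<in> {i+1..i+n} \<Longrightarrow> J k \<Longrightarrow> k \<le> b i" for k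
    using Min_le[OF \<open>finite ?S\<close>, of k] Max_ge[OF \<open>finite ?S\<close>, of k] by (auto simp: a_def b_def)
  then show "a i \<le> b i" using \<open>a i \<in> _\<close> \<open>J (a i)\<close> by blast
qed

lemma a_eq_first_iff: "a i = i + 1 \<longleftrightarrow> J (i + 1)"
  using a_in[of i] a_min[of "i+1" i] n3 by auto

lemma b_eq_last_iff: "b i = i + n \<longleftrightarrow> \<not> J i"
  using b_in[of i] b_max[of "i+n" i] n3 J_anti[of i] by auto

text \<open>If only one line separated the region from the polygon and it were a ray line of the region,
  then \<open>J\<close> would fail on a whole window, making the polygon unbounded.\<close>

lemma a_eq_b_imp: assumes "a i = b i" shows "i + 1 < a i" "a i < i + n"
proof -
  have one: "k = a i" if "k \<in> {i+1..i+n}" "J k" for k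
    using a_min[OF that] b_max[OF that] assms by simp
  have "\<not> J (i+1)"
  proof
    assume "J (i+1)"
    then have ai: "a i = i + 1" using a_eq_first_iff by simp
    obtain j where j: "j \<in> {i+1+1..i+1+n}" "J j" using J_ex[of "i+1"] by auto
    have "j \<noteq> i + 1 + n" using j(2) J_anti[of "i+1"] \<open>J (i+1)\<close> by auto
    then show False using one[of j] j ai by auto
  qed
  then show "i + 1 < a i" using a_eq_first_iff[of i] a_in[of i] by auto
  have "\<not> J (i + n)"
  proof
    assume Ji: "J (i + n)"
    then have ai: "a i = i + n" using one[of "i+n"] n3 by simp
    obtain j where j: "j \<in> {i-1+1..i-1+n}" "J j" using J_ex[of "i-1"] by auto
    have "j \<noteq> i" using j(2) J_anti[of "i"] Ji by auto
    then show False using one[of j] j ai by auto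
  qed
  then show "a i < i + n" using a_in[of i] by (cases "a i = i + n") auto
qed

text \<open>Three elements arise in three ways: from \<open>a i = i+1\<close> alone, from
  \<open>b i = i+n\<close> alone, or from \<open>a i = b i\<close> strictly inside the
  window.\<close>

lemma C_cases:
  obtains (two) "C i = {i+1, i+n}"
  | (three) m where "i + 1 < m" "m < i + n" "C i = {i+1, m, i+n}"
  | (four) "i + 1 < a i" "a i < b i" "b i < i + n" "C i = {i+1, a i, b i, i+n}"
proof -
  have o: "i + 1 \<le> a i" "a i \<le> b i" "b i \<le> i + n" "a i = b i \<Longrightarrow> i + 1 < a i \<and> a i < i + n"
    using a_in[of i] b_in[of i] a_le_b[of i] a_eq_b_imp[of i] by auto
  consider "a i = i + 1" "b i = i + n" | "a i = i + 1" "b i < i + n" | "i + 1 < a i" "b i = i + n"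
    | "i + 1 < a i" "b i < i + n" "a i = b i" | "i + 1 < a i" "b i < i + n" "a i < b i"
    using o by linarith
  then show thesis
  proof cases
    case 1 then show thesis using two by (simp add: C_def insert_commute)
  next
    case 2 then show thesis using three[of "b i"] o by (force simp: C_def)
  next
    case 3 then show thesis using three[of "a i"] o by (force simp: C_def)
  next
    case 4 then show thesis using three[of "a i"] by (simp add: C_def)
  next
    case 5 then show thesis using four by (simp add: C_def)
  qed
qed

lemma C_sub: "C i \<subseteq> {i+1..i+n}" and first_in_C: "i + 1 \<in> C i" and last_in_C: "i + n \<in> C i"
  using a_in[of i] b_in[of i] n3 by (auto simp: C_def)

lemma C_span: assumes "j \<in> C i" "l \<in> C i" shows "l < j + n"
  using subsetD[OF C_sub assms(1)] subsetD[OF C_sub assms(2)] by simp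

text \<open>The middle one of three members of \<open>C i\<close> is \<open>a i\<close> or
  \<open>b i\<close>, so \<open>J\<close> holds there, and it cannot hold at both outer ones as
  well. In \<open>tri_sign\<close> all remaining patterns are positive. Geometrically, the middle
  line cuts off the corner of the outer two, so no line of \<open>C i\<close> is redundant.\<close>

lemma tri_pos_C:
  assumes "j \<in> C i" "k \<in> C i" "l \<in> C i" "j < k" "k < l" shows "tri j k l > 0"
proof -
  have "l < j + n" using assms C_span by blast
  note T = tri_sign[OF assms(4,5) this]
  have J: "J (a i)" "J (b i)" using a_in b_in by auto
  have first: "\<not> J (i+1)" if "a i \<noteq> i+1" using that a_eq_first_iff by auto
  have last: "\<not> J (i+n)" if "b i \<noteq> i+n" using that b_eq_last_iff[of i] J_anti[of i] by auto
  have o: "i + 1 \<le> a i" "a i \<le> b i" "b i \<le> i + n" "a i = b i \<Longrightarrow> i + 1 < a i \<and> a i < i + n"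
    using a_in b_in a_le_b a_eq_b_imp by auto
  have C: "j \<in> {i+1, a i, b i, i+n}" "k \<in> {i+1, a i, b i, i+n}" "l \<in> {i+1, a i, b i, i+n}"
    using assms by (auto simp: C_def)
  have k: "k = a i \<or> k = b i" using C assms o by auto
  then have "J k" using J by auto
  moreover have "\<not> (J j \<and> J l)"
  proof
    assume jl: "J j \<and> J l"
    have "x = a i \<or> x = b i" if "J x" "x \<in> {i+1, a i, b i, i+n}" for x
      using that first last by (metis insertE empty_iff)
    then have "j = a i \<or> j = b i" "l = a i \<or> l = b i" using jl C by blast+
    then show False using assms(4,5) o(2) k by linarith
  qed
  ultimately show ?thesis using T by (auto split: if_splits)
qed

text \<open>The flanking lines depend on the place of \<open>k\<close>: \<open>i+1\<close> and
  \<open>a i\<close> before \<open>a i\<close>, then \<open>a i\<close> and \<open>b i\<close>, and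
  \<open>b i\<close> and \<open>i+n\<close> after \<open>b i\<close>. In the first and last case
  \<open>J k\<close> fails by the choice of \<open>a i\<close> and \<open>b i\<close>; in the middle
  case both neighbours satisfy \<open>J\<close>, which settles the sign for any
  \<open>k\<close>.\<close>

lemma tri_neg_off_C:
  assumes "k \<in> {i+1..i+n}" "k \<notin> C i"
  obtains j l where "j \<in> C i" "l \<in> C i" "j < k" "k < l" "tri j k l < 0"
proof -
  have kne: "k \<noteq> i+1" "k \<noteq> a i" "k \<noteq> b i" "k \<noteq> i + n" using assms by (auto simp: C_def)
  have J: "J (a i)" "J (b i)" using a_in b_in by auto
  consider "k < a i" | "a i < k" "k < b i" | "b i < k" using kne by linarith
  then show ?thesis
  proof cases
    case 1
    have "\<not> J k" "\<not> J (i+1)" using a_min[of k i] a_min[of "i+1" i] 1 assms n3 by auto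
    then show ?thesis using that[of "i+1" "a i"] tri_sign[of "i+1" k "a i"] 1 kne assms J a_in[of i]
      by (auto simp: C_def)
  next
    case 2
    then show ?thesis using that[of "a i" "b i"] tri_sign[of "a i" k "b i"] J a_in[of i] b_in[of i]
      by (auto simp: C_def)
  next
    case 3
    have "\<not> J k" "\<not> J (i+n)" using b_max[of k i] b_max[of "i+n" i] 3 assms n3 by auto
    then show ?thesis using that[of "b i" "i+n"] tri_sign[of "b i" k "i+n"] 3 kne assms J b_in[of i]
      by (auto simp: C_def)
  qed
qed

text \<open>By \<open>tri_eq\<close>, a positive multiple of \<open>f k\<close> is a sum of two
  nonpositive terms and a negative constant, so the constraint of \<open>k\<close> is strictly
  implied by those of two lines in \<open>C i\<close>.\<close>

lemma off_C_neg:
  assumes "\<forall>j\<in>C i. f j x \<le> 0" "k \<in> {i+1..i+n}" "k \<notin> C i" shows "f k x < 0"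
proof -
  obtain j l where jl: "j \<in> C i" "l \<in> C i" "j < k" "k < l" "tri j k l < 0"
    using tri_neg_off_C[OF assms(2,3)] .
  have "l < j + n" using jl C_span by blast
  then have D: "D j l > 0" "D k l > 0" "D j k > 0" using jl by (auto intro!: D_pos)
  have "f j x \<le> 0" "f l x \<le> 0" using assms jl by auto
  then have "D j l * f k x < 0"
    using tri_eq[of j l k x] jl(5) D
    by (smt (verit) add_neg_nonpos add_nonpos_neg add_nonpos_nonpos mult_nonneg_nonpos less_imp_le)
  then show ?thesis using D by (simp add: mult_less_0_iff)
qed

lemma R_iff: "x \<in> R i \<longleftrightarrow> (\<forall>k\<in>C i. f k x \<le> 0)"
  using off_C_neg[of i x] C_sub[of i] unfolding R_def by force

lemma R_off_C: "x \<in> R i \<Longrightarrow> k \<in> {i+1..i+n} \<Longrightarrow> k \<notin> C i \<Longrightarrow> f k x < 0"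
  using off_C_neg R_iff by blast

section \<open>Vertices and edges of the unbounded regions\<close>

definition nxt :: "int \<Rightarrow> int \<Rightarrow> int \<Rightarrow> bool" where
  "nxt i j k \<longleftrightarrow> j \<in> C i \<and> k \<in> C i \<and> j < k \<and> (\<forall>l\<in>C i. \<not> (j < l \<and> l < k))"

lemma nxt_unique: "nxt i j k \<Longrightarrow> nxt i j k' \<Longrightarrow> k = k'" "nxt i j k \<Longrightarrow> nxt i j' k \<Longrightarrow> j = j'"
  unfolding nxt_def by (metis linorder_cases)+

lemma finite_C: "finite (C i)" by (simp add: C_def)

lemma nxt_ex: assumes "k \<in> C i" "k \<noteq> i + n" obtains l where "nxt i k l"
proof -
  let ?S = "{l\<in>C i. k < l}"
  have "i + n \<in> ?S" using assms last_in_C[of i] subsetD[OF C_sub assms(1)] by auto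
  then have S: "finite ?S" "?S \<noteq> {}" using finite_C by auto
  have "Min ?S \<in> C i" "k < Min ?S" using Min_in[OF S] by auto
  moreover have "\<not> (k < l \<and> l < Min ?S)" if "l \<in> C i" for l using Min_le[OF S(1), of l] that by auto
  ultimately have "nxt i k (Min ?S)" using assms unfolding nxt_def by blast
  then show ?thesis by (rule that)
qed

lemma prev_ex: assumes "k \<in> C i" "k \<noteq> i + 1" obtains l where "nxt i l k"
proof -
  let ?S = "{l\<in>C i. l < k}"
  have "i + 1 \<in> ?S" using assms first_in_C[of i] subsetD[OF C_sub assms(1)] by auto
  then have S: "finite ?S" "?S \<noteq> {}" using finite_C by auto
  have "Max ?S \<in> C i" "Max ?S < k" using Max_in[OF S] by auto
  moreover have "\<not> (Max ?S < l \<and> l < k)" if "l \<in> C i" for l using Max_ge[OF S(1), of l] that by auto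
  ultimately have "nxt i (Max ?S) k" using assms unfolding nxt_def by blast
  then show ?thesis by (rule that)
qed

lemma nxt_D: assumes "nxt i j k" shows "D j k > 0" "j \<in> {i+1..i+n}" "k \<in> {i+1..i+n}" "j < k" "k < j + n"
proof -
  have C: "j \<in> C i" "k \<in> C i" "j < k" using assms by (auto simp: nxt_def)
  then show "j \<in> {i+1..i+n}" "k \<in> {i+1..i+n}" "j < k" using C_sub[of i] by blast+
  show "k < j + n" using C C_span by blast
  then show "D j k > 0" using C by (intro D_pos)
qed

lemma nxt_V_on: assumes "nxt i j k" shows "f j (V j k) = 0" "f k (V j k) = 0"
  using V_on[of j k] nxt_D[OF assms] by auto

text \<open>As \<open>j\<close> and \<open>k\<close> are consecutive, \<open>l\<close> comes before
  or after both. In \<open>tri_eq\<close> at \<open>V j k\<close> the terms of \<open>j\<close> and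
  \<open>k\<close> vanish, which leaves \<open>f l\<close> with the sign opposite to the positive
  \<open>tri\<close>.\<close>

lemma V_in_C: assumes "nxt i j k" "l \<in> C i" "l \<noteq> j" "l \<noteq> k" shows "f l (V j k) < 0"
proof -
  have jk: "j \<in> C i" "k \<in> C i" "j < k" using assms by (auto simp: nxt_def)
  have D: "D j k > 0" using nxt_D assms by auto
  have "l < j \<or> k < l" using assms unfolding nxt_def by (meson linorder_neqE_linordered_idom)
  then have "D j k * f l (V j k) < 0"
  proof
    assume "l < j"
    then have "tri l j k > 0" using tri_pos_C[OF assms(2) jk(1,2)] jk by auto
    then show ?thesis using tri_eq[of l k j "V j k"] V_on[of j k] D by auto
  next
    assume "k < l"
    then have "tri j k l > 0" using tri_pos_C[OF jk(1,2) assms(2)] jk by auto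
    then show ?thesis using tri_eq[of j l k "V j k"] V_on[of j k] D by auto
  qed
  then show ?thesis using D by (simp add: mult_less_0_iff)
qed

lemma V_in_R: assumes "nxt i j k" shows "V j k \<in> R i"
proof -
  have "f l (V j k) \<le> 0" if "l \<in> C i" for l
    using V_in_C[OF assms that] nxt_V_on[OF assms] by force
  then show ?thesis by (simp add: R_iff)
qed

lemma V_neg: assumes "nxt i j k" "l \<in> {i+1..i+n}" "l \<noteq> j" "l \<noteq> k" shows "f l (V j k) < 0"
  using V_in_C[OF assms(1) _ assms(3,4)] R_off_C[OF V_in_R[OF assms(1)] assms(2)] by blast

lemma V_intersection: assumes "nxt i j k" shows "V j k \<in> intersection_points (range line)"
  using nxt_V_on[OF assms] not_dvd[of j k] nxt_D[OF assms] unfolding intersection_points_iff by blast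

text \<open>A common point of two non-consecutive lines of \<open>C i\<close> is cut off from
  \<open>R i\<close> by any line of \<open>C i\<close> between them, by
  \<open>tri_pos_C\<close>.\<close>

lemma R_line_vertex:
  assumes "x \<in> R i" "f k x = 0" "k \<in> {i+1..i+n}" "x \<in> intersection_points (range line)"
  shows "(\<exists>l. nxt i k l \<and> x = V k l) \<or> (\<exists>l. nxt i l k \<and> x = V l k)"
proof -
  obtain l where l: "l \<in> {i+1..i+n}" "l \<noteq> k" "f l x = 0"
    using intersection_point_second_line[OF assms(4,2,3)] .
  have C: "k \<in> C i" "l \<in> C i" using R_off_C[OF assms(1)] assms l by force+
  have key: "nxt i j m \<and> x = V j m" if "j \<in> C i" "m \<in> C i" "j < m" "f j x = 0" "f m x = 0" for j m
  proof -
    have bd: "j \<in> {i+1..i+n}" "m \<in> {i+1..i+n}" using that C_sub[of i] by auto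
    have "\<not> (j < r \<and> r < m)" if r: "r \<in> C i" for r
    proof
      assume jr: "j < r \<and> r < m"
      have "tri j r m > 0" using tri_pos_C[OF \<open>j \<in> C i\<close> r \<open>m \<in> C i\<close>] jr by auto
      then have "D j m * f r x > 0" using tri_eq[of j m r x] \<open>f j x = 0\<close> \<open>f m x = 0\<close> by simp
      moreover have "D j m > 0" using bd jr by (intro D_pos) auto
      moreover have "f r x \<le> 0" using assms(1) r by (simp add: R_iff)
      ultimately show False by (simp add: zero_less_mult_iff)
    qed
    then have nx: "nxt i j m" using that unfolding nxt_def by blast
    moreover have "x = V j m" using V_unique[of j m x "V j m"] nxt_D[OF nx] nxt_V_on[OF nx] that by simp
    ultimately show ?thesis by blast
  qed
  show ?thesis
  proof (cases "k < l")
    case True then show ?thesis using key[of k l] C l assms by blast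
  next
    case False then show ?thesis using key[of l k] C l assms by force
  qed
qed

text \<open>The form of a second line \<open>k\<close> serves as a coordinate on line
  \<open>j\<close>: it changes at the rate \<open>D k j\<close> along the direction of
  \<open>j\<close>.\<close>

lemma line_param:
  assumes "D k j \<noteq> 0" "f j x = 0" "f j y = 0"
  shows "x = (fst y + (f k x - f k y) / D k j * p j, snd y + (f k x - f k y) / D k j * q j)"
proof (rule V_unique[OF assms(1)])
  show "f j x = f j (fst y + (f k x - f k y) / D k j * p j, snd y + (f k x - f k y) / D k j * q j)"
    unfolding f_move using assms by (simp add: D_def)
  show "f k x = f k (fst y + (f k x - f k y) / D k j * p j, snd y + (f k x - f k y) / D k j * q j)"
    unfolding f_move using assms by simp
qed

lemma edge_seg:
  assumes jk: "nxt i j k" and kl: "nxt i k l" shows "line k \<inter> R i = seg (V j k) (V k l)"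
proof -
  have ne: "j < k" "k < l" using nxt_D jk kl by auto
  have jR: "j \<in> {i+1..i+n}" "l \<in> {i+1..i+n}" using nxt_D jk kl by auto
  let ?P = "V j k" and ?Q = "V k l"
  have z: "f j ?P = 0" "f k ?P = 0" "f k ?Q = 0" "f l ?Q = 0" using nxt_V_on jk kl by auto
  have n: "f j ?Q < 0" "f l ?P < 0" using V_neg[OF kl] V_neg[OF jk] jR ne by auto
  show ?thesis
  proof
    show "line k \<inter> R i \<subseteq> seg ?P ?Q"
    proof
      fix x assume x: "x \<in> line k \<inter> R i"
      \<comment> \<open>On line \<open>k\<close> the form \<open>f j\<close> is affine and vanishes
        at \<open>?P\<close>, so this ratio is the parameter of \<open>x\<close> between
        \<open>?P\<close> and \<open>?Q\<close>. The constraint of \<open>j\<close> bounds it below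
        by 0, that of \<open>l\<close> above by 1.\<close>
      let ?t = "f j x / f j ?Q"
      let ?y = "(fst ?P + ?t * (fst ?Q - fst ?P), snd ?P + ?t * (snd ?Q - snd ?P))"
      have xy: "x = ?y"
      proof (rule V_unique[of j k])
        show "f j x = f j ?y" "f k x = f k ?y" unfolding f_affine using x z n by simp_all
      qed (use nxt_D(1)[OF jk] in simp)
      have "f j x \<le> 0" "f l x \<le> 0" using x jR by (auto simp: R_def)
      have t0: "?t \<ge> 0" using n \<open>f j x \<le> 0\<close> by (simp add: divide_nonpos_neg)
      have "f l ?y = (1 - ?t) * f l ?P" using z unfolding f_affine by simp
      then have "f l x = (1 - ?t) * f l ?P" using xy by metis
      then have t1: "?t \<le> 1" using n \<open>f l x \<le> 0\<close> by (simp add: mult_le_0_iff)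
      show "x \<in> seg ?P ?Q" using xy t0 t1 unfolding seg_def by blast
    qed
    show "seg ?P ?Q \<subseteq> line k \<inter> R i"
    proof
      fix x assume "x \<in> seg ?P ?Q"
      then obtain t where t: "0 \<le> t" "t \<le> 1"
        "x = (fst ?P + t * (fst ?Q - fst ?P), snd ?P + t * (snd ?Q - snd ?P))"
        unfolding seg_def by blast
      have fx: "f m x = (1 - t) * f m ?P + t * f m ?Q" for m unfolding t(3) by (rule f_affine)
      have "f m x \<le> 0" if "m \<in> {i+1..i+n}" for m
      proof -
        have "f m ?P \<le> 0" "f m ?Q \<le> 0" using V_in_R[OF jk] V_in_R[OF kl] that by (auto simp: R_def)
        then show ?thesis unfolding fx using t by (simp add: add_nonpos_nonpos mult_nonneg_nonpos)
      qed
      then show "x \<in> line k \<inter> R i" using fx[of k] z by (simp add: R_def)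
    qed
  qed
qed

lemma edge_vertices:
  assumes jk: "nxt i j k" and kl: "nxt i k l"
  shows "line k \<inter> R i \<inter> intersection_points (range line) = {V j k, V k l}"
proof
  show "line k \<inter> R i \<inter> intersection_points (range line) \<subseteq> {V j k, V k l}"
  proof
    fix x assume "x \<in> line k \<inter> R i \<inter> intersection_points (range line)"
    then have "(\<exists>l. nxt i k l \<and> x = V k l) \<or> (\<exists>l. nxt i l k \<and> x = V l k)"
      using R_line_vertex[of x i k] nxt_D[OF jk] by simp
    then show "x \<in> {V j k, V k l}" using nxt_unique(1)[OF kl] nxt_unique(2)[OF jk] by blast
  qed
  show "{V j k, V k l} \<subseteq> line k \<inter> R i \<inter> intersection_points (range line)"
    using V_in_R[OF jk] V_in_R[OF kl] V_intersection[OF jk] V_intersection[OF kl]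
      nxt_V_on[OF jk] nxt_V_on[OF kl] by simp
qed

lemma edge_adjacent:
  assumes jk: "nxt i j k" and kl: "nxt i k l"
  shows "adjacent_points (range line) (line k) (V j k) (V k l)"
proof -
  have "V j k \<noteq> V k l"
    using V_neg[OF kl, of j] nxt_V_on[OF jk] nxt_D[OF jk] nxt_D[OF kl] by force
  then show ?thesis
    using edge_vertices[OF assms] edge_seg[OF assms] unfolding adjacent_points_def by auto
qed

lemma first_vertex:
  assumes "nxt i (i+1) k"
  shows "line (i+1) \<inter> R i \<inter> intersection_points (range line) = {V (i+1) k}"
    "end_of (V (i+1) k) (line (i+1) \<inter> R i)"
proof -
  let ?V = "V (i+1) k"
  have no: "\<not> nxt i l (i+1)" for l using nxt_D[of i l "i+1"] by auto
  show "line (i+1) \<inter> R i \<inter> intersection_points (range line) = {?V}"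
  proof
    show "line (i+1) \<inter> R i \<inter> intersection_points (range line) \<subseteq> {?V}"
    proof
      fix x assume "x \<in> line (i+1) \<inter> R i \<inter> intersection_points (range line)"
      then have "(\<exists>l. nxt i (i+1) l \<and> x = V (i+1) l) \<or> (\<exists>l. nxt i l (i+1) \<and> x = V l (i+1))"
        using R_line_vertex[of x i "i+1"] n3 by simp
      then show "x \<in> {?V}" using nxt_unique(1)[OF assms] no by blast
    qed
    show "{?V} \<subseteq> line (i+1) \<inter> R i \<inter> intersection_points (range line)"
      using V_in_R[OF assms] V_intersection[OF assms] nxt_V_on[OF assms] by simp
  qed
  have "x \<in> ray ?V (p (i+1), q (i+1))" if x: "x \<in> line (i+1) \<inter> R i" for x
  proof -
    \<comment> \<open>\<open>f k\<close> decreases along the direction of line \<open>i+1\<close>,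
      so the part of this line in \<open>R i\<close> runs forwards from the vertex.\<close>
    have D: "D k (i+1) < 0" using nxt_D(1)[OF assms] D_swap[of k "i+1"] by simp
    have "f k x \<le> 0" using x nxt_D[OF assms] by (auto simp: R_def)
    then have "(f k x - f k ?V) / D k (i+1) \<ge> 0" using D nxt_V_on[OF assms] by (simp add: divide_nonpos_neg)
    then show ?thesis
      by (rule rayI[OF _ line_param[of k "i+1" x ?V]]) (use D nxt_V_on[OF assms] x in auto)
  qed
  then have "line (i+1) \<inter> R i \<subseteq> ray ?V (p (i+1), q (i+1))" by blast
  then show "end_of ?V (line (i+1) \<inter> R i)"
    using V_in_R[OF assms] nxt_V_on[OF assms] unfolding end_of_def by auto
qed

lemma last_vertex:
  assumes "nxt i k (i+n)"
  shows "line (i+n) \<inter> R i \<inter> intersection_points (range line) = {V k (i+n)}"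
    "end_of (V k (i+n)) (line (i+n) \<inter> R i)"
proof -
  let ?V = "V k (i+n)"
  have no: "\<not> nxt i (i+n) l" for l using nxt_D[of i "i+n" l] by auto
  show "line (i+n) \<inter> R i \<inter> intersection_points (range line) = {?V}"
  proof
    show "line (i+n) \<inter> R i \<inter> intersection_points (range line) \<subseteq> {?V}"
    proof
      fix x assume "x \<in> line (i+n) \<inter> R i \<inter> intersection_points (range line)"
      then have "(\<exists>l. nxt i (i+n) l \<and> x = V (i+n) l) \<or> (\<exists>l. nxt i l (i+n) \<and> x = V l (i+n))"
        using R_line_vertex[of x i "i+n"] n3 by simp
      then show "x \<in> {?V}" using nxt_unique(2)[OF assms] no by blast
    qed
    show "{?V} \<subseteq> line (i+n) \<inter> R i \<inter> intersection_points (range line)"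
      using V_in_R[OF assms] V_intersection[OF assms] nxt_V_on[OF assms] by simp
  qed
  have "x \<in> ray ?V (- p (i+n), - q (i+n))" if x: "x \<in> line (i+n) \<inter> R i" for x
  proof -
    \<comment> \<open>Here \<open>f k\<close> increases along the direction of the line, so the ray
      runs backwards.\<close>
    have D: "D k (i+n) > 0" using nxt_D(1)[OF assms] by simp
    have "f k x \<le> 0" using x nxt_D[OF assms] by (auto simp: R_def)
    then have "- ((f k x - f k ?V) / D k (i+n)) \<ge> 0" (is "?t \<ge> 0")
      using D nxt_V_on[OF assms] by (simp add: divide_nonpos_pos)
    moreover have "x = (fst ?V + ?t * - p (i+n), snd ?V + ?t * - q (i+n))"
      using line_param[of k "i+n" x ?V] D nxt_V_on[OF assms] x by simp
    ultimately show ?thesis by (rule rayI)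
  qed
  then have "line (i+n) \<inter> R i \<subseteq> ray ?V (- p (i+n), - q (i+n))" by blast
  then show "end_of ?V (line (i+n) \<inter> R i)"
    using V_in_R[OF assms] nxt_V_on[OF assms] unfolding end_of_def by auto
qed

lemma lines_meeting_R: "{L \<in> range line. L \<inter> R i \<noteq> {}} = line ` C i"
proof
  show "{L \<in> range line. L \<inter> R i \<noteq> {}} \<subseteq> line ` C i"
  proof
    fix L assume L: "L \<in> {L \<in> range line. L \<inter> R i \<noteq> {}}"
    then obtain k where k: "k \<in> {i+1..i+n}" "L = line k" unfolding range_line[of i] by blast
    then obtain x where x: "f k x = 0" "x \<in> R i" using L by (auto simp: line_def)
    then have "k \<in> C i" using R_off_C[of x i k] k by fastforce
    then show "L \<in> line ` C i" using k by blast
  qed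
  have "line k \<inter> R i \<noteq> {}" if kC: "k \<in> C i" for k
  proof (cases "k = i + n")
    case False
    then obtain l where "nxt i k l" using nxt_ex[OF kC] by metis
    then show ?thesis using V_in_R nxt_V_on by (meson disjoint_iff mem_line)
  next
    case True
    then have "k \<noteq> i + 1" using n3 by simp
    then obtain l where "nxt i l k" using prev_ex[OF kC] by metis
    then show ?thesis using V_in_R nxt_V_on by (meson disjoint_iff mem_line)
  qed
  then show "line ` C i \<subseteq> {L \<in> range line. L \<inter> R i \<noteq> {}}" by auto
qed

lemma card_lines_meeting_R: "card {L \<in> range line. L \<inter> R i \<noteq> {}} = card (C i)"
  unfolding lines_meeting_R by (rule card_image) (rule inj_on_subset[OF inj_line C_sub])

subsection \<open>Regions\<close>

lemma near:
  obtains e where "e > 0" "\<And>k y. y \<in> square m e \<Longrightarrow> f k m > 0 \<Longrightarrow> f k y > 0"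
proof -
  \<comment> \<open>The product is unchanged when the direction of the line is reversed, so a radius
    found for n representatives works for all integers.\<close>
  let ?P = "\<lambda>k e. \<forall>y\<in>square m e. f k m \<noteq> 0 \<longrightarrow> f k y * f k m > 0"
  have ex: "\<exists>e>0. ?P k e" for k
  proof (cases "f k m = 0")
    case True then show ?thesis by (intro exI[of _ 1]) simp
  next
    case False
    \<comment> \<open>A bound for the rate of change of \<open>f k\<close> in the maximum norm; the
      added 1 makes the estimate strict.\<close>
    let ?s = "\<bar>p k\<bar> + \<bar>q k\<bar> + 1"
    let ?e = "\<bar>f k m\<bar> / ?s"
    have s: "?s > 0" by (simp add: add_nonneg_pos)
    have e: "?e > 0" using False s by simp
    have "f k y * f k m > 0" if y: "y \<in> square m ?e" for y
    proof -
      have "\<bar>f k y - f k m\<bar> = \<bar>p k * (snd y - snd m) - q k * (fst y - fst m)\<bar>"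
        by (simp add: f_def algebra_simps)
      also have "\<dots> \<le> \<bar>p k\<bar> * \<bar>snd y - snd m\<bar> + \<bar>q k\<bar> * \<bar>fst y - fst m\<bar>"
        by (metis abs_mult abs_triangle_ineq4)
      also have "\<dots> \<le> \<bar>p k\<bar> * ?e + \<bar>q k\<bar> * ?e"
        using y by (intro add_mono mult_left_mono) (auto simp: square_def)
      also have "\<dots> < ?s * ?e" unfolding distrib_right using e by simp
      also have "\<dots> = \<bar>f k m\<bar>" using s by simp
      finally have lt: "\<bar>f k y - f k m\<bar> < \<bar>f k m\<bar>" .
      show ?thesis
      proof (cases "f k m > 0")
        case True then show ?thesis using lt by (intro mult_pos_pos) (auto simp: abs_less_iff)
      next
        case False then show ?thesis using lt \<open>f k m \<noteq> 0\<close>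
          by (intro mult_neg_neg) (auto simp: abs_less_iff)
      qed
    qed
    then show ?thesis using e by blast
  qed
  have "\<exists>e>0. \<forall>k\<in>{0+1..0+n}. ?P k e"
  proof (rule finite_common_bound)
    show "?P k e \<Longrightarrow> e' > 0 \<Longrightarrow> e' \<le> e \<Longrightarrow> ?P k e'" for k e e'
      by (auto simp: square_def)
  qed (use ex in auto)
  then obtain e where e: "e > 0" "\<forall>k\<in>{0+1..0+n}. ?P k e" by blast
  have "f k y > 0" if y: "y \<in> square m e" and k: "f k m > 0" for k y
  proof -
    obtain k' where k': "k' \<in> {0+1..0+n}" "n dvd k - k'" by (rule rep_ex)
    have "f k' m \<noteq> 0" using f_zero_dvd[OF k'(2), of m] k by simp
    then have "f k' y * f k' m > 0" using e(2) k'(1) y by blast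
    then have "f k y * f k m > 0" using f_dvd[OF k'(2)] by (metis minus_mult_minus)
    then show ?thesis using k by (simp add: zero_less_mult_iff)
  qed
  then show ?thesis using that e(1) by blast
qed

lemma norm_pos: "p k * p k + q k * q k > 0"
proof -
  have "p k \<noteq> 0 \<or> q k \<noteq> 0" using D_pos[of k "k+1"] n3 by (auto simp: D_def)
  then show ?thesis by (simp add: sum_squares_gt_zero_iff)
qed

text \<open>Starting from a point of a single line, a step along its left normal
  \<open>(- q k, p k)\<close> that is too short to cross another line ends inside the cell to the
  left.\<close>

lemma side_point:
  assumes "f k m = 0" "\<And>j. \<not> n dvd j - k \<Longrightarrow> f j m \<noteq> 0" "e > 0"
  obtains z where "z \<in> square m e" "f k z > 0" "\<And>j. f j m > 0 \<Longrightarrow> f j z > 0" "\<And>j. f j z \<noteq> 0"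
proof -
  obtain e' where e': "e' > 0" "\<And>k y. y \<in> square m e' \<Longrightarrow> f k m > 0 \<Longrightarrow> f k y > 0" by (rule near[of m]) blast
  have "min e e' > 0" using assms e' by simp
  then obtain t where t: "t > 0" "(fst m + t * - q k, snd m + t * p k) \<in> square m (min e e')"
    (is "?z \<in> _")
    by (rule small_move)
  have sq: "?z \<in> square m e" "?z \<in> square m e'" using t(2) by (auto simp: square_def)
  have "f k ?z = f k m + t * (p k * p k + q k * q k)" by (simp add: f_def algebra_simps)
  then have k: "f k ?z > 0" using assms(1) t(1) norm_pos by simp
  have pos: "f j ?z > 0" if "f j m > 0" for j using e'(2)[OF sq(2) that] .
  have "f j ?z \<noteq> 0" for j
  proof (cases "n dvd j - k")
    case True then show ?thesis using f_zero_dvd[OF True, of ?z] k by simp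
  next
    case False
    then have "f j m > 0 \<or> f (j + n) m > 0" using assms(2)[of j] f_anti[of j m] by auto
    then show ?thesis using pos[of j] pos[of "j+n"] f_anti[of j ?z] by fastforce
  qed
  then show ?thesis using that sq k pos by blast
qed

lemma line_eq_line: "line_eq (- q k) (p k) (c k) (line k)"
  using norm_pos[of k] by (auto simp: line_eq_def line_def f_def)

text \<open>\<open>region\<close> admits every equation of a line. Two points of the line show that
  \<open>(a', b')\<close> is orthogonal to its direction, and \<open>s\<close> is then the
  coefficient of \<open>(a', b')\<close> along the normal \<open>(- q k, p k)\<close>.\<close>

lemma line_eq_proportional:
  assumes "line_eq a' b' c' (line k)"
  obtains s where "s \<noteq> 0" "\<And>x. a' * fst x + b' * snd x - c' = s * f k x"
proof -
  let ?N = "p k * p k + q k * q k"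
  have N: "?N > 0" by (rule norm_pos)
  have L: "f k x = 0 \<longleftrightarrow> a' * fst x + b' * snd x = c'" for x
    using assms unfolding line_eq_def line_def by (cases x) auto
  define o' where "o' = V k (k+1)"
  have "D k (k+1) \<noteq> 0" using D_pos[of k "k+1"] n3 by simp
  then have o: "f k o' = 0" by (simp add: o'_def V_on)
  have "f k (fst o' + 1 * p k, snd o' + 1 * q k) = 0" unfolding f_move using o by (simp add: D_def)
  then have ap: "a' * p k + b' * q k = 0" using L[of o'] o unfolding L by (simp add: algebra_simps)
  define s where "s = (b' * p k - a' * q k) / ?N"
  have sN: "s * ?N = b' * p k - a' * q k" using N by (simp add: s_def)
  have "?N * a' = ?N * (- s * q k)"
  proof -
    have "?N * (- s * q k) = - (s * ?N) * q k" by (simp add: algebra_simps)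
    also have "\<dots> = a' * (q k * q k) - (b' * q k) * p k" unfolding sN by (simp add: algebra_simps)
    also have "b' * q k = - (a' * p k)" using ap by (simp add: eq_neg_iff_add_eq_0 add.commute)
    finally show ?thesis by (simp add: algebra_simps)
  qed
  then have a: "a' = - s * q k" using N by (simp only: mult_cancel_left) simp
  have "?N * b' = ?N * (s * p k)"
  proof -
    have "?N * (s * p k) = (s * ?N) * p k" by (simp add: algebra_simps)
    also have "\<dots> = b' * (p k * p k) - (a' * p k) * q k" unfolding sN by (simp add: algebra_simps)
    also have "a' * p k = - (b' * q k)" using ap by (simp add: eq_neg_iff_add_eq_0)
    finally show ?thesis by (simp add: algebra_simps)
  qed
  then have b: "b' = s * p k" using N by (simp only: mult_cancel_left) simp
  have "s \<noteq> 0" using assms a b by (auto simp: line_eq_def)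
  moreover have "a' * fst x + b' * snd x - c' = s * f k x" for x
  proof -
    have "c' = a' * fst o' + b' * snd o'" using L o by simp
    then have "a' * fst x + b' * snd x - c' = s * (f k x - f k o')"
      unfolding a b by (simp add: f_def algebra_simps)
    then show ?thesis using o by simp
  qed
  ultimately show ?thesis by (rule that)
qed

section \<open>Regions are the cells of points on no line\<close>

lemma region_imp_cell:
  assumes "region (range line) S"
  obtains z where "\<And>k. f k z \<noteq> 0" "S = cell z"
proof -
  obtain a' b' c' \<epsilon> where *:
    "(\<forall>L\<in>range line. line_eq (a' L) (b' L) (c' L) L \<and> \<epsilon> L \<in> {-1, 1}) \<and>
      S = {(x, y). \<forall>L\<in>range line. \<epsilon> L * (a' L * x + b' L * y - c' L) \<ge> 0} \<and>
      (\<exists>x y. \<forall>L\<in>range line. \<epsilon> L * (a' L * x + b' L * y - c' L) > 0)"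
    using assms unfolding region_def by (elim exE) (rule that)
  then obtain z1 z2 where
    z: "\<And>k. \<epsilon> (line k) * (a' (line k) * z1 + b' (line k) * z2 - c' (line k)) > 0"
    by blast
  from * have eq: "\<And>k. line_eq (a' (line k)) (b' (line k)) (c' (line k)) (line k)" and
    S: "S = {(x, y). \<forall>L\<in>range line. \<epsilon> L * (a' L * x + b' L * y - c' L) \<ge> 0}"
    by blast+
  have "\<exists>s. \<forall>x. \<epsilon> (line k) * (a' (line k) * fst x + b' (line k) * snd x - c' (line k)) = s * f k x"
    for k
  proof -
    obtain s where "\<And>x. a' (line k) * fst x + b' (line k) * snd x - c' (line k) = s * f k x"
      by (rule line_eq_proportional[OF eq[of k]]) (rule that)
    then show ?thesis by (intro exI[of _ "\<epsilon> (line k) * s"]) (simp add: mult.assoc)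
  qed
  then obtain s where
    s: "\<epsilon> (line k) * (a' (line k) * fst x + b' (line k) * snd x - c' (line k)) = s k * f k x" for k x
    by metis
  define z' where "z' = (z1, z2)"
  have pos: "s k * f k z' > 0" for k using z[of k] s[of k z'] by (simp add: z'_def)
  have Sx: "x \<in> S \<longleftrightarrow> (\<forall>k. s k * f k x \<ge> 0)" for x
    unfolding S s[symmetric] by (cases x) auto
  have "S = cell z'"
  proof (rule set_eqI)
    fix x
    have "(\<forall>k. s k * f k x \<ge> 0) \<longleftrightarrow> (\<forall>k. f k z' > 0 \<longrightarrow> f k x \<ge> 0)"
    proof safe
      fix k assume "\<forall>k. s k * f k x \<ge> 0" "f k z' > 0"
      moreover have "s k > 0" using pos[of k] \<open>f k z' > 0\<close> by (simp add: zero_less_mult_iff)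
      ultimately show "f k x \<ge> 0" by (metis zero_le_mult_iff not_less)
    next
      fix k assume *: "\<forall>k. f k z' > 0 \<longrightarrow> f k x \<ge> 0"
      show "s k * f k x \<ge> 0"
      proof (cases "f k z' > 0")
        case True
        then show ?thesis using * pos[of k] by (simp add: zero_less_mult_iff)
      next
        case False
        then have "s k < 0" "f (k+n) z' > 0" using pos[of k] by (auto simp: zero_less_mult_iff f_anti)
        then have "f (k+n) x \<ge> 0" using * by blast
        then show ?thesis using \<open>s k < 0\<close> by (simp add: f_anti mult_nonpos_nonpos)
      qed
    qed
    then show "x \<in> S \<longleftrightarrow> x \<in> cell z'" using Sx by (simp add: cell_def)
  qed
  moreover have "f k z' \<noteq> 0" for k using pos[of k] by auto
  ultimately show ?thesis using that by blast
qed

lemma region_cell: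
  assumes "\<And>k. f k z \<noteq> 0" shows "region (range line) (cell z)"
proof -
  \<comment> \<open>\<open>region\<close> indexes its equations by lines as point sets, whereas
    \<open>f\<close> is indexed by integers; \<open>K\<close> selects one index, and with it a
    direction, for each line.\<close>
  define K where "K L = (SOME k. line k = L)" for L
  have K: "line (K (line k)) = line k" for k unfolding K_def by (rule someI) simp
  have fK: "(\<forall>x. f (K (line k)) x = f k x) \<or> (\<forall>x. f (K (line k)) x = - f k x)" for k
    using f_dvd K[of k] line_eq_iff by blast
  define \<epsilon> where "\<epsilon> L = (if f (K L) z > 0 then 1 else - 1 :: 'a)" for L
  define A where "A L = - q (K L)" for L
  define B where "B L = p (K L)" for L
  define E where "E L = c (K L)" for L
  have v: "\<epsilon> L * (A L * fst x + B L * snd x - E L) = \<epsilon> L * f (K L) x" for L x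
    by (simp add: A_def B_def E_def f_def algebra_simps)
  have 1: "\<forall>L\<in>range line. line_eq (A L) (B L) (E L) L \<and> \<epsilon> L \<in> {-1, 1}"
  proof
    fix L assume "L \<in> range line"
    then have "line (K L) = L" using K by auto
    then show "line_eq (A L) (B L) (E L) L \<and> \<epsilon> L \<in> {-1, 1}"
      using line_eq_line[of "K L"] by (simp add: A_def B_def E_def \<epsilon>_def)
  qed
  have 2: "cell z = {(x, y). \<forall>L\<in>range line. \<epsilon> L * (A L * x + B L * y - E L) \<ge> 0}"
  proof (rule set_eqI)
    fix x
    have "(\<forall>k. f k z > 0 \<longrightarrow> f k x \<ge> 0) \<longleftrightarrow> (\<forall>k. \<epsilon> (line k) * f (K (line k)) x \<ge> 0)"
    proof safe
      fix k assume *: "\<forall>k. f k z > 0 \<longrightarrow> f k x \<ge> 0"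
      let ?k = "K (line k)"
      show "\<epsilon> (line k) * f ?k x \<ge> 0"
      proof (cases "f ?k z > 0")
        case True then show ?thesis using * by (simp add: \<epsilon>_def)
      next
        case False
        then have "f (?k + n) z > 0" using assms[of ?k] by (simp add: f_anti)
        then have "f (?k + n) x \<ge> 0" using * by blast
        then show ?thesis using False by (simp add: \<epsilon>_def f_anti)
      qed
    next
      fix k assume *: "\<forall>k. \<epsilon> (line k) * f (K (line k)) x \<ge> 0" and k: "f k z > 0"
      from fK[of k] show "f k x \<ge> 0"
      proof
        assume e: "\<forall>x. f (K (line k)) x = f k x"
        then have "f (K (line k)) z > 0" "f (K (line k)) x = f k x" using k by metis+
        then show ?thesis using *[rule_format, of k] by (simp add: \<epsilon>_def)
      next
        assume e: "\<forall>x. f (K (line k)) x = - f k x"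
        then have "f (K (line k)) z = - f k z" "f (K (line k)) x = - f k x" by metis+
        then show ?thesis using *[rule_format, of k] k by (simp add: \<epsilon>_def)
      qed
    qed
    then show "x \<in> cell z \<longleftrightarrow> x \<in> {(x, y). \<forall>L\<in>range line. \<epsilon> L * (A L * x + B L * y - E L) \<ge> 0}"
      using v[of _ x] by (cases x) (simp only: cell_def mem_Collect_eq prod.case fst_conv snd_conv ball_simps)
  qed
  have 3: "\<forall>L\<in>range line. \<epsilon> L * (A L * fst z + B L * snd z - E L) > 0"
    unfolding v using assms by (auto simp: \<epsilon>_def not_less less_le)
  show ?thesis
    unfolding region_def
    by (rule exI[of _ A], rule exI[of _ B], rule exI[of _ E], rule exI[of _ \<epsilon>])
      (use 1 2 3 in blast)
qed

section \<open>The unbounded regions are the \<open>R i\<close>\<close>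

lemma cell_eq_R: assumes "\<And>k. k \<in> {i+1..i+n} \<Longrightarrow> f k z < 0" shows "cell z = R i"
proof (rule set_eqI)
  fix x
  show "x \<in> cell z \<longleftrightarrow> x \<in> R i"
  proof
    assume x: "x \<in> cell z"
    have "f k x \<le> 0" if "k \<in> {i+1..i+n}" for k
    proof -
      have "f (k + n) z > 0" using assms[OF that] by (simp add: f_anti)
      then have "f (k + n) x \<ge> 0" using x by (simp add: cell_def)
      then show ?thesis by (simp add: f_anti)
    qed
    then show "x \<in> R i" by (simp add: R_def)
  next
    assume x: "x \<in> R i"
    have "f k x \<ge> 0" if "f k z > 0" for k
    proof -
      obtain k' where k': "k' \<in> {i+1..i+n}" "n dvd k - k'" by (rule rep_ex)
      have "f k' z < 0" "f k' x \<le> 0" using assms k' x by (auto simp: R_def)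
      then show ?thesis using f_dvd[OF k'(2)] that by (metis neg_0_le_iff_le not_less_iff_gr_or_eq)
    qed
    then show "x \<in> cell z" by (simp add: cell_def)
  qed
qed

text \<open>The directions of lines \<open>i\<close> and \<open>i+1\<close> span the cone of ray
  directions of \<open>R i\<close>. Each is parallel to one line of the window, but their sum points
  strictly to the right of all of them and so into the interior.\<close>

lemma D_first: "k \<in> {i+1..i+n} \<Longrightarrow> D k i \<le> 0 \<and> D k (i+1) \<le> 0 \<and> D k i + D k (i+1) < 0"
proof -
  assume k: "k \<in> {i+1..i+n}"
  have "D (i+n) i = 0" by (simp add: D_def p_anti q_anti)
  moreover have "D (i+1) (i+1) = 0" by (simp add: D_def)
  moreover have "D k i < 0" if "k \<noteq> i + n" using D_pos[of i k] D_swap[of k i] k that by simp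
  moreover have "D k (i+1) < 0" if "k \<noteq> i + 1" using D_pos[of "i+1" k] D_swap[of k "i+1"] k that by simp
  ultimately show ?thesis using n3 by (cases "k = i+n"; cases "k = i+1") (auto simp: add_neg_neg)
qed

lemma R_interior: obtains z where "\<And>k. k \<in> {i+1..i+n} \<Longrightarrow> f k z < 0"
proof -
  have "i + 1 \<noteq> i + n" using n3 by simp
  then obtain l where l: "nxt i (i+1) l" using nxt_ex[OF first_in_C] by metis
  let ?v = "V (i+1) l"
  let ?y = "(fst ?v + 1 * p i, snd ?v + 1 * q i)"
  let ?z = "(fst ?y + 1 * p (i+1), snd ?y + 1 * q (i+1))"
  have "f k ?z < 0" if "k \<in> {i+1..i+n}" for k
  proof -
    have "f k ?z = f k ?v + (D k i + D k (i+1))" unfolding f_move by (simp add: algebra_simps)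
    moreover have "f k ?v \<le> 0" using V_in_R[OF l] that by (simp add: R_def)
    ultimately show ?thesis using D_first[OF that] by (simp add: add_nonpos_neg)
  qed
  then show ?thesis by (rule that)
qed

lemma R_region: "region (range line) (R i)"
proof -
  obtain z where z: "\<And>k. k \<in> {i+1..i+n} \<Longrightarrow> f k z < 0" by (rule R_interior[of i]) blast
  have "f k z \<noteq> 0" for k
  proof -
    obtain k' where k': "k' \<in> {i+1..i+n}" "n dvd k - k'" by (rule rep_ex)
    then show ?thesis using z[OF k'(1)] f_zero_dvd[OF k'(2), of z] by auto
  qed
  then show ?thesis using region_cell[of z] cell_eq_R[OF z] by simp
qed

lemma R_contains_ray: "contains_ray (R i)"
proof -
  obtain z where z: "\<And>k. k \<in> {i+1..i+n} \<Longrightarrow> f k z < 0" by (rule R_interior[of i]) blast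
  have "ray z (p i, q i) \<subseteq> R i"
  proof
    fix x assume "x \<in> ray z (p i, q i)"
    then obtain t where t: "t \<ge> 0" "x = (fst z + t * p i, snd z + t * q i)" unfolding ray_def by auto
    have "f k x \<le> 0" if "k \<in> {i+1..i+n}" for k
      using z[OF that] D_first[OF that] t(1) unfolding t(2) f_move
      by (simp add: add_nonpos_nonpos mult_nonneg_nonpos)
    then show "x \<in> R i" by (simp add: R_def)
  qed
  moreover have "(p i, q i) \<noteq> (0, 0)" using norm_pos[of i] by auto
  ultimately show ?thesis unfolding contains_ray_def by blast
qed

lemma cell_ray_direction:
  assumes "ray v w \<subseteq> cell z" "f k z > 0" shows "p k * snd w - q k * fst w \<ge> 0" (is "?d \<ge> 0")
proof (rule ccontr)
  assume "\<not> ?thesis"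
  then have d: "?d < 0" by simp
  have fv: "f k (fst v + t * fst w, snd v + t * snd w) \<ge> 0" if "t \<ge> 0" for t
    using assms that unfolding ray_def cell_def by blast
  have f: "f k (fst v + t * fst w, snd v + t * snd w) = f k v + t * ?d" for t
    by (simp add: f_def algebra_simps)
  have "f k v \<ge> 0" using fv[of 0] unfolding f by simp
  \<comment> \<open>At this parameter \<open>f k\<close> would take the value -1.\<close>
  let ?t = "- (f k v + 1) / ?d"
  have "?t \<ge> 0" using d \<open>f k v \<ge> 0\<close> by (simp add: divide_nonpos_neg)
  then have "f k v + ?t * ?d \<ge> 0" using fv[of ?t] f[of ?t] by metis
  moreover have "?t * ?d = - (f k v + 1)" using d by simp
  ultimately show False by simp
qed

text \<open>For a ray direction \<open>w\<close>, the rates \<open>d k\<close> agree weakly in sign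
  with \<open>f k z\<close>. Starting from an index \<open>k0\<close> with \<open>d k0 > 0\<close>,
  let \<open>i\<close> be the last index below \<open>k0 + n\<close> with \<open>f i z > 0\<close>.
  Between \<open>k0\<close> and \<open>i\<close>, \<open>d\<close> is positive as a combination of
  \<open>d k0\<close> and \<open>d i\<close>, so no negative value interrupts the positive ones, and
  n negative values follow \<open>i\<close>.\<close>

lemma unbounded_cell_window:
  assumes gen: "\<And>k. f k z \<noteq> 0" and "contains_ray (cell z)"
  obtains i where "\<And>k. k \<in> {i+1..i+n} \<Longrightarrow> f k z < 0"
proof -
  obtain v w where vw: "ray v w \<subseteq> cell z" "w \<noteq> (0, 0)" using assms(2) unfolding contains_ray_def by blast
  define d where "d k = p k * snd w - q k * fst w" for k
  have d_pos: "f k z > 0 \<Longrightarrow> d k \<ge> 0" for k using cell_ray_direction[OF vw(1)] by (simp add: d_def)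
  have d_anti: "d (k + n) = - d k" for k by (simp add: d_def p_anti q_anti)
  have pos_d: "f k z > 0" if "d k > 0" for k
  proof (rule ccontr)
    assume "\<not> ?thesis"
    then have "f (k + n) z > 0" using gen[of k] by (simp add: f_anti)
    then show False using d_pos[of "k+n"] that d_anti[of k] by simp
  qed
  have plucker: "D j b * d k = D k b * d j + D j k * d b" for j k b
    by (simp add: D_def d_def algebra_simps)
  have "d 0 \<noteq> 0 \<or> d 1 \<noteq> 0"
  proof (rule ccontr)
    assume *: "\<not> ?thesis"
    have D: "D 0 1 > 0" using D_pos[of 0 1] n3 by simp
    \<comment> \<open>\<open>V_unique\<close> is applied to \<open>w\<close> and the origin as
      points: a vector parallel to two lines of different directions is zero.\<close>
    have "w = (0, 0)"
      by (rule V_unique[of 0 1]) (use D * in \<open>auto simp: f_def d_def\<close>)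
    then show False using vw by simp
  qed
  then obtain k0 where k0: "d k0 > 0"
    using d_anti[of 0] d_anti[of 1] by (metis linorder_neqE_linordered_idom neg_0_less_iff_less)
  let ?S = "{j\<in>{k0..k0+n-1}. f j z > 0}"
  have fin: "finite ?S" by (rule finite_subset[of _ "{k0..k0+n-1}"]) auto
  have "k0 \<in> ?S" using pos_d[OF k0] n3 by simp
  define i where "i = Max ?S"
  have i: "i \<in> ?S" using Max_in[OF fin] \<open>k0 \<in> ?S\<close> unfolding i_def by blast
  have max: "j \<le> i" if "j \<in> ?S" for j using Max_ge[OF fin that] by (simp add: i_def)
  have "f k z < 0" if k: "k \<in> {i+1..i+n}" for k
  proof (cases "k < k0 + n")
    case True
    then have "k \<notin> ?S" using max[of k] k by auto
    then have "\<not> f k z > 0" using k i True by simp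
    then show ?thesis using gen[of k] by simp
  next
    case False
    let ?j = "k - n"
    have j: "k0 \<le> ?j" "?j \<le> i" using False k by auto
    have "f ?j z > 0"
    proof (cases "?j = k0 \<or> ?j = i")
      case True then show ?thesis using pos_d[OF k0] i by auto
    next
      case F: False
      then have o: "k0 < ?j" "?j < i" "i < k0 + n" using j i by auto
      then have D: "D k0 i > 0" "D ?j i > 0" "D k0 ?j > 0" using D_pos by auto
      have "D k0 i * d ?j > 0" unfolding plucker[of k0 i ?j]
        using D k0 d_pos[of i] i by (simp add: add_pos_nonneg)
      then show ?thesis using D pos_d by (simp add: zero_less_mult_iff)
    qed
    then show ?thesis using f_anti[of ?j z] by simp
  qed
  then show ?thesis by (rule that)
qed

lemma unbounded_region_iff: "unbounded_region (range line) S \<longleftrightarrow> (\<exists>i. S = R i)"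
proof
  assume S: "unbounded_region (range line) S"
  then obtain z where z: "\<And>k. f k z \<noteq> 0" "S = cell z" using region_imp_cell unfolding unbounded_region_def by blast
  then obtain i where "\<And>k. k \<in> {i+1..i+n} \<Longrightarrow> f k z < 0"
    using unbounded_cell_window[OF z(1)] S unfolding unbounded_region_def by blast
  then show "\<exists>i. S = R i" using cell_eq_R z(2) by blast
qed (auto simp: unbounded_region_def R_region R_contains_ray)

section \<open>Distinctness of the 2n regions and the counts of gonalities\<close>

lemma R_periodic: "R (i + 2 * n) = R i"
proof -
  have "(\<forall>k\<in>{i+2*n+1..i+2*n+n}. f k x \<le> 0) \<longleftrightarrow> (\<forall>k\<in>{i+1..i+n}. f k x \<le> 0)" for x
  proof safe
    fix k assume *: "\<forall>k\<in>{i+2*n+1..i+2*n+n}. f k x \<le> 0" and "k \<in> {i+1..i+n}"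
    then show "f k x \<le> 0" using *[rule_format, of "k + 2*n"] f_periodic[of k x] by simp
  next
    fix k assume *: "\<forall>k\<in>{i+1..i+n}. f k x \<le> 0" and "k \<in> {i+2*n+1..i+2*n+n}"
    then show "f k x \<le> 0" using *[rule_format, of "k - 2*n"] f_periodic[of "k-2*n" x] by simp
  qed
  then show ?thesis by (simp add: R_def)
qed

lemma periodic_reduce:
  assumes "\<And>i. g (i + 2 * n) = g i" shows "g (i mod (2 * n)) = g i"
proof -
  have up: "g (i + int m * (2 * n)) = g i" for i m
  proof (induction m)
    case (Suc m)
    have "i + int (Suc m) * (2 * n) = (i + int m * (2 * n)) + 2 * n" by (simp add: algebra_simps)
    then show ?case using Suc assms by metis
  qed simp
  let ?d = "i div (2 * n)"
  have i: "i = i mod (2 * n) + ?d * (2 * n)" by (simp only: mod_div_mult_eq)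
  show ?thesis
  proof (cases "?d \<ge> 0")
    case True then show ?thesis using up[of "i mod (2*n)" "nat ?d"] i by simp
  next
    case False
    have "i mod (2 * n) = i + int (nat (- ?d)) * (2 * n)" using i False by simp
    then show ?thesis using up[of i "nat (- ?d)"] by simp
  qed
qed

lemma range_R: "range R = R ` {0..<2*n}"
proof -
  have "R i \<in> R ` {0..<2*n}" for i
    using periodic_reduce[of R i, OF R_periodic] n3 pos_mod_bound[of "2*n" i] pos_mod_sign[of "2*n" i]
    by (metis atLeastLessThan_iff imageI mult_pos_pos zero_less_numeral dual_order.strict_trans1)
  then show ?thesis by blast
qed

lemma R_distinct: assumes "i < j" "j < i + 2 * n" shows "R i \<noteq> R j"
proof
  assume eq: "R i = R j"
  obtain z where z: "\<And>k. k \<in> {i+1..i+n} \<Longrightarrow> f k z < 0" by (rule R_interior[of i]) blast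
  have pos: "f k z > 0" if "k \<in> {i+n+1..i+2*n}" for k
    using z[of "k-n"] f_anti[of "k-n" z] that by simp
  have "z \<in> R i" using z by (auto simp: R_def less_imp_le)
  then have "z \<in> R j" using eq by blast
  then have nonpos: "f k z \<le> 0" if "k \<in> {j+1..j+n}" for k using that by (simp add: R_def)
  \<comment> \<open>The point \<open>z\<close> is strictly to the left of the lines
    \<open>i+n+1\<close> to \<open>i+2n\<close>. The window of \<open>j\<close> ends in this range
    if \<open>j\<close> is at most \<open>i+n\<close> and begins in it otherwise.\<close>
  show False
  proof (cases "j \<le> i + n")
    case True then show False using pos[of "j+n"] nonpos[of "j+n"] assms n3 by simp
  next
    case False then show False using pos[of "j+1"] nonpos[of "j+1"] assms n3 by simp
  qed
qed

lemma inj_R: "inj_on R {0..<2*n}"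
proof (rule inj_onI)
  fix i j assume "i \<in> {0..<2*n}" "j \<in> {0..<2*n}" "R i = R j"
  then show "i = j" using R_distinct[of i j] R_distinct[of j i] by (cases i j rule: linorder_cases) auto
qed

lemma unbounded_gonality_R: "unbounded_gonality (range line) (card (C i)) (R i)"
proof -
  let ?LL = "range line"
  have ne: "i + 1 \<noteq> i + n" using n3 by simp
  obtain l where l: "nxt i (i+1) l" using nxt_ex[OF first_in_C ne] by metis
  obtain r where r: "nxt i r (i+n)" using prev_ex[OF last_in_C ne[symmetric]] by metis
  have ends: "\<forall>L\<in>{line (i+1), line (i+n)}. \<exists>P. L \<inter> R i \<inter> intersection_points ?LL = {P} \<and> end_of P (L \<inter> R i)"
    using first_vertex[OF l] last_vertex[OF r] by blast
  have edges: "\<exists>P Q. adjacent_points ?LL L P Q \<and> L \<inter> R i = seg P Q"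
    if L: "L \<in> ?LL - {line (i+1), line (i+n)}" "L \<inter> R i \<noteq> {}" for L
  proof -
    have "L \<in> line ` C i" using L lines_meeting_R[of i] by blast
    then obtain k where k: "k \<in> C i" "L = line k" by blast
    then have "k \<noteq> i + 1" "k \<noteq> i + n" using L by auto
    then obtain j m where "nxt i j k" "nxt i k m" using nxt_ex[OF k(1)] prev_ex[OF k(1)] by metis
    then show ?thesis using edge_adjacent edge_seg k(2) by blast
  qed
  have 3: "line (i+1) \<noteq> line (i+n)"
    using not_dvd[of "i+1" "i+n"] n3 line_eq_iff by simp
  show ?thesis
    unfolding unbounded_gonality_def
  proof (rule conjI, goal_cases)
    case 1
    show ?case using unbounded_region_iff by blast
  next
    case 2
    have "\<forall>L\<in>?LL - {line (i+1), line (i+n)}. L \<inter> R i \<noteq> {} \<longrightarrow>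
        (\<exists>P Q. adjacent_points ?LL L P Q \<and> L \<inter> R i = seg P Q)"
      using edges by blast
    with ends 3 have "\<exists>A\<in>?LL. \<exists>B\<in>?LL. A \<noteq> B \<and>
        (\<forall>L\<in>{A, B}. \<exists>P. L \<inter> R i \<inter> intersection_points ?LL = {P} \<and> end_of P (L \<inter> R i)) \<and>
        (\<forall>L\<in>?LL - {A, B}. L \<inter> R i \<noteq> {} \<longrightarrow> (\<exists>P Q. adjacent_points ?LL L P Q \<and> L \<inter> R i = seg P Q))"
      by (metis rangeI)
    then show ?case using card_lines_meeting_R[of i] by blast
  qed
qed

lemma gonality_regions:
  "{S. unbounded_gonality (range line) m S} = R ` {i\<in>{0..<2*n}. card (C i) = m}"
proof
  show "{S. unbounded_gonality (range line) m S} \<subseteq> R ` {i\<in>{0..<2*n}. card (C i) = m}"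
  proof
    fix S assume "S \<in> {S. unbounded_gonality (range line) m S}"
    then have S: "unbounded_region (range line) S" "card {L\<in>range line. L \<inter> S \<noteq> {}} = m"
      by (auto simp: unbounded_gonality_def)
    then have "S \<in> range R" using unbounded_region_iff by auto
    then obtain i where i: "i \<in> {0..<2*n}" "S = R i" unfolding range_R by blast
    then show "S \<in> R ` {i\<in>{0..<2*n}. card (C i) = m}" using S(2) card_lines_meeting_R[of i] by auto
  qed
  show "R ` {i\<in>{0..<2*n}. card (C i) = m} \<subseteq> {S. unbounded_gonality (range line) m S}"
    using unbounded_gonality_R by auto
qed

lemma card_gonality_regions:
  "card {S. unbounded_gonality (range line) m S} = card {i\<in>{0..<2*n}. card (C i) = m}"
  unfolding gonality_regions by (rule card_image) (rule inj_on_subset[OF inj_R], auto)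

lemma card_C: "card (C i) \<in> {2, 3, 4}"
  by (cases i rule: C_cases) (use n3 in auto)

subsection \<open>Extreme points\<close>

text \<open>\<open>J\<close> distinguishes the two directions of a line, as the forms show at
  \<open>h (k+1)\<close>, a point off that line.\<close>

lemma f_eq_of_J: assumes "n dvd j - k" "J j = J k" shows "f j x = f k x"
proof -
  have nk: "\<not> n dvd k - (k+1)" using not_dvd[of k "k+1"] n3 by simp
  have nj: "\<not> n dvd j - (k+1)"
  proof
    assume "n dvd j - (k+1)"
    then have "n dvd (j - k) - (j - (k+1))" using assms(1) by (rule dvd_diff[rotated])
    then have "n dvd 1" by simp
    then show False using zdvd_imp_le[of n 1] n3 by simp
  qed
  let ?h = "h (k+1)"
  show ?thesis
  proof (cases "J k")
    case True
    then have "f k ?h > 0" "f j ?h > 0" using h_pos[OF nk] h_pos[OF nj] assms(2) by auto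
    then have "f j ?h \<noteq> - f k ?h" by simp
    then show ?thesis using f_dvd[OF assms(1)] by blast
  next
    case False
    then have "f k ?h < 0" "f j ?h < 0" using h_neg[OF nk] h_neg[OF nj] assms(2) by auto
    then have "f j ?h \<noteq> - f k ?h" by simp
    then show ?thesis using f_dvd[OF assms(1)] by blast
  qed
qed

text \<open>Along the direction of line \<open>j\<close> each of these \<open>f k\<close> decreases,
  so \<open>f k P \<le> 0\<close> says that line \<open>k\<close> crosses line \<open>j\<close> at
  \<open>P\<close> or behind it. Thus \<open>P\<close> is the last intersection point in that
  direction.\<close>

lemma end_ofI:
  assumes "f j P = 0" "P \<in> intersection_points (range line)"
    "\<And>k. j < k \<Longrightarrow> k < j + n \<Longrightarrow> f k P \<le> 0"
  shows "end_of P (line j \<inter> intersection_points (range line))"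
proof -
  have "x \<in> ray P (- p j, - q j)" if x: "x \<in> line j \<inter> intersection_points (range line)" for x
  proof -
    have jw: "j \<in> {j-1+1..j-1+n}" using n3 by simp
    obtain l where l: "l \<in> {j-1+1..j-1+n}" "l \<noteq> j" "f l x = 0"
      using intersection_point_second_line[OF _ _ jw, of x] x by auto
    then have o: "j < l" "l < j + n" by auto
    then have D: "D l j < 0" using D_pos[of j l] D_swap[of j l] by simp
    have "- ((f l x - f l P) / D l j) \<ge> 0" (is "?t \<ge> 0")
      using assms(3)[OF o] l(3) D by (simp add: divide_nonpos_neg)
    moreover have "x = (fst P + ?t * - p j, snd P + ?t * - q j)"
      using line_param[of l j x P] D assms(1) x by simp
    ultimately show ?thesis by (rule rayI)
  qed
  then have "line j \<inter> intersection_points (range line) \<subseteq> ray P (- p j, - q j)" by blast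
  then show ?thesis using assms(1,2) unfolding end_of_def by auto
qed

text \<open>Crossings on different sides of \<open>P\<close> would force \<open>d\<close> to have
  opposite signs at \<open>k1\<close> and \<open>k2\<close>. But then \<open>w\<close> is parallel
  to line \<open>j\<close>, along which all these forms change in the same sense.\<close>

lemma end_ofD:
  assumes "f j P = 0" "end_of P (line j \<inter> intersection_points (range line))"
  shows "(\<forall>k. j < k \<and> k < j + n \<longrightarrow> f k P \<le> 0) \<or> (\<forall>k. j < k \<and> k < j + n \<longrightarrow> f k P \<ge> 0)"
proof (rule ccontr)
  assume "\<not> ?thesis"
  then obtain k1 k2 where k1: "j < k1" "k1 < j + n" "f k1 P > 0" and k2: "j < k2" "k2 < j + n" "f k2 P < 0"
    by (auto simp: not_le)
  obtain w where w: "line j \<inter> intersection_points (range line) \<subseteq> ray P w"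
    using assms(2) unfolding end_of_def by blast
  define d where "d k = p k * snd w - q k * fst w" for k
  have ray: "\<exists>t\<ge>0. f k P + t * d k = 0 \<and> t * d j = 0" if k: "j < k" "k < j + n" for k
  proof -
    have D: "D j k \<noteq> 0" using D_pos[OF k] by simp
    have "V j k \<in> line j \<inter> intersection_points (range line)"
      using V_on[OF D] not_dvd[OF k] intersection_points_iff by auto
    then have "V j k \<in> ray P w" using w by blast
    then obtain t where t: "t \<ge> 0" "V j k = (fst P + t * fst w, snd P + t * snd w)"
      unfolding ray_def by blast
    have "f l (V j k) = f l P + t * d l" for l unfolding t(2) by (simp add: f_def d_def algebra_simps)
    then show ?thesis using t(1) V_on[OF D] assms(1) by (metis add_0)
  qed
  obtain t1 where t1: "t1 \<ge> 0" "f k1 P + t1 * d k1 = 0" "t1 * d j = 0" using ray k1 by blast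
  obtain t2 where t2: "t2 \<ge> 0" "f k2 P + t2 * d k2 = 0" "t2 * d j = 0" using ray k2 by blast
  have "t1 * d k1 < 0" "t2 * d k2 > 0" using t1(2) t2(2) k1(3) k2(3)
    by (metis add_less_same_cancel1 add_pos_nonneg le_less_linear less_irrefl add.commute,
        metis add_neg_nonpos le_less_linear less_irrefl)
  then have d: "d k1 < 0" "d k2 > 0" "t1 \<noteq> 0" using t1(1) t2(1)
    by (auto simp: mult_less_0_iff zero_less_mult_iff)
  then have "d j = 0" using t1 by simp
  have "D j k2 * d k1 = D k1 k2 * d j + D j k1 * d k2" by (simp add: D_def d_def algebra_simps)
  then have "D j k2 * d k1 = D j k1 * d k2" using \<open>d j = 0\<close> by simp
  moreover have "D j k2 * d k1 < 0" "D j k1 * d k2 > 0"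
    using d D_pos[of j k1] D_pos[of j k2] k1 k2 by (auto simp: mult_less_0_iff)
  ultimately show False by simp
qed

text \<open>Passing from \<open>j\<close> to \<open>j + n\<close> turns a first point into a last
  one.\<close>

lemma end_ofD_directed:
  assumes "f j P = 0" "end_of P (line j \<inter> intersection_points (range line))"
  obtains j' where "n dvd j' - j" "\<And>k. j' < k \<Longrightarrow> k < j' + n \<Longrightarrow> f k P \<le> 0"
proof -
  from end_ofD[OF assms] show ?thesis
  proof
    assume "\<forall>k. j < k \<and> k < j + n \<longrightarrow> f k P \<le> 0"
    then show ?thesis using that[of j] by simp
  next
    assume *: "\<forall>k. j < k \<and> k < j + n \<longrightarrow> f k P \<ge> 0"
    have "f k P \<le> 0" if "j + n < k" "k < j + n + n" for k
      using *[rule_format, of "k-n"] that f_anti[of "k-n" P] by simp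
    then show ?thesis using that[of "j+n"] by simp
  qed
qed

lemma first_vertex_end:
  assumes "nxt i (i+1) k"
  shows "end_of (V (i+1) k) (line (i+1) \<inter> intersection_points (range line))"
proof (rule end_ofI)
  fix l assume "i + 1 < l" "l < i + 1 + n"
  then show "f l (V (i+1) k) \<le> 0" using V_in_R[OF assms] by (simp add: R_def)
qed (use nxt_V_on[OF assms] V_intersection[OF assms] in auto)

lemma last_vertex_end:
  assumes "nxt i k (i+n)"
  shows "end_of (V k (i+n)) (line (i+n) \<inter> intersection_points (range line))"
proof -
  \<comment> \<open>The vertex is the last intersection point in the direction of line
    \<open>i\<close>, which is line \<open>i+n\<close> reversed.\<close>
  have "line (i+n) = line i" by (rule line_eq_of_dvd) simp
  moreover have "end_of (V k (i+n)) (line i \<inter> intersection_points (range line))"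
  proof (rule end_ofI)
    fix l assume "i < l" "l < i + n"
    then show "f l (V k (i+n)) \<le> 0" using V_in_R[OF assms] by (simp add: R_def)
  next
    show "f i (V k (i+n)) = 0" using nxt_V_on[OF assms] f_anti[of i] by simp
  qed (rule V_intersection[OF assms])
  ultimately show ?thesis by simp
qed

lemma V_lines:
  assumes "nxt i j k" "V j k \<in> L" "L \<in> range line" shows "L = line j \<or> L = line k"
proof -
  obtain l where l: "l \<in> {i+1..i+n}" "L = line l" using assms(3) unfolding range_line[of i] by blast
  then show ?thesis using V_neg[OF assms(1) l(1)] assms(2) by force
qed

lemma a_eqI: "k \<in> {i+1..i+n} \<Longrightarrow> J k \<Longrightarrow> (\<And>l. l \<in> {i+1..i+n} \<Longrightarrow> J l \<Longrightarrow> k \<le> l) \<Longrightarrow> a i = k"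
  using a_in[of i] a_min[of k i] by (meson order_antisym)

lemma b_eqI: "k \<in> {i+1..i+n} \<Longrightarrow> J k \<Longrightarrow> (\<And>l. l \<in> {i+1..i+n} \<Longrightarrow> J l \<Longrightarrow> l \<le> k) \<Longrightarrow> b i = k"
  using b_in[of i] b_max[of k i] by (meson order_antisym)

lemma a_periodic: "a (i + 2 * n) = a i + 2 * n"
proof (rule a_eqI)
  fix l assume "l \<in> {i + 2 * n + 1..i + 2 * n + n}" "J l"
  then show "a i + 2 * n \<le> l" using a_min[of "l - 2*n" i] J_periodic[of "l - 2*n"] by simp
qed (use a_in[of i] J_periodic in auto)

lemma b_periodic: "b (i + 2 * n) = b i + 2 * n"
proof (rule b_eqI)
  fix l assume "l \<in> {i + 2 * n + 1..i + 2 * n + n}" "J l"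
  then show "l \<le> b i + 2 * n" using b_max[of "l - 2*n" i] J_periodic[of "l - 2*n"] by simp
qed (use b_in[of i] J_periodic in auto)

lemma V_periodic: "V (j + 2 * n) (k + 2 * n) = V j k"
proof -
  have *: "p (l + 2 * n) = p l" "q (l + 2 * n) = q l" "c (l + 2 * n) = c l" for l
    using p_anti[of l] p_anti[of "l+n"] q_anti[of l] q_anti[of "l+n"] c_anti[of l] c_anti[of "l+n"]
    by (simp_all add: algebra_simps)
  show ?thesis unfolding V_def D_def by (simp add: *)
qed

definition W :: "int \<Rightarrow> 'a \<times> 'a" where "W i = V (a i) (b i)"

lemma card_C_W_reduce:
  "card (C (i mod (2 * n))) = card (C i)" "W (i mod (2 * n)) = W i"
proof -
  have "card (C (i + 2 * n)) = card (C i)" for i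
    using card_lines_meeting_R[of i] card_lines_meeting_R[of "i + 2 * n"] by (simp add: R_periodic)
  then show "card (C (i mod (2 * n))) = card (C i)" by (rule periodic_reduce)
  have "W (i + 2 * n) = W i" for i by (simp add: W_def a_periodic b_periodic V_periodic)
  then show "W (i mod (2 * n)) = W i" by (rule periodic_reduce)
qed

lemma image_W_card: "{P. \<exists>i. card (C i) = m \<and> P = W i} = W ` {i\<in>{0..<2*n}. card (C i) = m}"
proof
  show "{P. \<exists>i. card (C i) = m \<and> P = W i} \<subseteq> W ` {i\<in>{0..<2*n}. card (C i) = m}"
  proof
    fix P assume "P \<in> {P. \<exists>i. card (C i) = m \<and> P = W i}"
    then obtain i where "card (C i) = m" "P = W i" by blast
    moreover have "i mod (2*n) \<in> {0..<2*n}" using n3 by simp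
    ultimately show "P \<in> W ` {i\<in>{0..<2*n}. card (C i) = m}"
      using card_C_W_reduce[of i] by (intro image_eqI[of _ _ "i mod (2*n)"]) auto
  qed
qed auto

lemma nxt_a_b: "a i < b i \<Longrightarrow> nxt i (a i) (b i)"
  using a_in[of i] b_in[of i] by (auto simp: nxt_def C_def)

text \<open>The vertex \<open>W i\<close> determines \<open>R i\<close>: among the four cells at \<open>W i\<close>, it is the one
  separated from the polygon by both lines through \<open>W i\<close>.\<close>

lemma R_eq_of_W:
  assumes "a i < b i"
  shows "R i = {x. \<forall>k. f k (W i) < 0 \<or> f k (W i) = 0 \<and> J k \<longrightarrow> f k x \<le> 0}"
proof (intro set_eqI iffI)
  note nx = nxt_a_b[OF assms]
  fix x assume x: "x \<in> R i"
  have "f k x \<le> 0" if k: "f k (W i) < 0 \<or> f k (W i) = 0 \<and> J k" for k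
  proof -
    obtain k' where k': "k' \<in> {i+1..i+n}" "n dvd k - k'" by (rule rep_ex)
    have le: "f k' x \<le> 0" using x k'(1) by (simp add: R_def)
    show ?thesis
    proof (cases "f k (W i) < 0")
      case True
      have "f k' (W i) \<le> 0" using V_in_R[OF nx] k'(1) by (simp add: R_def W_def)
      then have "f k (W i) \<noteq> - f k' (W i)" using True by simp
      then show ?thesis using f_dvd[OF k'(2)] le by metis
    next
      case False
      then have "f k (W i) = 0" "J k" using k by auto
      then have "f k' (W i) = 0" using f_zero_dvd[OF k'(2)] by simp
      then have "k' = a i \<or> k' = b i" using V_neg[OF nx k'(1)] by (force simp: W_def)
      then have "J k'" using a_in b_in by auto
      then show ?thesis using f_eq_of_J[OF k'(2)] \<open>J k\<close> le by simp
    qed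
  qed
  then show "x \<in> {x. \<forall>k. f k (W i) < 0 \<or> f k (W i) = 0 \<and> J k \<longrightarrow> f k x \<le> 0}" by blast
next
  note nx = nxt_a_b[OF assms]
  fix x assume x: "x \<in> {x. \<forall>k. f k (W i) < 0 \<or> f k (W i) = 0 \<and> J k \<longrightarrow> f k x \<le> 0}"
  have "f k x \<le> 0" if k: "k \<in> {i+1..i+n}" for k
  proof (cases "k = a i \<or> k = b i")
    case True
    then have "f k (W i) = 0" "J k" using nxt_V_on[OF nx] a_in b_in by (auto simp: W_def)
    then show ?thesis using x by simp
  next
    case False
    then have "f k (W i) < 0" using V_neg[OF nx k] by (simp add: W_def)
    then show ?thesis using x by simp
  qed
  then show "x \<in> R i" by (simp add: R_def)
qed

lemma card_C_2D:
  assumes "card (C i) = 2" shows "a i = i + 1" "b i = i + n" "C i = {i+1, i+n}"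
proof -
  have eq: "C i = {i+1, i+n}" using assms by (cases i rule: C_cases) (use n3 in auto)
  have "a i \<in> C i" "b i \<in> C i" by (simp_all add: C_def)
  then have "a i = i + 1 \<or> a i = i + n" "b i = i + 1 \<or> b i = i + n" using eq by auto
  then show "a i = i + 1" "b i = i + n" "C i = {i+1, i+n}"
    using a_le_b[of i] a_eq_b_imp[of i] eq n3 by auto
qed

lemma card_C_4D:
  assumes "card (C i) = 4" shows "i + 1 < a i" "a i < b i" "b i < i + n"
  using assms by (cases i rule: C_cases; use n3 in auto)+

text \<open>With two or four lines \<open>a i < b i\<close> holds and \<open>R_eq_of_W\<close>
  applies. With three lines \<open>a i = b i\<close> is possible, and then \<open>W i\<close> is a
  division by zero.\<close>

lemma inj_W: assumes "m \<noteq> 3" shows "inj_on W {i\<in>{0..<2*n}. card (C i) = m}"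
proof (rule inj_onI)
  have lt: "a i < b i" if "card (C i) = m" for i
    using card_C[of i] card_C_2D[of i] card_C_4D[of i] that assms n3 by auto
  fix i i' assume *: "i \<in> {i\<in>{0..<2*n}. card (C i) = m}" "i' \<in> {i\<in>{0..<2*n}. card (C i) = m}" "W i = W i'"
  then have "R i = R i'" using R_eq_of_W[OF lt[of i]] R_eq_of_W[OF lt[of i']] by simp
  then show "i = i'" using inj_R * by (auto dest: inj_onD)
qed

lemma extreme_of_two: assumes "card (C i) = 2" shows "extreme_point (range line) (W i)"
proof -
  note C2 = card_C_2D[OF assms]
  have nx: "nxt i (i+1) (i+n)" using nxt_a_b[of i] C2 n3 by simp
  have W: "W i = V (i+1) (i+n)" by (simp add: W_def C2)
  show ?thesis unfolding extreme_point_def W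
  proof (intro conjI ballI impI)
    fix L assume "L \<in> range line" "V (i+1) (i+n) \<in> L"
    then have "L = line (i+1) \<or> L = line (i+n)" using V_lines[OF nx] by simp
    then show "end_of (V (i+1) (i+n)) (L \<inter> intersection_points (range line))"
      using first_vertex_end[OF nx] last_vertex_end[OF nx] by metis
  qed (rule V_intersection[OF nx])
qed

text \<open>The point \<open>P\<close> is the last one on both directed lines. If \<open>j+1\<close>
  came before \<open>k\<close>, the condition for \<open>j\<close> would give
  \<open>f (j+1) P \<le> 0\<close> and the condition for \<open>k\<close> the opposite inequality,
  so three lines would meet in \<open>P\<close>. Hence \<open>k = j + 1\<close>, and the condition
  for \<open>j\<close> puts \<open>P\<close> into \<open>R j\<close>, on both its ray lines.\<close>

lemma two_of_consecutive:
  assumes "j < k" "k < j + n" "f j P = 0" "f k P = 0"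
    and j: "\<And>l. j < l \<Longrightarrow> l < j + n \<Longrightarrow> f l P \<le> 0" and k: "\<And>l. k < l \<Longrightarrow> l < k + n \<Longrightarrow> f l P \<le> 0"
  shows "card (C j) = 2 \<and> P = W j"
proof -
  have "k = j + 1"
  proof (rule ccontr)
    assume "k \<noteq> j + 1"
    then have l: "j < j + 1" "j + 1 < k" using assms by auto
    have "f (j+1) P \<le> 0" using j[of "j+1"] l assms by simp
    moreover have "f (j+1+n) P \<le> 0" using k[of "j+1+n"] l assms by simp
    ultimately have "f (j+1) P = 0" by (simp add: f_anti)
    then show False using no_concurrent_ordered[of j "j+1" k P] l assms by blast
  qed
  have PR: "P \<in> R j"
  proof -
    have "f l P \<le> 0" if "l \<in> {j+1..j+n}" for l
    proof (cases "l = j + n")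
      case True then show ?thesis using assms(3) f_anti[of j P] by simp
    next
      case False then show ?thesis using j[of l] that by simp
    qed
    then show ?thesis by (simp add: R_def)
  qed
  have last: "f (j+n) P = 0" using assms(3) by (simp add: f_anti)
  have IP: "P \<in> intersection_points (range line)"
    using assms not_dvd[of j k] intersection_points_iff by blast
  have first: "f (j+1) P = 0" using assms(4) \<open>k = j + 1\<close> by simp
  have "\<not> nxt j l (j+1)" for l using nxt_D[of j l "j+1"] by auto
  then obtain l where l: "nxt j (j+1) l" "P = V (j+1) l"
    using R_line_vertex[OF PR first _ IP] n3 by auto
  have "l = j + n"
  proof (rule ccontr)
    assume "l \<noteq> j + n"
    then show False
      using V_neg[OF l(1), of "j+n"] n3 last l(2) by simp
  qed
  then have nx: "nxt j (j+1) (j+n)" using l by simp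
  have "C j = {j+1, j+n}"
  proof
    show "C j \<subseteq> {j+1, j+n}"
    proof
      fix r assume r: "r \<in> C j"
      then have "\<not> (j + 1 < r \<and> r < j + n)" using nx unfolding nxt_def by blast
      then show "r \<in> {j+1, j+n}" using subsetD[OF C_sub r] by auto
    qed
  qed (use first_in_C last_in_C in auto)
  then have "card (C j) = 2" using n3 by simp
  then show ?thesis using card_C_2D[of j] l \<open>l = j + n\<close> by (simp add: W_def)
qed

lemma two_of_extreme:
  assumes "extreme_point (range line) P" shows "\<exists>i. card (C i) = 2 \<and> P = W i"
proof -
  have IP: "P \<in> intersection_points (range line)"
    and e: "\<And>l. f l P = 0 \<Longrightarrow> end_of P (line l \<inter> intersection_points (range line))"
    using assms unfolding extreme_point_def by auto
  obtain j0 k0 where jk0: "\<not> n dvd j0 - k0" "f j0 P = 0" "f k0 P = 0" using IP intersection_points_iff by blast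
  obtain j where j: "n dvd j - j0" "\<And>l. j < l \<Longrightarrow> l < j + n \<Longrightarrow> f l P \<le> 0"
    by (rule end_ofD_directed[OF jk0(2) e[OF jk0(2)]]) blast
  obtain k1 where k1: "n dvd k1 - k0" "\<And>l. k1 < l \<Longrightarrow> l < k1 + n \<Longrightarrow> f l P \<le> 0"
    by (rule end_ofD_directed[OF jk0(3) e[OF jk0(3)]]) blast
  have fp: "f (l + r * (2 * n)) P = f l P" for l r
    using periodic_reduce[of "\<lambda>l. f l P", OF f_periodic, of "l + r * (2 * n)"]
      periodic_reduce[of "\<lambda>l. f l P", OF f_periodic, of l] by simp
  \<comment> \<open>Shifting \<open>k1\<close> by a multiple of 2n preserves its direction, and with
    it the condition on \<open>P\<close>, and brings it within n of \<open>j\<close>.\<close>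
  define r where "r = (k1 - j + n) div (2 * n)"
  define k where "k = k1 + (- r) * (2 * n)"
  have "k - j + n = (k1 - j + n) mod (2 * n)"
    unfolding k_def r_def by (simp add: minus_div_mult_eq_mod[symmetric] algebra_simps)
  moreover have "0 \<le> (k1 - j + n) mod (2 * n)" "(k1 - j + n) mod (2 * n) < 2 * n" using n3 by auto
  ultimately have bd: "j - n \<le> k" "k < j + n" by auto
  have k: "f l P \<le> 0" if "k < l" "l < k + n" for l
    using k1(2)[of "l + r * (2*n)"] that fp[of l r] unfolding k_def by (simp add: algebra_simps)
  have "k - k0 = (k1 - k0) - n * (r * 2)" by (simp add: k_def)
  then have "n dvd k - k0" using k1(1) by (simp only: dvd_diff dvd_triv_left)
  have jk: "\<not> n dvd j - k"
  proof
    assume "n dvd j - k"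
    then have "n dvd (j - k) - (j - j0) + (k - k0)" 
      by (rule dvd_add[OF dvd_diff[OF _ j(1)] \<open>n dvd k - k0\<close>])
    then show False using jk0(1) by simp
  qed
  have z: "f j P = 0" "f k P = 0"
    using f_zero_dvd[OF j(1)] f_zero_dvd[OF \<open>n dvd k - k0\<close>] jk0 by auto
  have "k \<noteq> j" "k \<noteq> j - n" using jk by auto
  then consider "j < k" | "k < j" "j < k + n" using bd by linarith
  then show ?thesis
  proof cases
    case 1 then show ?thesis using two_of_consecutive[of j k P] bd z j(2) k by blast
  next
    case 2 then show ?thesis using two_of_consecutive[of k j P] z j(2) k by blast
  qed
qed

lemma card_extreme_points: "card {P. extreme_point (range line) P} = card {i\<in>{0..<2*n}. card (C i) = 2}"
proof -
  have "{P. extreme_point (range line) P} = {P. \<exists>i. card (C i) = 2 \<and> P = W i}"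
    using two_of_extreme extreme_of_two by blast
  then show ?thesis unfolding image_W_card using card_image[OF inj_W[of 2]] by simp
qed

subsection \<open>Boundary segments\<close>

text \<open>This makes the cell across a bounded edge of \<open>R i\<close> bounded. For a ray
  direction, \<open>d k\<close> is nonnegative, yet also a positive combination of the nonpositive
  \<open>d (i+1)\<close> and \<open>d (i+n)\<close>; so these two vanish and the direction is
  zero.\<close>

lemma flipped_cell_bounded:
  assumes "i + 1 < k" "k < i + n" "f k z > 0" "f (i+1) z < 0" "f (i+n) z < 0"
  shows "\<not> contains_ray (cell z)"
proof
  assume "contains_ray (cell z)"
  then obtain v w where vw: "ray v w \<subseteq> cell z" "w \<noteq> (0, 0)" unfolding contains_ray_def by blast
  define d where "d k = p k * snd w - q k * fst w" for k
  have d_pos: "f k z > 0 \<Longrightarrow> d k \<ge> 0" for k using cell_ray_direction[OF vw(1)] by (simp add: d_def)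
  have d_neg: "f k z < 0 \<Longrightarrow> d k \<le> 0" for k
    using d_pos[of "k+n"] by (simp add: f_anti d_def p_anti q_anti)
  have D: "D (i+1) (i+n) > 0" "D k (i+n) > 0" "D (i+1) k > 0" using assms(1,2) by (auto intro!: D_pos)
  have "D (i+1) (i+n) * d k = D k (i+n) * d (i+1) + D (i+1) k * d (i+n)"
    by (simp add: D_def d_def algebra_simps)
  moreover have "D (i+1) (i+n) * d k \<ge> 0" using D d_pos assms(3) by simp
  moreover have "D k (i+n) * d (i+1) \<le> 0" "D (i+1) k * d (i+n) \<le> 0"
    using D d_neg assms by (simp_all add: mult_nonneg_nonpos)
  ultimately have "D k (i+n) * d (i+1) = 0" "D (i+1) k * d (i+n) = 0" by linarith+
  then have "d (i+1) = 0" "d (i+n) = 0" using D by auto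
  then have "w = (0, 0)"
    by (intro V_unique[of "i+1" "i+n"]) (use D in \<open>auto simp: f_def d_def\<close>)
  then show False using vw by simp
qed

text \<open>Only two cells touch a point \<open>m\<close> of a single line; this is a membership
  test for the one to the left of line \<open>k\<close>, in terms of the signs at
  \<open>m\<close>.\<close>

lemma side_cell:
  assumes m: "f k m = 0" "\<And>j. \<not> n dvd j - k \<Longrightarrow> f j m \<noteq> 0"
    and z: "f k z > 0" "\<And>j. f j m > 0 \<Longrightarrow> f j z > 0"
    and y: "f k y \<ge> 0" "\<And>j. f j m > 0 \<Longrightarrow> f j y \<ge> 0"
  shows "y \<in> cell z"
proof -
  have "f j y \<ge> 0" if j: "f j z > 0" for j
  proof (cases "n dvd j - k")
    case True
    then have "f j z \<noteq> - f k z" using j z(1) by simp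
    then show ?thesis using f_dvd[OF True] y(1) by metis
  next
    case False
    have "\<not> f j m < 0"
    proof
      assume "f j m < 0"
      then have "f (j+n) z > 0" using z(2)[of "j+n"] by (simp add: f_anti)
      then show False using j by (simp add: f_anti)
    qed
    then have "f j m > 0" using m(2)[OF False] by simp
    then show ?thesis by (rule y(2))
  qed
  then show ?thesis by (simp add: cell_def)
qed

section \<open>Segments between adjacent intersection points\<close>

lemma adjacent_between:
  assumes "adjacent_points (range line) (line k) P Q" "\<not> n dvd j - k" "0 \<le> t" "t \<le> 1"
    "f j (fst P + t * (fst Q - fst P), snd P + t * (snd Q - snd P)) = 0" (is "f j ?y = 0")
  shows "?y = P \<or> ?y = Q"
proof -
  have z: "f k P = 0" "f k Q = 0" and s: "seg P Q \<inter> intersection_points (range line) = {P, Q}"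
    using assms(1) unfolding adjacent_points_def by auto
  have "f k ?y = 0" unfolding f_affine using z by simp
  then have "?y \<in> intersection_points (range line)" using assms(2,5) intersection_points_iff by blast
  moreover have "?y \<in> seg P Q" using assms(3,4) unfolding seg_def by blast
  ultimately show ?thesis using s by blast
qed

lemma adjacent_same_side:
  assumes "adjacent_points (range line) (line k) P Q" "\<not> n dvd j - k" "f j P > 0"
  shows "\<not> f j Q < 0"
proof
  assume Q: "f j Q < 0"
  let ?t = "f j P / (f j P - f j Q)"
  let ?y = "(fst P + ?t * (fst Q - fst P), snd P + ?t * (snd Q - snd P))"
  have d: "f j P - f j Q > 0" using assms(3) Q by simp
  have t: "0 \<le> ?t" "?t \<le> 1" using assms(3) Q d by (simp_all add: divide_le_eq)
  have "f j ?y = f j P - ?t * (f j P - f j Q)" unfolding f_affine by (simp only: algebra_simps)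
  then have "f j ?y = 0" using d by simp
  then have "?y = P \<or> ?y = Q" by (rule adjacent_between[OF assms(1,2) t])
  then show False using \<open>f j ?y = 0\<close> assms(3) Q by (metis less_irrefl)
qed

text \<open>The midpoint is the test point for the whole segment: it is no intersection point, so
  exactly one line passes through it.\<close>

lemma adjacent_midpoint:
  assumes "adjacent_points (range line) (line k) P Q"
  obtains m where "m \<in> seg P Q" "f k m = 0" "\<And>j. \<not> n dvd j - k \<Longrightarrow> f j m \<noteq> 0"
    "\<And>j. 2 * f j m = f j P + f j Q"
proof
  let ?h = "1 / 2 :: 'a"
  let ?m = "(fst P + ?h * (fst Q - fst P), snd P + ?h * (snd Q - snd P))"
  have fm: "2 * f j ?m = f j P + f j Q" for j unfolding f_affine by (simp add: field_simps)
  then show "2 * f j ?m = f j P + f j Q" for j .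
  show "?m \<in> seg P Q" unfolding seg_def mem_Collect_eq by (intro exI[of _ ?h]) simp
  have PQ: "P \<noteq> Q" "f k P = 0" "f k Q = 0" using assms unfolding adjacent_points_def by auto
  then show "f k ?m = 0" using fm[of k] by simp
  show "f j ?m \<noteq> 0" if j: "\<not> n dvd j - k" for j
  proof
    assume z: "f j ?m = 0"
    then have "?m = P \<or> ?m = Q" by (intro adjacent_between[OF assms j]) auto
    then show False using PQ(1) by (auto simp: prod_eq_iff field_simps)
  qed
qed

section \<open>The boundary segments are the bounded edges of the \<open>R i\<close>\<close>

definition bounded_edges :: "int \<Rightarrow> ('a \<times> 'a) set set" where
  "bounded_edges i = {line k \<inter> R i | k. k \<in> C i \<and> k \<noteq> i + 1 \<and> k \<noteq> i + n}"

lemma bounded_edgesE: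
  assumes "e \<in> bounded_edges i"
  obtains j k l where "nxt i j k" "nxt i k l" "e = line k \<inter> R i" "i + 1 < k" "k < i + n"
proof -
  obtain k where k: "k \<in> C i" "k \<noteq> i + 1" "k \<noteq> i + n" "e = line k \<inter> R i"
    using assms unfolding bounded_edges_def by blast
  then obtain j l where "nxt i j k" "nxt i k l" using nxt_ex[of k i] prev_ex[of k i] by metis
  moreover have "i + 1 < k" "k < i + n" using subsetD[OF C_sub k(1)] k by auto
  ultimately show ?thesis using k(4) that by blast
qed

lemma window_not_dvd:
  assumes "j \<in> {i+1..i+n}" "k \<in> {i+1..i+n}" "j \<noteq> k" shows "\<not> n dvd j - k"
proof
  assume "n dvd j - k"
  moreover have "\<bar>j - k\<bar> < n" using assms(1,2) by (simp add: abs_less_iff)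
  ultimately show False using dvd_small assms(3) by blast
qed

lemma inner_point_neg:
  assumes "m \<in> R i" "\<And>j. \<not> n dvd j - k \<Longrightarrow> f j m \<noteq> 0" "l \<in> {i+1..i+n}" "\<not> n dvd l - k"
  shows "f l m < 0"
proof -
  have "f l m \<le> 0" using assms(1,3) by (simp add: R_def)
  then show ?thesis using assms(2)[OF assms(4)] by simp
qed

text \<open>The edge belongs to the cell on its other side as well, which is bounded by
  \<open>flipped_cell_bounded\<close>.\<close>

lemma bounded_edge_in_bounded_union:
  assumes jk: "nxt i j k" and kl: "nxt i k l" and k: "i + 1 < k" "k < i + n"
  shows "line k \<inter> R i \<subseteq> bounded_union (range line)"
proof
  fix x assume x: "x \<in> line k \<inter> R i"
  obtain m where m: "m \<in> seg (V j k) (V k l)" "f k m = 0" "\<And>j. \<not> n dvd j - k \<Longrightarrow> f j m \<noteq> 0"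
    by (rule adjacent_midpoint[OF edge_adjacent[OF jk kl]]) blast
  have mR: "m \<in> R i" using m(1) edge_seg[OF jk kl] by blast
  obtain z where z: "f k z > 0" "\<And>j. f j m > 0 \<Longrightarrow> f j z > 0" "\<And>j. f j z \<noteq> 0"
    by (rule side_point[OF m(2,3) zero_less_one]) auto
  have neg: "f r z < 0" if r: "r \<in> {i+1..i+n}" "\<not> n dvd r - k" for r
  proof -
    have "f r m < 0" by (rule inner_point_neg[OF mR m(3) r])
    then show ?thesis using z(2)[of "r+n"] by (simp add: f_anti)
  qed
  have "f (i+1) z < 0" "f (i+n) z < 0"
    using neg[of "i+1"] neg[of "i+n"] not_dvd[of "i+1" k] not_dvd[of k "i+n"] k by auto
  then have "\<not> contains_ray (cell z)" using flipped_cell_bounded[OF k z(1)] by blast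
  then have "bounded_region (range line) (cell z)"
    unfolding bounded_region_def using region_cell z(3) by blast
  moreover have "x \<in> cell z"
  proof (rule side_cell[OF m(2,3) z(1,2)])
    fix r assume r: "f r m > 0"
    obtain r' where r': "r' \<in> {i+1..i+n}" "n dvd r - r'" by (rule rep_ex)
    have "f r' m \<le> 0" "f r' x \<le> 0" using mR x r'(1) by (auto simp: R_def)
    then have "f r m \<noteq> f r' m" using r by simp
    then have "f r x = - f r' x" using f_dvd[OF r'(2)] by metis
    then show "f r x \<ge> 0" using \<open>f r' x \<le> 0\<close> by simp
  qed (use x in simp_all)
  ultimately show "x \<in> bounded_union (range line)" unfolding bounded_union_def by blast
qed

text \<open>An arbitrarily small step along the sum of the directions of \<open>i\<close> and
  \<open>i+1\<close> leads into the interior of \<open>R i\<close>, and an interior point belongs to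
  no other region.\<close>

lemma R_near_outside_bounded_union:
  assumes "x \<in> R i" "e > 0" shows "square x e - bounded_union (range line) \<noteq> {}"
proof -
  obtain t where t: "t > 0" "(fst x + t * (p i + p (i+1)), snd x + t * (q i + q (i+1))) \<in> square x e"
    (is "?y \<in> _") using small_move[OF assms(2)] by blast
  have neg: "f k ?y < 0" if k: "k \<in> {i+1..i+n}" for k
  proof -
    have "f k ?y = f k x + t * (D k i + D k (i+1))" by (simp add: f_def D_def algebra_simps)
    moreover have "t * (D k i + D k (i+1)) < 0" using D_first[OF k] t(1) by (simp add: mult_pos_neg)
    moreover have "f k x \<le> 0" using assms(1) k by (simp add: R_def)
    ultimately show ?thesis by simp
  qed
  have "?y \<notin> bounded_union (range line)"
  proof
    assume "?y \<in> bounded_union (range line)"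
    then obtain S where S: "bounded_region (range line) S" "?y \<in> S" unfolding bounded_union_def by blast
    then obtain z where z: "\<And>k. f k z \<noteq> 0" "S = cell z"
      using region_imp_cell unfolding bounded_region_def by blast
    have "f k z < 0" if k: "k \<in> {i+1..i+n}" for k
    proof -
      have "\<not> f k z > 0" using neg[OF k] S(2) z(2) by (force simp: cell_def)
      then show ?thesis using z(1)[of k] by simp
    qed
    then have "S = R i" using cell_eq_R z(2) by blast
    then show False using S(1) R_contains_ray by (simp add: bounded_region_def)
  qed
  then show ?thesis using t(2) by blast
qed

lemma bounded_edge_boundary_segment:
  assumes "e \<in> bounded_edges i" shows "e \<in> boundary_segments (range line)"
proof -
  obtain j k l where e: "nxt i j k" "nxt i k l" "e = line k \<inter> R i" "i + 1 < k" "k < i + n"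
    using assms by (rule bounded_edgesE)
  have seg: "e = seg (V j k) (V k l)" using edge_seg e by simp
  have "x \<in> boundary (bounded_union (range line))" if x: "x \<in> e" for x
  proof -
    have "x \<in> bounded_union (range line)" using bounded_edge_in_bounded_union[OF e(1,2,4,5)] x e(3) by blast
    moreover have "x \<in> square x r" if "r > 0" for r using that by (simp add: square_def)
    ultimately show ?thesis
      using R_near_outside_bounded_union[of x i] x e(3) unfolding boundary_def by blast
  qed
  then have "seg (V j k) (V k l) \<subseteq> boundary (bounded_union (range line))" using seg by blast
  then show ?thesis using edge_adjacent[OF e(1,2)] unfolding boundary_segments_def seg by blast
qed

text \<open>If both cells at \<open>m\<close> were bounded, together they would cover a square
  around \<open>m\<close>. The cell on the right is treated as the left one of the reversed line
  \<open>k + n\<close>.\<close>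

lemma boundary_point_unbounded_region:
  assumes m: "f k m = 0" "\<And>j. \<not> n dvd j - k \<Longrightarrow> f j m \<noteq> 0"
    and bd: "m \<in> boundary (bounded_union (range line))"
  shows "\<exists>i. m \<in> R i"
proof (rule ccontr)
  assume no: "\<nexists>i. m \<in> R i"
  obtain e where e: "e > 0" "\<And>j y. y \<in> square m e \<Longrightarrow> f j m > 0 \<Longrightarrow> f j y > 0" by (rule near[of m]) blast
  have side: "y \<in> bounded_union (range line)"
    if k': "f k' m = 0" "\<And>j. \<not> n dvd j - k' \<Longrightarrow> f j m \<noteq> 0" and y: "y \<in> square m e" "f k' y \<ge> 0" for k' y
  proof -
    obtain z where z: "f k' z > 0" "\<And>j. f j m > 0 \<Longrightarrow> f j z > 0" "\<And>j. f j z \<noteq> 0"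
      by (rule side_point[OF k' zero_less_one]) auto
    have reg: "region (range line) (cell z)" using region_cell z(3) by blast
    have "m \<in> cell z" by (rule side_cell[OF k' z(1,2)]) (use k' in auto)
    then have "\<not> contains_ray (cell z)" using no unbounded_region_iff reg unfolding unbounded_region_def by blast
    moreover have "y \<in> cell z"
      by (rule side_cell[OF k' z(1,2)]) (use e(2)[OF y(1)] y(2) in \<open>auto simp: less_imp_le\<close>)
    ultimately show ?thesis using reg unfolding bounded_union_def bounded_region_def by blast
  qed
  have "y \<in> bounded_union (range line)" if y: "y \<in> square m e" for y
  proof (cases "f k y \<ge> 0")
    case True then show ?thesis using side[OF m y] by blast
  next
    case False
    have "f (k+n) m = 0" using m(1) by (simp add: f_anti)
    moreover have "f j m \<noteq> 0" if "\<not> n dvd j - (k+n)" for j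
    proof -
      have "\<not> n dvd j - k"
      proof
        assume "n dvd j - k"
        then have "n dvd (j - k) - n" by simp
        then show False using that by (simp add: algebra_simps)
      qed
      then show ?thesis by (rule m(2))
    qed
    ultimately show ?thesis using side[of "k+n" y] y False by (simp add: f_anti)
  qed
  then have "square m e - bounded_union (range line) = {}" by blast
  then show False using bd e(1) unfolding boundary_def by blast
qed

text \<open>The midpoint lies in some \<open>R i\<close>, and no line separates it from the ends, so
  both ends lie in \<open>R i\<close>. A ray line carries only one vertex of \<open>R i\<close>;
  hence \<open>k\<close> is an inner line of \<open>C i\<close> and the ends are its two
  vertices.\<close>

lemma boundary_segment_bounded_edge:
  assumes "s \<in> boundary_segments (range line)" shows "\<exists>i. s \<in> bounded_edges i"
proof -
  obtain P Q k0 where s: "s = seg P Q" and adj0: "adjacent_points (range line) (line k0) P Q"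
    and sub: "seg P Q \<subseteq> boundary (bounded_union (range line))"
    using assms unfolding boundary_segments_def by blast
  obtain m where m: "m \<in> seg P Q" "f k0 m = 0" "\<And>j. \<not> n dvd j - k0 \<Longrightarrow> f j m \<noteq> 0"
    "\<And>j. 2 * f j m = f j P + f j Q"
    by (rule adjacent_midpoint[OF adj0]) blast
  obtain i where mR: "m \<in> R i" using boundary_point_unbounded_region[OF m(2,3)] m(1) sub by blast
  obtain k where k: "k \<in> {i+1..i+n}" "n dvd k0 - k" by (rule rep_ex)
  have lk: "line k0 = line k" using line_eq_of_dvd[OF k(2)] .
  have adj: "adjacent_points (range line) (line k) P Q" using adj0 lk by simp
  then have PQ: "P \<noteq> Q" "f k P = 0" "f k Q = 0" "P \<in> intersection_points (range line)"
    "Q \<in> intersection_points (range line)" unfolding adjacent_points_def by auto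
  have "f k m = 0" using m(2) f_zero_dvd[OF k(2)] by simp
  then have kC: "k \<in> C i" using R_off_C[OF mR k(1)] by force
  have le: "f j P \<le> 0 \<and> f j Q \<le> 0" if j: "j \<in> {i+1..i+n}" for j
  proof (cases "j = k")
    case True then show ?thesis using PQ by simp
  next
    case False
    have nd: "\<not> n dvd j - k" using window_not_dvd[OF j k(1) False] .
    have nd': "\<not> n dvd (j + n) - k"
    proof
      assume "n dvd (j + n) - k"
      then have "n dvd ((j + n) - k) - n" by (rule dvd_diff) simp
      moreover have "((j + n) - k) - n = j - k" by simp
      ultimately show False using nd by metis
    qed
    have "f j m \<le> 0" using mR j by (simp add: R_def)
    then have "f j P + f j Q \<le> 0" using m(4)[of j] by simp
    moreover have "\<not> (f j P > 0 \<and> f j Q < 0)" using adjacent_same_side[OF adj nd] by blast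
    moreover have "\<not> (f j P < 0 \<and> f j Q > 0)" using adjacent_same_side[OF adj nd'] by (simp add: f_anti)
    ultimately show ?thesis by linarith
  qed
  then have PR: "{P, Q} \<subseteq> line k \<inter> R i \<inter> intersection_points (range line)"
    using PQ by (auto simp: R_def)
  have "k \<noteq> i + 1"
  proof
    assume "k = i + 1"
    moreover have "i + 1 \<noteq> i + n" using n3 by simp
    then obtain l where "nxt i (i+1) l" using nxt_ex[OF first_in_C] by metis
    ultimately show False using first_vertex(1)[of i l] PR PQ(1) by auto
  qed
  moreover have "k \<noteq> i + n"
  proof
    assume "k = i + n"
    moreover have "i + n \<noteq> i + 1" using n3 by simp
    then obtain l where "nxt i l (i+n)" using prev_ex[OF last_in_C] by metis
    ultimately show False using last_vertex(1)[of i l] PR PQ(1) by auto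
  qed
  ultimately have be: "line k \<inter> R i \<in> bounded_edges i" using kC unfolding bounded_edges_def by blast
  obtain j l where jl: "nxt i j k" "nxt i k l"
    using nxt_ex[OF kC \<open>k \<noteq> i + n\<close>] prev_ex[OF kC \<open>k \<noteq> i + 1\<close>] by metis
  have "{P, Q} \<subseteq> {V j k, V k l}" using PR edge_vertices[OF jl] by simp
  then have "(P = V j k \<and> Q = V k l) \<or> (P = V k l \<and> Q = V j k)" using PQ(1) by auto
  then have "s = line k \<inter> R i" using s edge_seg[OF jl] seg_commute by metis
  then show ?thesis using be by blast
qed

text \<open>Of the two cells at the midpoint of \<open>e\<close>, one is \<open>R i\<close> and the
  other is bounded, so the unbounded \<open>R i'\<close> has to be \<open>R i\<close>. This keeps
  the edges of the traversal from being repeated.\<close>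

lemma bounded_edges_disjoint:
  assumes "e \<in> bounded_edges i" "e \<in> bounded_edges i'" shows "R i = R i'"
proof -
  obtain j k l where e: "nxt i j k" "nxt i k l" "e = line k \<inter> R i" "i + 1 < k" "k < i + n"
    using assms(1) by (rule bounded_edgesE)
  obtain m where m: "m \<in> seg (V j k) (V k l)" "f k m = 0" "\<And>j. \<not> n dvd j - k \<Longrightarrow> f j m \<noteq> 0"
    by (rule adjacent_midpoint[OF edge_adjacent[OF e(1,2)]]) blast
  obtain k' where k': "e = line k' \<inter> R i'" using assms(2) unfolding bounded_edges_def by blast
  have me: "m \<in> e" using m(1) edge_seg[OF e(1,2)] e(3) by simp
  have mR: "m \<in> R i" using me unfolding e(3) by blast
  have mR': "m \<in> R i'" using me unfolding k' by blast
  obtain z where z: "\<And>r. r \<in> {i'+1..i'+n} \<Longrightarrow> f r z < 0" by (rule R_interior[of i']) blast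
  have cz: "cell z = R i'" using cell_eq_R z by blast
  have neg: "f r z < 0" if r: "r \<in> {i+1..i+n}" "r \<noteq> k" for r
  proof -
    have nd: "\<not> n dvd r - k" using window_not_dvd[OF r(1) _ r(2)] e(4,5) by simp
    have rm: "f r m < 0" by (rule inner_point_neg[OF mR m(3) r(1) nd])
    obtain r' where r': "r' \<in> {i'+1..i'+n}" "n dvd r - r'" by (rule rep_ex)
    have "f r' m \<le> 0" using mR' r'(1) by (simp add: R_def)
    then have "f r m \<noteq> - f r' m" using rm by simp
    then have "f r z = f r' z" using f_dvd[OF r'(2)] by metis
    then show ?thesis using z[OF r'(1)] by simp
  qed
  have "\<not> f k z > 0"
  proof
    assume "f k z > 0"
    moreover have "f (i+1) z < 0" "f (i+n) z < 0" using neg[of "i+1"] neg[of "i+n"] e(4,5) n3 by auto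
    ultimately show False using flipped_cell_bounded[OF e(4,5)] cz R_contains_ray by metis
  qed
  moreover have "f k z \<noteq> 0"
  proof -
    obtain r' where r': "r' \<in> {i'+1..i'+n}" "n dvd k - r'" by (rule rep_ex)
    then show ?thesis using f_zero_dvd[OF r'(2), of z] z[OF r'(1)] by auto
  qed
  ultimately have "f k z < 0" by simp
  then have "f r z < 0" if "r \<in> {i+1..i+n}" for r using neg[OF that] by (cases "r = k") auto
  then show ?thesis using cell_eq_R[of i z] cz by simp
qed

lemma bounded_edges_periodic: "bounded_edges (i mod (2 * n)) = bounded_edges i"
proof (rule periodic_reduce)
  fix i
  have C: "k \<in> C (i + 2 * n) \<longleftrightarrow> k - 2 * n \<in> C i" for k
    by (auto simp: C_def a_periodic b_periodic)
  have L: "line (k - 2 * n) = line k" for k by (rule line_eq_of_dvd) simp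
  show "bounded_edges (i + 2 * n) = bounded_edges i"
  proof
    show "bounded_edges (i + 2 * n) \<subseteq> bounded_edges i"
    proof
      fix e assume "e \<in> bounded_edges (i + 2 * n)"
      then obtain k where "k \<in> C (i + 2*n)" "k \<noteq> i + 2*n + 1" "k \<noteq> i + 2*n + n" "e = line k \<inter> R i"
        unfolding bounded_edges_def R_periodic by blast
      then show "e \<in> bounded_edges i" unfolding bounded_edges_def mem_Collect_eq
        by (intro exI[of _ "k - 2*n"]) (auto simp: C L)
    qed
    show "bounded_edges i \<subseteq> bounded_edges (i + 2 * n)"
    proof
      fix e assume "e \<in> bounded_edges i"
      then obtain k where "k \<in> C i" "k \<noteq> i + 1" "k \<noteq> i + n" "e = line k \<inter> R i"
        unfolding bounded_edges_def by blast
      then show "e \<in> bounded_edges (i + 2 * n)" unfolding bounded_edges_def mem_Collect_eq R_periodic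
        using L[of "k + 2*n"] by (intro exI[of _ "k + 2*n"]) (auto simp: C)
    qed
  qed
qed

lemma boundary_segments_eq:
  "boundary_segments (range line) = (\<Union>i\<in>{0..<2*n}. bounded_edges i)"
proof
  show "boundary_segments (range line) \<subseteq> (\<Union>i\<in>{0..<2*n}. bounded_edges i)"
  proof
    fix s assume "s \<in> boundary_segments (range line)"
    then obtain i where "s \<in> bounded_edges i" using boundary_segment_bounded_edge by blast
    then have "s \<in> bounded_edges (i mod (2*n))" by (simp add: bounded_edges_periodic)
    moreover have "i mod (2*n) \<in> {0..<2*n}" using n3 by simp
    ultimately show "s \<in> (\<Union>i\<in>{0..<2*n}. bounded_edges i)" by blast
  qed
qed (use bounded_edge_boundary_segment in blast)

lemma boundary_segment_ends:
  assumes "seg P Q \<in> boundary_segments (range line)"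
  obtains i j k l where "nxt i j k" "nxt i k l" "seg P Q = line k \<inter> R i" "{P, Q} = {V j k, V k l}"
proof -
  obtain i where "seg P Q \<in> bounded_edges i" using boundary_segment_bounded_edge[OF assms(1)] by blast
  then obtain j k l where e: "nxt i j k" "nxt i k l" "seg P Q = line k \<inter> R i"
    by (rule bounded_edgesE) 
  then have sg: "seg P Q = seg (V j k) (V k l)" using edge_seg by simp
  define P1 where "P1 = V j k"
  define Q1 where "Q1 = V k l"
  have neg: "f j Q1 < 0" "f l P1 < 0" "f j P1 = 0" "f l Q1 = 0"
    using V_neg[OF e(2), of j] V_neg[OF e(1), of l] nxt_D[OF e(1)] nxt_D[OF e(2)]
      nxt_V_on[OF e(1)] nxt_V_on[OF e(2)] by (auto simp: P1_def Q1_def)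
  have in_seg: "P1 \<in> seg P Q" "Q1 \<in> seg P Q" unfolding sg P1_def Q1_def by (rule ends_in_seg)+
  \<comment> \<open>The form \<open>f r\<close> is nonpositive on the segment; if it vanished at an
    inner point, it would vanish on the whole segment. So ends can be recognised from the point set
    alone.\<close>
  have extremal: "X \<in> {P, Q}"
    if X: "X \<in> seg P Q" "r \<in> {i+1..i+n}" "f r X = 0" and Y: "Y \<in> seg P Q" "f r Y < 0" for r X Y
  proof (rule ccontr)
    assume no: "X \<notin> {P, Q}"
    have le: "f r P \<le> 0" "f r Q \<le> 0" 
      using ends_in_seg(1)[of P Q] ends_in_seg(2)[of Q P] X(2) unfolding e(3) by (auto simp: R_def)
    obtain t where t: "0 \<le> t" "t \<le> 1" "X = (fst P + t * (fst Q - fst P), snd P + t * (snd Q - snd P))"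
      using X(1) unfolding seg_def by blast
    obtain u where u: "Y = (fst P + u * (fst Q - fst P), snd P + u * (snd Q - snd P))"
      using Y(1) unfolding seg_def by blast
    have "t \<noteq> 0" "t \<noteq> 1" using no t(3) by (auto simp: prod_eq_iff)
    then have t': "0 < t" "t < 1" using t by auto
    have "(1 - t) * f r P + t * f r Q = 0" using X(3) unfolding t(3) f_affine .
    moreover have "(1 - t) * f r P \<le> 0" "t * f r Q \<le> 0" using le t by (simp_all add: mult_nonneg_nonpos)
    ultimately have "(1 - t) * f r P = 0" "t * f r Q = 0" by linarith+
    then have "f r P = 0" "f r Q = 0" using t' by auto
    then have "f r Y = 0" unfolding u f_affine by simp
    then show False using Y(2) by simp
  qed
  have "P1 \<in> {P, Q}" using extremal[OF in_seg(1) _ neg(3) in_seg(2) neg(1)] nxt_D[OF e(1)] by simp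
  moreover have "Q1 \<in> {P, Q}" using extremal[OF in_seg(2) _ neg(4) in_seg(1) neg(2)] nxt_D[OF e(2)] by simp
  moreover have "P1 \<noteq> Q1" using neg by auto
  ultimately have "{P, Q} = {P1, Q1}" by auto
  then show ?thesis using that[OF e(1,2,3)] by (simp add: P1_def Q1_def)
qed

lemma seg_ends_unique:
  assumes "seg P Q \<in> boundary_segments (range line)" "seg P Q = seg P' Q'"
  shows "{P, Q} = {P', Q'}"
proof -
  obtain i j k l where 1: "nxt i j k" "nxt i k l" "seg P Q = line k \<inter> R i" "{P, Q} = {V j k, V k l}"
    using boundary_segment_ends[OF assms(1)] .
  obtain i' j' k' l' where 2: "nxt i' j' k'" "nxt i' k' l'" "seg P' Q' = line k' \<inter> R i'"
    "{P', Q'} = {V j' k', V k' l'}"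
    using boundary_segment_ends[OF assms(1)[unfolded assms(2)]] .
  have "{P, Q} = seg P Q \<inter> intersection_points (range line)" using edge_vertices[OF 1(1,2)] 1(3,4) by simp
  moreover have "{P', Q'} = seg P' Q' \<inter> intersection_points (range line)"
    using edge_vertices[OF 2(1,2)] 2(3,4) by simp
  ultimately show ?thesis using assms(2) by simp
qed


lemma set_traversal:
  assumes T: "cyclic_traversal (range line) T"
  shows "set T = {P. \<exists>Q. seg P Q \<in> boundary_segments (range line)}"
proof
  let ?N = "length T"
  let ?g = "\<lambda>i. seg (T ! i) (T ! (Suc i mod ?N))"
  have img: "?g ` {..<?N} = boundary_segments (range line)"
    using T unfolding cyclic_traversal_def bij_betw_def by blast
  show "set T \<subseteq> {P. \<exists>Q. seg P Q \<in> boundary_segments (range line)}"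
  proof
    fix P assume "P \<in> set T"
    then obtain i where i: "i < ?N" "P = T ! i" by (metis in_set_conv_nth)
    then have "?g i \<in> boundary_segments (range line)" using img by blast
    then show "P \<in> {P. \<exists>Q. seg P Q \<in> boundary_segments (range line)}" using i by blast
  qed
  show "{P. \<exists>Q. seg P Q \<in> boundary_segments (range line)} \<subseteq> set T"
  proof
    fix P assume "P \<in> {P. \<exists>Q. seg P Q \<in> boundary_segments (range line)}"
    then obtain Q where PQ: "seg P Q \<in> boundary_segments (range line)" by blast
    then have "seg P Q \<in> ?g ` {..<?N}" unfolding img .
    then obtain i where "seg P Q = ?g i" "i \<in> {..<?N}" by (rule imageE)
    then have i: "i < ?N" "seg P Q = ?g i" by simp_all
    have "{P, Q} = {T ! i, T ! (Suc i mod ?N)}" by (rule seg_ends_unique[OF PQ i(2)])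
    moreover have "0 < ?N" using i(1) by linarith
    then have "T ! i \<in> set T" "T ! (Suc i mod ?N) \<in> set T"
      using nth_mem[OF i(1)] nth_mem[of "Suc i mod ?N" T] mod_less_divisor[of ?N "Suc i"] by blast+
    ultimately show "P \<in> set T" by (metis insertI1 insertE singletonD)
  qed
qed

subsection \<open>Non-outer points and the traversal\<close>

lemma outer_point_first: assumes "nxt i (i+1) k" shows "outer_point (range line) (V (i+1) k)"
  unfolding outer_point_def
  using V_intersection[OF assms] first_vertex_end[OF assms] nxt_V_on[OF assms]
  by (metis mem_line rangeI)

lemma outer_point_last: assumes "nxt i k (i+n)" shows "outer_point (range line) (V k (i+n))"
  unfolding outer_point_def
  using V_intersection[OF assms] last_vertex_end[OF assms] nxt_V_on[OF assms]
  by (metis mem_line rangeI)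

text \<open>Both \<open>i+n\<close> and \<open>i+1+n\<close> lie strictly between \<open>l\<close>
  and \<open>l+n\<close>, and their forms have opposite signs at \<open>P\<close>. So line
  \<open>l\<close> has crossings on both sides of \<open>P\<close>.\<close>

lemma not_end_inner:
  assumes "P \<in> R i" "f l P = 0" "f (i+1) P < 0" "f (i+n) P < 0" "i + 1 < l" "l < i + n"
  shows "\<not> end_of P (line l \<inter> intersection_points (range line))"
proof
  assume "end_of P (line l \<inter> intersection_points (range line))"
  from end_ofD[OF assms(2) this] show False
  proof
    assume *: "\<forall>k. l < k \<and> k < l + n \<longrightarrow> f k P \<le> 0"
    have "f (i+1+n) P \<le> 0" using * assms(5,6) by simp
    then show False using assms(3) f_anti[of "i+1" P] by simp
  next
    assume *: "\<forall>k. l < k \<and> k < l + n \<longrightarrow> f k P \<ge> 0"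
    have "f (i+n) P \<ge> 0" using * assms(5,6) by simp
    then show False using assms(4) by simp
  qed
qed

lemma non_outer_W: assumes "card (C i) = 4" shows "non_outer_point (range line) (W i)"
proof -
  note o = card_C_4D[OF assms]
  note nx = nxt_a_b[OF o(2)]
  have neg: "f (i+1) (W i) < 0" "f (i+n) (W i) < 0"
    using V_neg[OF nx, of "i+1"] V_neg[OF nx, of "i+n"] o n3 by (auto simp: W_def)
  have WR: "W i \<in> R i" using V_in_R[OF nx] by (simp add: W_def)
  have z: "f (a i) (W i) = 0" "f (b i) (W i) = 0" using nxt_V_on[OF nx] by (auto simp: W_def)
  have "\<not> end_of (W i) (line (a i) \<inter> intersection_points (range line))"
    by (rule not_end_inner[OF WR z(1) neg]) (use o in auto)
  moreover have "\<not> end_of (W i) (line (b i) \<inter> intersection_points (range line))"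
    by (rule not_end_inner[OF WR z(2) neg]) (use o in auto)
  moreover have "L = line (a i) \<or> L = line (b i)" if "L \<in> range line" "W i \<in> L" for L
    using V_lines[OF nx] that by (simp add: W_def)
  ultimately show ?thesis
    using V_intersection[OF nx] unfolding non_outer_point_def outer_point_def W_def by metis
qed

text \<open>Vertices on the ray lines are outer, and only with four lines is there a vertex on
  neither of them.\<close>

lemma non_outer_vertex:
  assumes "nxt i j k" "non_outer_point (range line) (V j k)" shows "card (C i) = 4 \<and> V j k = W i"
proof -
  have "j \<noteq> i + 1" "k \<noteq> i + n"
    using outer_point_first[of i k] outer_point_last[of i j] assms by (auto simp: non_outer_point_def)
  moreover have jk: "j \<in> C i" "k \<in> C i" "j < k" using assms(1) by (auto simp: nxt_def)
  moreover have "j \<noteq> i + n" "k \<noteq> i + 1" using nxt_D[OF assms(1)] by auto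
  ultimately have in_ab: "j \<noteq> i + 1" "k \<noteq> i + n" "j \<noteq> i + n" "k \<noteq> i + 1" by auto
  show ?thesis
  proof (cases i rule: C_cases)
    case two then show ?thesis using jk in_ab by auto
  next
    case (three m) then show ?thesis using jk in_ab by auto
  next
    case four
    then have "j = a i" "k = b i" using jk in_ab by auto
    moreover have "card (C i) = 4" using four by auto
    ultimately show ?thesis by (simp add: W_def)
  qed
qed

lemma W_boundary_end:
  assumes "card (C i) = 4" obtains Q where "seg (W i) Q \<in> boundary_segments (range line)"
proof -
  note o = card_C_4D[OF assms]
  note nx = nxt_a_b[OF o(2)]
  have aC: "a i \<in> C i" by (simp add: C_def)
  obtain j where j: "nxt i j (a i)" using prev_ex[OF aC] o by auto
  have "line (a i) \<inter> R i \<in> bounded_edges i" using aC o unfolding bounded_edges_def by fastforce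
  moreover have "line (a i) \<inter> R i = seg (W i) (V j (a i))"
    using edge_seg[OF j nx] seg_commute by (simp add: W_def)
  ultimately show ?thesis using that bounded_edge_boundary_segment by metis
qed

lemma card_non_outer_on_traversal:
  assumes "cyclic_traversal (range line) T"
  shows "card {P \<in> set T. non_outer_point (range line) P} = card {i\<in>{0..<2*n}. card (C i) = 4}"
proof -
  have "{P \<in> set T. non_outer_point (range line) P} = {P. \<exists>i. card (C i) = 4 \<and> P = W i}"
  proof (intro set_eqI iffI)
    fix P assume "P \<in> {P \<in> set T. non_outer_point (range line) P}"
    then obtain Q where PQ: "seg P Q \<in> boundary_segments (range line)" and no: "non_outer_point (range line) P"
      using set_traversal[OF assms] by blast
    obtain i j k l where e: "nxt i j k" "nxt i k l" "{P, Q} = {V j k, V k l}"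
      using boundary_segment_ends[OF PQ] by metis
    then have "P = V j k \<or> P = V k l" by blast
    then show "P \<in> {P. \<exists>i. card (C i) = 4 \<and> P = W i}"
      using non_outer_vertex[OF e(1)] non_outer_vertex[OF e(2)] no by blast
  next
    fix P assume "P \<in> {P. \<exists>i. card (C i) = 4 \<and> P = W i}"
    then obtain i where i: "card (C i) = 4" "P = W i" by blast
    then show "P \<in> {P \<in> set T. non_outer_point (range line) P}"
      using W_boundary_end[OF i(1)] non_outer_W[OF i(1)] set_traversal[OF assms] by blast
  qed
  then show ?thesis unfolding image_W_card using card_image[OF inj_W[of 4]] by simp
qed

section \<open>Assembling the traversal\<close>

lemma vertex_join:
  assumes "nxt i (i+1) k" "nxt (i+1) k' (i+1+n)" shows "V (i+1) k = V k' (i+1+n)"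
proof -
  let ?P = "V (i+1) k" and ?Q = "V k' (i+1+n)"
  have k: "i + 1 < k" "k \<le> i + n" "i + 1 < k'" "k' \<le> i + n" using nxt_D[OF assms(1)] nxt_D[OF assms(2)] by auto
  have z: "f (i+1) ?P = 0" "f k ?P = 0" "f (i+1) ?Q = 0" "f k' ?Q = 0"
    using nxt_V_on[OF assms(1)] nxt_V_on[OF assms(2)] f_anti[of "i+1" ?Q] by auto
  have le: "f k' ?P \<le> 0" "f k ?Q \<le> 0"
    using V_in_R[OF assms(1)] V_in_R[OF assms(2)] k by (auto simp: R_def)
  have D: "D k (i+1) < 0" "D k' (i+1) < 0"
    using D_pos[of "i+1" k] D_pos[of "i+1" k'] D_swap[of k "i+1"] D_swap[of k' "i+1"] k by auto
  \<comment> \<open>The position of \<open>?P\<close> relative to \<open>?Q\<close> along line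
    \<open>i+1\<close>. Each is the last intersection point in this direction:
    \<open>f k ?Q \<le> 0\<close> gives \<open>t \<le> 0\<close>, and \<open>f k' ?P \<le> 0\<close>
    gives \<open>t \<ge> 0\<close>.\<close>
  define t where "t = (f k ?P - f k ?Q) / D k (i+1)"
  have P: "?P = (fst ?Q + t * p (i+1), snd ?Q + t * q (i+1))"
    unfolding t_def by (rule line_param) (use D z in auto)
  have t: "t \<le> 0" using le z D unfolding t_def by (simp add: divide_nonpos_neg)
  have "f k' ?P = t * D k' (i+1)" using arg_cong[OF P, of "f k'"] z unfolding f_move by simp
  then have "t * D k' (i+1) \<le> 0" using le by simp
  then have "t = 0" using t D(2) by (metis less_le mult_neg_neg not_le)
  then show ?thesis using P by simp
qed

text \<open>The walk goes backwards through \<open>C i\<close>, from the vertex on line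
  \<open>i+n\<close> to the one on line \<open>i+1\<close>, so that by \<open>vertex_join\<close> it
  ends where the walk of \<open>R (i+1)\<close> starts. With two lines it is a single vertex without
  edges.\<close>

lemma region_walk:
  obtains vs where "vs \<noteq> []" "\<exists>k. nxt i k (i+n) \<and> hd vs = V k (i+n)"
    "\<exists>k. nxt i (i+1) k \<and> last vs = V (i+1) k"
    "distinct (walk_edges vs)" "set (walk_edges vs) = bounded_edges i"
proof (cases i rule: C_cases)
  case two
  have nx: "nxt i (i+1) (i+n)" unfolding nxt_def two using n3 by auto
  have "bounded_edges i = {}" unfolding bounded_edges_def two by auto
  then show ?thesis using nx by (intro that[of "[V (i+1) (i+n)]"]) auto
next
  case (three m)
  have nx: "nxt i (i+1) m" "nxt i m (i+n)" unfolding nxt_def three(3) using three(1,2) by auto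
  have "bounded_edges i = {line m \<inter> R i}" unfolding bounded_edges_def three(3) using three(1,2) by auto
  moreover have "line m \<inter> R i = seg (V m (i+n)) (V (i+1) m)" using edge_seg[OF nx] seg_commute by metis
  ultimately show ?thesis using nx by (intro that[of "[V m (i+n), V (i+1) m]"]) auto
next
  case four
  have nx: "nxt i (i+1) (a i)" "nxt i (a i) (b i)" "nxt i (b i) (i+n)"
    unfolding nxt_def four(4) using four(1-3) by auto
  have be: "bounded_edges i = {line (b i) \<inter> R i, line (a i) \<inter> R i}"
    unfolding bounded_edges_def four(4) using four(1-3) by auto
  have s: "line (b i) \<inter> R i = seg (V (b i) (i+n)) (V (a i) (b i))"
    "line (a i) \<inter> R i = seg (V (a i) (b i)) (V (i+1) (a i))"
    using edge_seg[OF nx(1,2)] edge_seg[OF nx(2,3)] seg_commute by metis+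
  have "f (b i) (V (i+1) (a i)) < 0" using V_neg[OF nx(1), of "b i"] b_in four by auto
  then have "V (i+1) (a i) \<notin> line (b i) \<inter> R i" by simp
  moreover have "V (i+1) (a i) \<in> line (a i) \<inter> R i" using V_in_R[OF nx(1)] nxt_V_on[OF nx(1)] by simp
  ultimately have "line (b i) \<inter> R i \<noteq> line (a i) \<inter> R i" by blast
  then show ?thesis using nx be s
    by (intro that[of "[V (b i) (i+n), V (a i) (b i), V (i+1) (a i)]"]) auto
qed

lemma traversal_ex: "\<exists>T. cyclic_traversal (range line) T"
proof -
  have "\<exists>vs. vs \<noteq> [] \<and> (\<exists>k. nxt i k (i+n) \<and> hd vs = V k (i+n)) \<and>
    (\<exists>k. nxt i (i+1) k \<and> last vs = V (i+1) k) \<and>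
    distinct (walk_edges vs) \<and> set (walk_edges vs) = bounded_edges i" for i
    by (rule region_walk[of i]) blast
  then obtain vs where vs: "\<And>i. vs i \<noteq> []" "\<And>i. \<exists>k. nxt i k (i+n) \<and> hd (vs i) = V k (i+n)"
    "\<And>i. \<exists>k. nxt i (i+1) k \<and> last (vs i) = V (i+1) k"
    "\<And>i. distinct (walk_edges (vs i))" "\<And>i. set (walk_edges (vs i)) = bounded_edges i"
    by metis
  have join: "last (vs i) = hd (vs (i+1))" for i
    using vs(3)[of i] vs(2)[of "i+1"] vertex_join by metis
  \<comment> \<open>Indices 0 and 2n name the same region but were given walks independently; the
    starts agree, being the only intersection point of the region on its last ray line.\<close>
  have closed: "hd (vs (2*n)) = hd (vs 0)"
  proof -
    obtain k where k: "nxt 0 k (0+n)" "hd (vs 0) = V k (0+n)" using vs(2)[of 0] by blast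
    obtain k' where k': "nxt (2*n) k' (2*n+n)" "hd (vs (2*n)) = V k' (2*n+n)" using vs(2)[of "2*n"] by blast
    have "line (2*n+n) = line (0+n)" by (rule line_eq_of_dvd) simp
    moreover have "R (2*n) = R 0" using R_periodic[of 0] by simp
    ultimately show ?thesis using last_vertex(1)[OF k(1)] last_vertex(1)[OF k'(1)] k(2) k'(2) by simp
  qed
  let ?g = "\<lambda>j. walk_edges (vs (int j))"
  have walk: "\<exists>U. U \<noteq> [] \<and> hd U = hd (vs 0) \<and> last U = last (vs (int m)) \<and>
      walk_edges U = concat (map ?g [0..<Suc m])" for m
  proof (induction m)
    case 0
    show ?case using vs(1) by (intro exI[of _ "vs 0"]) simp
  next
    case (Suc m)
    then obtain U where U: "U \<noteq> []" "hd U = hd (vs 0)" "last U = last (vs (int m))"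
      "walk_edges U = concat (map ?g [0..<Suc m])" by blast
    let ?v = "vs (int (Suc m))"
    have j: "last U = hd ?v" using U(3) join[of "int m"] by (simp add: add.commute)
    have "walk_edges (U @ tl ?v) = concat (map ?g [0..<Suc (Suc m)])"
      using walk_edges_append[OF U(1) vs(1) j] U(4) by simp
    moreover have "last (U @ tl ?v) = last ?v"
      using j vs(1)[of "int (Suc m)"] by (cases ?v) auto
    ultimately show ?case using U(1,2) by (intro exI[of _ "U @ tl ?v"]) simp
  qed
  define N where "N = nat (2 * n)"
  have N: "int N = 2 * n" "N > 0" using n3 by (auto simp: N_def)
  obtain U where U: "U \<noteq> []" "hd U = hd (vs 0)" "last U = last (vs (int (N - 1)))"
    "walk_edges U = concat (map ?g [0..<N])" using walk[of "N - 1"] N(2) by auto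
  have "int (N - 1) + 1 = 2 * n" using N by simp
  then have hl: "hd U = last U" using U(2,3) join[of "int (N - 1)"] closed by simp
  have "distinct (walk_edges U)" unfolding U(4)
  proof (rule distinct_concat_map)
    fix i j assume ij: "i < j" "j < N"
    then have "R (int i) \<noteq> R (int j)" using R_distinct[of "int i" "int j"] N(1) by simp
    then show "set (?g i) \<inter> set (?g j) = {}" using bounded_edges_disjoint unfolding vs(5) by blast
  qed (rule vs(4))
  then obtain T where T: "bij_betw (\<lambda>i. seg (T ! i) (T ! (Suc i mod length T))) {..<length T} (set (walk_edges U))"
    using closed_walk_bij[OF U(1) hl] by blast
  have "set (walk_edges U) = (\<Union>i\<in>{..<N}. bounded_edges (int i))"
    unfolding U(4) by (auto simp: vs(5))
  also have "\<dots> = (\<Union>i\<in>int ` {..<N}. bounded_edges i)" by blast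
  also have "int ` {..<N} = {0..<2*n}" using N(1) by (simp add: lessThan_atLeast0 image_int_atLeastLessThan)
  finally have "set (walk_edges U) = boundary_segments (range line)" by (simp add: boundary_segments_eq)
  then show ?thesis using T unfolding cyclic_traversal_def by auto
qed

lemma gonality_counts:
  assumes "int N = n"
  shows "(\<exists>T. cyclic_traversal (range line) T) \<and>
    (\<forall>T r k. cyclic_traversal (range line) T \<and>
       r = card {P. extreme_point (range line) P} \<and>
       k = card {P \<in> set T. non_outer_point (range line) P} \<longrightarrow>
         card {S. unbounded_gonality (range line) 2 S} = r \<and>
         card {S. unbounded_gonality (range line) 4 S} = k \<and>
         int (card {S. unbounded_gonality (range line) 3 S}) = 2 * int N - int r - int k \<and>
         (\<forall>m>4. \<not> (\<exists>S. unbounded_gonality (range line) m S)))"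
proof -
  let ?X = "\<lambda>m. {i\<in>{0..<2*n}. card (C i) = m}"
  have fin: "finite (?X m)" for m by (rule finite_subset[of _ "{0..<2*n}"]) auto
  have "{0..<2*n} = ?X 2 \<union> ?X 3 \<union> ?X 4" using card_C by auto
  then have "card {0..<2*n} = card (?X 2 \<union> ?X 3 \<union> ?X 4)" by (rule arg_cong)
  also have "\<dots> = card (?X 2 \<union> ?X 3) + card (?X 4)"
    by (rule card_Un_disjoint) (use fin in auto)
  also have "card (?X 2 \<union> ?X 3) = card (?X 2) + card (?X 3)"
    by (rule card_Un_disjoint) (use fin in auto)
  finally have sum: "2 * int N = int (card (?X 2)) + int (card (?X 3)) + int (card (?X 4))"
    using assms by simp
  have none: "\<not> unbounded_gonality (range line) m S" if "m > 4" for m S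
  proof
    assume "unbounded_gonality (range line) m S"
    then have "S \<in> R ` ?X m" using gonality_regions[of m] by blast
    then obtain i where "card (C i) = m" by blast
    then show False using card_C[of i] that by auto
  qed
  show ?thesis
    using traversal_ex sum none
    by (auto simp: card_gonality_regions card_extreme_points card_non_outer_on_traversal)
qed

end

subsection \<open>Directing and sorting the lines of an arrangement\<close>

text \<open>Directions are taken in a half-open half-plane, on which the sign of the cross product
  is a strict order.\<close>

lemma is_line_upper:
  fixes L :: "('a::linordered_field \<times> 'a) set"
  assumes "is_line L"
  obtains p q c where "q > 0 \<or> q = 0 \<and> p > 0" "L = {x. p * snd x - q * fst x - c = 0}"
proof -
  obtain a b c where ab: "(a, b) \<noteq> (0, 0)" and L: "L = {(x, y). a * x + b * y = c}"
    using assms unfolding is_line_def line_eq_def by blast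
  have L1: "L = {x. b * snd x - (- a) * fst x - c = 0}" unfolding L by (auto simp: algebra_simps)
  have L2: "L = {x. (- b) * snd x - a * fst x - (- c) = 0}" unfolding L by (auto simp: algebra_simps)
  show ?thesis
  proof (cases "- a > 0 \<or> - a = 0 \<and> b > 0")
    case True then show ?thesis by (rule that[OF _ L1])
  next
    case False
    then have "a > 0 \<or> a = 0 \<and> - b > 0" using ab by auto
    then show ?thesis by (rule that[OF _ L2])
  qed
qed

text \<open>The identity is the linear relation of three vectors in second coordinates. It can be
  divided by \<open>q2\<close>, because a direction with \<open>q2 = 0\<close> is the least one and
  has nothing before it.\<close>

lemma det_trans:
  fixes p1 :: "'a::linordered_field"
  assumes u: "q1 > 0 \<or> q1 = 0 \<and> p1 > 0" "q2 > 0 \<or> q2 = 0 \<and> p2 > 0" "q3 > 0 \<or> q3 = 0 \<and> p3 > 0"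
    and d: "p1 * q2 - q1 * p2 > 0" "p2 * q3 - q2 * p3 > 0"
  shows "p1 * q3 - q1 * p3 > 0"
proof -
  have q2: "q2 > 0"
  proof (rule ccontr)
    assume "\<not> ?thesis"
    then have "q2 = 0" "p2 > 0" using u(2) by auto
    then have "q1 * p2 < 0" using d(1) by simp
    then show False using \<open>p2 > 0\<close> u(1) by (auto simp: mult_less_0_iff)
  qed
  have nn: "q1 \<ge> 0" "q3 \<ge> 0" using u by auto
  have pos: "q1 > 0 \<or> q3 > 0"
  proof (rule ccontr)
    assume "\<not> ?thesis"
    then have "q3 = 0" "p3 > 0" using u by auto
    then show False using d(2) q2 by (auto simp: mult_less_0_iff)
  qed
  have id: "q2 * (p1 * q3 - q1 * p3) = q3 * (p1 * q2 - q1 * p2) + q1 * (p2 * q3 - q2 * p3)"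
    by (simp add: algebra_simps)
  have "q3 * (p1 * q2 - q1 * p2) \<ge> 0" "q1 * (p2 * q3 - q2 * p3) \<ge> 0" using nn d by simp_all
  moreover have "q3 * (p1 * q2 - q1 * p2) > 0 \<or> q1 * (p2 * q3 - q2 * p3) > 0"
    using pos d by auto
  ultimately have "q2 * (p1 * q3 - q1 * p3) > 0" unfolding id by linarith
  then show ?thesis using q2 by (simp add: zero_less_mult_iff)
qed

lemma det_nonzero:
  fixes p1 :: "'a::linordered_field"
  assumes L: "L1 = {x. p1 * snd x - q1 * fst x - c1 = 0}" "L2 = {x. p2 * snd x - q2 * fst x - c2 = 0}"
    and u: "q1 > 0 \<or> q1 = 0 \<and> p1 > 0" "q2 > 0 \<or> q2 = 0 \<and> p2 > 0"
    and ne: "L1 \<noteq> L2" "L1 \<inter> L2 \<noteq> {}"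
  shows "p1 * q2 - q1 * p2 \<noteq> 0"
proof
  assume d: "p1 * q2 - q1 * p2 = 0"
  have par: "p * e2 - q * e1 = 0"
    if "p' * e2 - q' * e1 = 0" "p' * q - q' * p = 0" "q' > 0 \<or> q' = 0 \<and> p' > 0"
    for p q p' q' e1 e2 :: 'a
  proof -
    have "p' * (p * e2 - q * e1) = p * (p' * e2 - q' * e1) - e1 * (p' * q - q' * p)"
      "q' * (p * e2 - q * e1) = q * (p' * e2 - q' * e1) - e2 * (p' * q - q' * p)"
      by (simp_all add: algebra_simps)
    then show ?thesis using that by auto
  qed
  obtain x where x: "p1 * snd x - q1 * fst x - c1 = 0" "p2 * snd x - q2 * fst x - c2 = 0"
    using ne(2) L by blast
  have "y \<in> L1 \<longleftrightarrow> y \<in> L2" for y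
  proof -
    have 1: "y \<in> L1 \<longleftrightarrow> p1 * (snd y - snd x) - q1 * (fst y - fst x) = 0"
      using x(1) unfolding L by (auto simp: algebra_simps)
    have 2: "y \<in> L2 \<longleftrightarrow> p2 * (snd y - snd x) - q2 * (fst y - fst x) = 0"
      using x(2) unfolding L by (auto simp: algebra_simps)
    have d': "p2 * q1 - q2 * p1 = 0" using d by (simp add: algebra_simps)
    show ?thesis unfolding 1 2 using par[OF _ d u(1)] par[OF _ d' u(2)] by blast
  qed
  then show False using ne(1) by blast
qed

text \<open>An intermediate value theorem that needs no completeness, as the root of an affine
  function is a quotient.\<close>

lemma affine_zero_between:
  fixes A :: "'a::linordered_field"
  assumes "A * fst z + B * snd z + E > 0" "A * fst x + B * snd x + E \<le> 0"
  obtains s where "0 < s" "s \<le> 1"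
    "A * (fst z + s * (fst x - fst z)) + B * (snd z + s * (snd x - snd z)) + E = 0"
proof
  let ?g = "\<lambda>w. A * fst w + B * snd w + E"
  let ?s = "?g z / (?g z - ?g x)"
  have d: "?g z - ?g x > 0" using assms by linarith
  show "0 < ?s" using assms(1) d by (rule divide_pos_pos)
  show "?s \<le> 1" using assms d by (simp add: divide_le_eq)
  have "A * (fst z + s * (fst x - fst z)) + B * (snd z + s * (snd x - snd z)) + E = ?g z - s * (?g z - ?g x)"
    for s by (simp add: algebra_simps)
  also have "?g z - ?s * (?g z - ?g x) = 0" using d by simp
  finally show "A * (fst z + ?s * (fst x - fst z)) + B * (snd z + ?s * (snd x - snd z)) + E = 0" .
qed

lemma enumerate_strict_order:
  fixes S :: "'b set"
  assumes fin: "finite S" and total: "\<And>x y. x \<in> S \<Longrightarrow> y \<in> S \<Longrightarrow> x \<noteq> y \<Longrightarrow> lt x y \<or> lt y x"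
    and irrefl: "\<And>x. \<not> lt x x"
    and trans: "\<And>x y z. x \<in> S \<Longrightarrow> y \<in> S \<Longrightarrow> z \<in> S \<Longrightarrow> lt x y \<Longrightarrow> lt y z \<Longrightarrow> lt x z"
  obtains e where "bij_betw e {..<card S} S" "\<And>i j. i < j \<Longrightarrow> j < card S \<Longrightarrow> lt (e i) (e j)"
proof -
  define r where "r x = card {y\<in>S. lt y x}" for x
  have less: "r x < r y" if "x \<in> S" "y \<in> S" "lt x y" for x y
    unfolding r_def
  proof (rule psubset_card_mono)
    show "{z\<in>S. lt z x} \<subset> {z\<in>S. lt z y}"
      using trans[OF _ that(1,2) _ that(3)] that irrefl[of x] by blast
  qed (use fin in simp)
  have inj: "inj_on r S"
    by (rule inj_onI) (metis less total less_irrefl)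
  have "r x < card S" if "x \<in> S" for x
    unfolding r_def using that irrefl[of x] fin by (intro psubset_card_mono) auto
  then have "r ` S \<subseteq> {..<card S}" by blast
  then have "r ` S = {..<card S}" using card_image[OF inj] by (intro card_subset_eq) auto
  then have bij: "bij_betw r S {..<card S}" using inj by (simp add: bij_betw_def)
  let ?e = "inv_into S r"
  have bije: "bij_betw ?e {..<card S} S" by (rule bij_betw_inv_into[OF bij])
  have re: "r (?e i) = i" "?e i \<in> S" if "i < card S" for i
    using that bij_betw_inv_into_right[OF bij] bij_betwE[OF bije] by auto
  have "lt (?e i) (?e j)" if ij: "i < j" "j < card S" for i j
  proof -
    have e: "r (?e i) = i" "?e i \<in> S" "r (?e j) = j" "?e j \<in> S" using re ij by auto
    then have "\<not> lt (?e j) (?e i)" using less[of "?e j" "?e i"] ij by auto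
    moreover have "?e i \<noteq> ?e j" using e ij by auto
    ultimately show ?thesis using total[of "?e i" "?e j"] e by blast
  qed
  then show ?thesis using that bije by blast
qed

text \<open>Here \<open>z\<close> is an interior point of the polygon, \<open>J k\<close> records
  its side of line \<open>k\<close>, and \<open>h k\<close> is the midpoint of the side of the
  polygon on that line.\<close>

lemma arrangement_polygon_lines:
  fixes \<L> :: "('a::linordered_field \<times> 'a) set set"
  assumes n: "n \<ge> 3" and arr: "line_arrangement \<L>" and card: "card \<L> = n" and G: "full_gonality \<L> G"
  obtains p q c J h where "polygon_lines (int n) p q c J h" "\<L> = range (polygon_lines.line p q c)"
proof -
  have fin: "finite \<L>" and lines: "\<And>L. L \<in> \<L> \<Longrightarrow> is_line L"
    and meet: "\<And>L M. L \<in> \<L> \<Longrightarrow> M \<in> \<L> \<Longrightarrow> L \<noteq> M \<Longrightarrow> L \<inter> M \<noteq> {}"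
    using arr unfolding line_arrangement_def by auto
  define ok where "ok L t \<longleftrightarrow> (fst (snd t) > 0 \<or> fst (snd t) = 0 \<and> fst t > 0) \<and>
    L = {x. fst t * snd x - fst (snd t) * fst x - snd (snd t) = 0}" for L and t :: "'a \<times> 'a \<times> 'a"
  define P where "P L = fst (SOME t. ok L t)" for L
  define Q where "Q L = fst (snd (SOME t. ok L t))" for L
  define E where "E L = snd (snd (SOME t. ok L t))" for L
  have "ok L (SOME t. ok L t)" if LL: "L \<in> \<L>" for L
  proof -
    obtain p q c where "q > 0 \<or> q = 0 \<and> p > 0" "L = {x. p * snd x - q * fst x - c = 0}"
      by (rule is_line_upper[OF lines[OF LL]])
    then have "ok L (p, q, c)" by (simp add: ok_def)
    then show ?thesis by (rule someI)
  qed
  then have up: "Q L > 0 \<or> Q L = 0 \<and> P L > 0"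
    and L: "L = {x. P L * snd x - Q L * fst x - E L = 0}" if "L \<in> \<L>" for L
    using that unfolding ok_def P_def Q_def E_def by blast+
  define lt where "lt L M \<longleftrightarrow> P L * Q M - Q L * P M > 0" for L M
  obtain e where e: "bij_betw e {..<n} \<L>" and elt: "\<And>i j. i < j \<Longrightarrow> j < n \<Longrightarrow> lt (e i) (e j)"
  proof (rule enumerate_strict_order[OF fin, of lt])
    fix L M assume LM: "L \<in> \<L>" "M \<in> \<L>" "L \<noteq> M"
    have "P L * Q M - Q L * P M \<noteq> 0"
      by (rule det_nonzero[OF L[OF LM(1)] L[OF LM(2)] up[OF LM(1)] up[OF LM(2)] LM(3) meet[OF LM]])
    then show "lt L M \<or> lt M L" unfolding lt_def by (auto simp: algebra_simps)
  next
    show "\<not> lt L L" for L by (simp add: lt_def)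
  next
    fix L M N assume "L \<in> \<L>" "M \<in> \<L>" "N \<in> \<L>" "lt L M" "lt M N"
    then show "lt L N" using det_trans[OF up up up] unfolding lt_def by blast
  next
    fix e assume "bij_betw e {..<card \<L>} \<L>" "\<And>i j. i < j \<Longrightarrow> j < card \<L> \<Longrightarrow> lt (e i) (e j)"
    then show thesis using that card by simp
  qed
  let ?n = "int n"
  \<comment> \<open>The sorted lines are repeated with period n, and \<open>sg\<close> reverses all
    directions from one period to the next.\<close>
  define K where "K k = e (nat (k mod ?n))" for k
  define sg :: "int \<Rightarrow> 'a" where "sg k = (if even (k div ?n) then 1 else -1)" for k
  define p where "p k = sg k * P (K k)" for k
  define q where "q k = sg k * Q (K k)" for k
  define c where "c k = sg k * E (K k)" for k
  define f where "f k x = p k * snd x - q k * fst x - c k" for k x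
  have n0: "?n > 0" using n by simp
  have modn: "nat (k mod ?n) < n" for k using n0 by (simp add: nat_less_iff)
  have KL: "K k \<in> \<L>" for k unfolding K_def using bij_betwE[OF e] modn by simp
  have Kf: "x \<in> K k \<longleftrightarrow> f k x = 0" for x k
  proof -
    have "f k x = sg k * (P (K k) * snd x - Q (K k) * fst x - E (K k))"
      by (simp add: f_def p_def q_def c_def algebra_simps)
    moreover have "sg k \<noteq> 0" by (simp add: sg_def)
    ultimately show ?thesis using L[OF KL[of k]] by auto
  qed
  have divn: "(k + ?n) div ?n = k div ?n + 1" for k using n0 by (intro div_add_self2) simp
  have Kn: "K (k + ?n) = K k" and sgn: "sg (k + ?n) = - sg k" for k
    unfolding sg_def divn by (simp_all add: K_def)
  have Keq: "?n dvd j - k" if "K j = K k" for j k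
  proof -
    have "nat (j mod ?n) = nat (k mod ?n)"
      using that bij_betw_imp_inj_on[OF e] modn unfolding K_def by (auto dest: inj_onD)
    then have "j mod ?n = k mod ?n" using n0 by (simp add: eq_nat_nat_iff)
    then show ?thesis by (simp add: mod_eq_dvd_iff)
  qed
  have rK: "range K = \<L>"
  proof
    show "\<L> \<subseteq> range K"
    proof
      fix M assume "M \<in> \<L>"
      then obtain i where i: "i < n" "M = e i" using bij_betw_imp_surj_on[OF e] by blast
      then have "K (int i) = M" by (simp add: K_def)
      then show "M \<in> range K" by blast
    qed
  qed (use KL in auto)
  have Dpos: "p j * q k - q j * p k > 0" if jk: "j < k" "k < j + ?n" for j k
  proof -
    have D: "p j * q k - q j * p k = (sg j * sg k) * (P (K j) * Q (K k) - Q (K j) * P (K k))"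
      by (simp add: p_def q_def algebra_simps)
    let ?r = "j div ?n" and ?s = "k div ?n"
    have dm: "j = ?n * ?r + j mod ?n" "k = ?n * ?s + k mod ?n" by simp_all
    have bd: "0 \<le> j mod ?n" "j mod ?n < ?n" "0 \<le> k mod ?n" "k mod ?n < ?n" using n0 by simp_all
    have "?r \<le> ?s" using jk(1) n0 by (simp add: zdiv_mono1)
    moreover have "?s \<le> (j + ?n) div ?n" using jk(2) n0 by (intro zdiv_mono1) auto
    then have "?s \<le> ?r + 1" unfolding divn .
    ultimately consider "?s = ?r" | "?s = ?r + 1" by linarith
    then show ?thesis
    proof cases
      case 1
      then have "?n * ?s = ?n * ?r" by simp
      then have "j mod ?n < k mod ?n" using dm jk(1) by linarith
      then have "nat (j mod ?n) < nat (k mod ?n)" using bd by (simp only: nat_less_eq_zless)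
      then have "lt (K j) (K k)" unfolding K_def by (rule elt[OF _ modn])
      moreover have "sg j * sg k = 1" using 1 by (simp add: sg_def)
      ultimately show ?thesis unfolding D lt_def by simp
    next
      \<comment> \<open>In the next period both the order of the residues and the sign are reversed,
        and the two changes cancel.\<close>
      case 2
      then have "?n * ?s = ?n * ?r + ?n" by (simp add: distrib_left)
      then have "k mod ?n < j mod ?n" using dm jk(2) by linarith
      then have "nat (k mod ?n) < nat (j mod ?n)" using bd by (simp only: nat_less_eq_zless)
      then have "lt (K k) (K j)" unfolding K_def by (rule elt[OF _ modn])
      moreover have "sg j * sg k = -1" using 2 by (simp add: sg_def)
      ultimately show ?thesis unfolding D lt_def by (simp add: algebra_simps)
    qed
  qed
  have reg: "region \<L> G" and unb: "\<not> contains_ray G"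
    and sides: "\<And>L. L \<in> \<L> \<Longrightarrow> \<exists>P Q. adjacent_points \<L> L P Q \<and> L \<inter> G = seg P Q"
    using G unfolding full_gonality_def bounded_region_def by auto
  obtain a b d \<epsilon> where *: "(\<forall>L\<in>\<L>. line_eq (a L) (b L) (d L) L \<and> \<epsilon> L \<in> {-1, 1}) \<and>
      G = {(x, y). \<forall>L\<in>\<L>. \<epsilon> L * (a L * x + b L * y - d L) \<ge> 0} \<and>
      (\<exists>x y. \<forall>L\<in>\<L>. \<epsilon> L * (a L * x + b L * y - d L) > 0)"
    using reg unfolding region_def by (elim exE) (rule that)
  define A where "A L = \<epsilon> L * a L" for L
  define B where "B L = \<epsilon> L * b L" for L
  define F where "F L = - \<epsilon> L * d L" for L
  have g: "\<epsilon> L * (a L * x + b L * y - d L) = A L * x + B L * y + F L" for L x y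
    by (simp add: A_def B_def F_def algebra_simps)
  have on: "A L * fst x + B L * snd x + F L = 0 \<longleftrightarrow> x \<in> L" if "L \<in> \<L>" for L x
  proof -
    have "line_eq (a L) (b L) (d L) L" "\<epsilon> L \<noteq> 0" using * that by auto
    then show ?thesis unfolding g[symmetric] line_eq_def by (cases x) auto
  qed
  have Gx: "x \<in> G \<longleftrightarrow> (\<forall>L\<in>\<L>. A L * fst x + B L * snd x + F L \<ge> 0)" for x
    using * unfolding g by (cases x) simp
  obtain z where z: "\<And>L. L \<in> \<L> \<Longrightarrow> A L * fst z + B L * snd z + F L > 0"
    using * unfolding g by (metis fst_conv snd_conv)
  have fz: "f k z \<noteq> 0" for k using z[OF KL] on[OF KL] Kf by (metis less_irrefl)
  \<comment> \<open>A change of sign would put a point of the line strictly before \<open>m\<close>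
    on the way from \<open>z\<close>, where the inequality that defines \<open>G\<close> is still
    strict.\<close>
  have same_side: "f k z > 0 \<longleftrightarrow> f k m > 0" if m: "m \<in> G" "f k m \<noteq> 0" for k m
  proof (rule ccontr)
    assume neq: "\<not> ?thesis"
    have "\<exists>s. 0 < s \<and> s \<le> 1 \<and> f k (fst z + s * (fst m - fst z), snd z + s * (snd m - snd z)) = 0"
    proof (cases "f k z > 0")
      case True
      then have "(- q k) * fst z + p k * snd z + (- c k) > 0" "(- q k) * fst m + p k * snd m + (- c k) \<le> 0"
        using neq by (auto simp: f_def)
      then obtain s where s: "0 < s" "s \<le> 1" "(- q k) * (fst z + s * (fst m - fst z)) +
          p k * (snd z + s * (snd m - snd z)) + (- c k) = 0" by (rule affine_zero_between)
      have "f k (fst z + s * (fst m - fst z), snd z + s * (snd m - snd z)) = 0"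
        using s(3) by (simp add: f_def algebra_simps)
      then show ?thesis using s(1,2) by blast
    next
      case False
      then have "q k * fst z + (- p k) * snd z + c k > 0" "q k * fst m + (- p k) * snd m + c k \<le> 0"
        using neq fz[of k] by (auto simp: f_def)
      then obtain s where s: "0 < s" "s \<le> 1" "q k * (fst z + s * (fst m - fst z)) +
          (- p k) * (snd z + s * (snd m - snd z)) + c k = 0" by (rule affine_zero_between)
      have "f k (fst z + s * (fst m - fst z), snd z + s * (snd m - snd z)) = 0"
        using s(3) by (simp add: f_def algebra_simps)
      then show ?thesis using s(1,2) by blast
    qed
    then obtain s where s: "0 < s" "s \<le> 1" "f k (fst z + s * (fst m - fst z), snd z + s * (snd m - snd z)) = 0"
      (is "f k ?y = 0") by blast
    have "s \<noteq> 1" using s(3) m(2) by auto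
    then have "s < 1" using s by simp
    let ?g = "\<lambda>w. A (K k) * fst w + B (K k) * snd w + F (K k)"
    have "?g ?y = (1 - s) * ?g z + s * ?g m" by (simp add: algebra_simps)
    moreover have "?g m \<ge> 0" using m(1) Gx KL by blast
    ultimately have "?g ?y > 0" using z[OF KL[of k]] s \<open>s < 1\<close> by (simp add: add_pos_nonneg)
    then show False using on[OF KL[of k], of ?y] Kf[of ?y k] s(3) by (metis less_irrefl)
  qed
  have "\<exists>m. m \<in> L \<inter> G \<and> (\<forall>M\<in>\<L>. M \<noteq> L \<longrightarrow> m \<notin> M)" if LL: "L \<in> \<L>" for L
  proof -
    obtain P Q where PQ: "adjacent_points \<L> L P Q" "L \<inter> G = seg P Q" using sides[OF LL] by blast
    let ?h = "1 / 2 :: 'a"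
    let ?m = "(fst P + ?h * (fst Q - fst P), snd P + ?h * (snd Q - snd P))"
    have ms: "?m \<in> seg P Q" unfolding seg_def mem_Collect_eq by (intro exI[of _ ?h]) simp
    have ne: "P \<noteq> Q" and ip: "seg P Q \<inter> intersection_points \<L> = {P, Q}"
      using PQ(1) unfolding adjacent_points_def by auto
    have mne: "?m \<noteq> P" "?m \<noteq> Q" using ne by (auto simp: prod_eq_iff field_simps)
    have "?m \<notin> M" if M: "M \<in> \<L>" "M \<noteq> L" for M
    proof
      assume "?m \<in> M"
      moreover have "?m \<in> L" using ms PQ(2) by blast
      ultimately have "?m \<in> intersection_points \<L>" using M LL unfolding intersection_points_def by blast
      then show False using ms ip mne by blast
    qed
    then show ?thesis using ms PQ(2) by blast
  qed
  then obtain H where H: "\<And>L. L \<in> \<L> \<Longrightarrow> H L \<in> L \<and> H L \<in> G"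
    "\<And>L M. L \<in> \<L> \<Longrightarrow> M \<in> \<L> \<Longrightarrow> M \<noteq> L \<Longrightarrow> H L \<notin> M"
    by (metis IntE)
  define h where "h k = H (K k)" for k
  define J where "J k \<longleftrightarrow> f k z > 0" for k
  have hne: "f j (h k) \<noteq> 0" if "\<not> ?n dvd j - k" for j k
    using H(2)[OF KL[of k] KL[of j]] Keq that Kf[of "h k" j] unfolding h_def by metis
  have hG: "h k \<in> G" for k unfolding h_def using H(1) KL by blast
  \<comment> \<open>If \<open>J\<close> fails on the window, \<open>z\<close> is to the right of all
    its lines and stays there when moved in the direction of line \<open>i\<close>. The ray crosses
    no line, so it remains in the bounded \<open>G\<close>.\<close>
  have Jex: "\<exists>j\<in>{i+1..i+?n}. J j" for i
  proof (rule ccontr)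
    assume no: "\<not> ?thesis"
    have neg: "f k z < 0" if "k \<in> {i+1..i+?n}" for k using no that fz[of k] unfolding J_def by (metis linorder_neqE_linordered_idom)
    have fy: "f k (fst z + t * p i, snd z + t * q i) < 0" if k: "k \<in> {i+1..i+?n}" and t: "t \<ge> 0" for k t
    proof -
      have pq: "p k * q i - q k * p i \<le> 0"
      proof (cases "k = i + ?n")
        case True then show ?thesis by (simp add: p_def q_def Kn sgn)
      next
        case False
        then have "p i * q k - q i * p k > 0" using k by (intro Dpos) auto
        then show ?thesis by (simp add: algebra_simps)
      qed
      have "f k (fst z + t * p i, snd z + t * q i) = f k z + t * (p k * q i - q k * p i)"
        by (simp add: f_def algebra_simps)
      then show ?thesis using neg[OF k] mult_nonneg_nonpos[OF t pq] by simp
    qed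
    have off: "(fst z + t * p i, snd z + t * q i) \<notin> L" if LL: "L \<in> \<L>" and t: "t \<ge> 0" for L t
    proof -
      obtain k0 where k0: "L = K k0" using LL rK by blast
      let ?k = "i + 1 + (k0 - i - 1) mod ?n"
      have "0 \<le> (k0 - i - 1) mod ?n" "(k0 - i - 1) mod ?n < ?n" using n0 by simp_all
      then have k: "?k \<in> {i+1..i+?n}" by simp
      have "?k mod ?n = k0 mod ?n" by (simp add: mod_simps)
      then have "K ?k = L" using k0 by (simp add: K_def)
      then show ?thesis using fy[OF k t] Kf by force
    qed
    have "ray z (p i, q i) \<subseteq> G"
    proof
      fix x assume "x \<in> ray z (p i, q i)"
      then obtain t where t: "t \<ge> 0" "x = (fst z + t * p i, snd z + t * q i)" unfolding ray_def by auto
      have "A L * fst x + B L * snd x + F L \<ge> 0" if LL: "L \<in> \<L>" for L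
      proof (rule ccontr)
        assume "\<not> ?thesis"
        then have le: "A L * fst x + B L * snd x + F L \<le> 0" by simp
        obtain s where s: "0 < s" "A L * (fst z + s * (fst x - fst z)) + B L * (snd z + s * (snd x - snd z)) + F L = 0"
          by (rule affine_zero_between[OF z[OF LL] le]) blast
        have "(fst z + (s * t) * p i, snd z + (s * t) * q i) \<in> L"
          using s(2) on[OF LL, of "(fst z + (s * t) * p i, snd z + (s * t) * q i)"] t(2)
          by (simp add: mult.assoc)
        then show False using off[OF LL, of "s * t"] s(1) t(1) by simp
      qed
      then show "x \<in> G" by (simp add: Gx)
    qed
    moreover have "(p i, q i) \<noteq> (0, 0)" using Dpos[of i "i+1"] n by auto
    ultimately show False using unb unfolding contains_ray_def by blast
  qed
  have loc: "polygon_lines ?n p q c J h"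
  proof
    show "?n \<ge> 3" using n by simp
    show "p (k + ?n) = - p k" "q (k + ?n) = - q k" "c (k + ?n) = - c k" for k
      by (simp_all add: p_def q_def c_def Kn sgn)
    show "j < k \<Longrightarrow> k < j + ?n \<Longrightarrow> 0 < p j * q k - q j * p k" for j k by (rule Dpos)
    show "p k * snd (h k) - q k * fst (h k) - c k = 0" for k
      using Kf[of "h k" k] H(1)[OF KL[of k]] by (simp add: h_def f_def)
    show "\<not> ?n dvd j - k \<Longrightarrow> J j \<Longrightarrow> 0 < p j * snd (h k) - q j * fst (h k) - c j" for j k
      using same_side[OF hG hne] unfolding J_def f_def by blast
    show "\<not> ?n dvd j - k \<Longrightarrow> \<not> J j \<Longrightarrow> p j * snd (h k) - q j * fst (h k) - c j < 0" for j k
      using same_side[OF hG hne, of j k] hne[of j k] unfolding J_def f_def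
      by (metis linorder_neqE_linordered_idom)
    show "\<exists>j\<in>{i+1..i+?n}. J j" for i by (rule Jex)
  qed
  have "polygon_lines.line p q c k = K k" for k
    unfolding polygon_lines.line_def[OF loc] using Kf[of _ k] by (auto simp: f_def)
  then have "\<L> = range (polygon_lines.line p q c)" using rK by (metis image_cong)
  then show ?thesis using that loc by blast
qed

theorem theorem5p8:
  fixes \<L> :: "('a::linordered_field \<times> 'a) set set" and n :: nat
  assumes "n \<ge> 3"
    and "line_arrangement \<L>"
    and "card \<L> = n"
    and "\<exists>G. full_gonality \<L> G"
  shows "(\<exists>T. cyclic_traversal \<L> T) \<and>
    (\<forall>T r k. cyclic_traversal \<L> T \<and>
       r = card {P. extreme_point \<L> P} \<and>
       k = card {P \<in> set T. non_outer_point \<L> P} \<longrightarrow>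
         card {R. unbounded_gonality \<L> 2 R} = r \<and>
         card {R. unbounded_gonality \<L> 4 R} = k \<and>
         int (card {R. unbounded_gonality \<L> 3 R}) = 2 * int n - int r - int k \<and>
         (\<forall>m>4. \<not> (\<exists>R. unbounded_gonality \<L> m R)))"
proof -
  obtain G where "full_gonality \<L> G" using assms(4) by blast
  then obtain p q c J h where loc: "polygon_lines (int n) p q c J h" and
    L: "\<L> = range (polygon_lines.line p q c)"
    using arrangement_polygon_lines[OF assms(1,2,3)] by metis
  show ?thesis unfolding L by (rule polygon_lines.gonality_counts[OF loc]) simp
qed

end
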